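(* Let $k$ be a field, $I$ a monomial ideal in $R=k[x_1,\dots,x_n]$, and let $I=J+K$ be an $x_p$-partition of $I$ in which all elements of $J$ are divisible by $x_p$ (for some $1\le p\le n$). If for all $i$ and all multidegrees $j$, $\beta_{i,j}(J\cap K)>0$ implies that $\beta_{i,j}(J)=0$, then $I=J+K$ is a Betti splitting. In particular, if the minimal graded free resolution of $J$ is linear, then $I=J+K$ is a Betti splitting.
   Context: $\mathcal{G}(L)$ denotes the unique set of minimal monomial generators of a monomial ideal $L$. The $x_p$-partition of $I$ is $I=J+K$ where $J$ is the ideal generated by all elements of $\mathcal{G}(I)$ divisible by $x_p$, and $K$ is the ideal generated by all other elements of $\mathcal{G}(I)$. $R$ carries the standard multigrading, in which $\deg x_i$ is the $i$-th unit vector of $\mathbb{N}^n$, and $\beta_{i,j}(L)=\dim_k\operatorname{Tor}^R_i(k,L)_j$ for a multidegree $j\in\mathbb{N}^n$, with $\beta_{-1,j}=0$. The minimal graded free resolution of $J$ is linear if, for some $d$, $J$ is generated in (total) degree $d$ and, in the standard grading, the $i$-th free module in the resolution is generated in degree $i+d$ for all $i$. Betti splitting: $I=J+K$ (with $\mathcal{G}(I)$ the disjoint union of $\mathcal{G}(J)$ and $\mathcal{G}(K)$) is a Betti splitting if $\beta_{i,j}(I)=\beta_{i,j}(J)+\beta_{i,j}(K)+\beta_{i-1,j}(J\cap K)$ for all $i\in\mathbb{N}$ and all multidegrees $j$ (hence also all degrees $j$ in the standard grading). *)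

theory Defs
  imports "HOL-Library.Poly_Mapping" Complex_Main
begin

section \<open>Polynomials and ideals\<close>

text \<open>
  Exponent vectors are elements of \<open>'n \<Rightarrow>\<^sub>0 nat\<close>, where the finite type \<open>'n\<close> indexes the
  variables, and polynomials are finitely supported functions on exponent vectors. The
  multiplication of \<open>\<Rightarrow>\<^sub>0\<close> is convolution, so \<open>('n, 'k) mpoly\<close> is the ring
  \<open>k[x\<^sub>1, \<dots>, x\<^sub>n]\<close>.
\<close>

type_synonym ('n, 'k) mpoly = "('n \<Rightarrow>\<^sub>0 nat) \<Rightarrow>\<^sub>0 'k"

definition monom :: "('n \<Rightarrow>\<^sub>0 nat) \<Rightarrow> ('n, 'k::field) mpoly" where
  "monom t = Poly_Mapping.single t 1"

definition var :: "'n \<Rightarrow> ('n, 'k::field) mpoly" where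
  "var p = monom (Poly_Mapping.single p 1)"

text \<open>
  An ideal is a subspace of the ring as a module over itself. This module is not
  interpreted globally, because the simp rule \<open>module.scale_scale\<close> would then be
  \<open>a * (b * x) = (a * b) * x\<close>, which loops with \<open>mult.assoc\<close>.
\<close>

lemma module_times: "module ((*) :: 'a::comm_ring_1 \<Rightarrow> 'a \<Rightarrow> 'a)"
  by standard (simp_all add: distrib_left distrib_right mult.assoc)

definition ideal_span :: "'a::comm_ring_1 set \<Rightarrow> 'a set" where
  "ideal_span S = module.span (*) S"

definition monomial_ideal :: "('n, 'k::field) mpoly set \<Rightarrow> bool" where
  "monomial_ideal L \<longleftrightarrow> (\<exists>G \<subseteq> range monom. L = ideal_span G)"

definition minimal_monomial_generators :: "('n, 'k::field) mpoly set \<Rightarrow> ('n, 'k) mpoly set \<Rightarrow> bool" where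
  "minimal_monomial_generators G L \<longleftrightarrow>
     G \<subseteq> range monom \<and> ideal_span G = L \<and> (\<forall>H. H \<subset> G \<longrightarrow> ideal_span H \<noteq> L)"

definition mingens :: "('n, 'k::field) mpoly set \<Rightarrow> ('n, 'k) mpoly set" where
  "mingens L = (THE G. minimal_monomial_generators G L)"

definition x_partition ::
  "'n \<Rightarrow> ('n, 'k::field) mpoly set \<Rightarrow> ('n, 'k) mpoly set \<Rightarrow> ('n, 'k) mpoly set \<Rightarrow> bool" where
  "x_partition p I J K \<longleftrightarrow>
     J = ideal_span {m \<in> mingens I. var p dvd m} \<and>
     K = ideal_span {m \<in> mingens I. \<not> var p dvd m}"


section \<open>Graded free resolutions\<close>

text \<open>
  A grading of the polynomial ring is given by the degree \<open>gr t\<close> of each monomial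
  \<open>x^t\<close>. The multigrading is \<open>gr = (\<lambda>t. t)\<close>, the standard grading is \<open>gr = total_degree\<close>.
\<close>

definition total_degree :: "('n::finite \<Rightarrow>\<^sub>0 nat) \<Rightarrow> nat" where
  "total_degree t = (\<Sum>v\<in>UNIV. Poly_Mapping.lookup t v)"

definition homogeneous ::
  "(('n \<Rightarrow>\<^sub>0 nat) \<Rightarrow> 'g) \<Rightarrow> 'g \<Rightarrow> ('n, 'k::field) mpoly \<Rightarrow> bool" where
  "homogeneous gr g f \<longleftrightarrow> (\<forall>t\<in>Poly_Mapping.keys f. gr t = g)"

text \<open>
  The free module \<open>A^r\<close> is the set \<open>free_module r\<close> of those elements of \<open>nat \<Rightarrow>\<^sub>0 A\<close> that
  are supported on \<open>{..<r}\<close>.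
\<close>

definition scale :: "'a::comm_ring_1 \<Rightarrow> (nat \<Rightarrow>\<^sub>0 'a) \<Rightarrow> (nat \<Rightarrow>\<^sub>0 'a)" where
  "scale c v = Poly_Mapping.map (\<lambda>x. c * x) v"

lemma lookup_scale [simp]:
  "Poly_Mapping.lookup (scale c v) b = c * Poly_Mapping.lookup v b"
  unfolding scale_def by (simp add: Poly_Mapping.map.rep_eq when_def)

interpretation free_mod: module "scale :: 'a::comm_ring_1 \<Rightarrow> (nat \<Rightarrow>\<^sub>0 'a) \<Rightarrow> (nat \<Rightarrow>\<^sub>0 'a)"
  by standard (rule poly_mapping_eqI, simp add: lookup_add distrib_left distrib_right mult.assoc)+

interpretation fin_vec: vector_space "scale :: 'k::field \<Rightarrow> (nat \<Rightarrow>\<^sub>0 'k) \<Rightarrow> (nat \<Rightarrow>\<^sub>0 'k)"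
  by standard (rule poly_mapping_eqI, simp add: lookup_add distrib_left distrib_right mult.assoc)+

definition free_module :: "nat \<Rightarrow> (nat \<Rightarrow>\<^sub>0 'a::comm_ring_1) set" where
  "free_module r = {v. Poly_Mapping.keys v \<subseteq> {..<r}}"

text \<open>
  Data of a sequence \<open>\<dots> \<rightarrow> F\<^sub>2 \<rightarrow> F\<^sub>1 \<rightarrow> F\<^sub>0 \<rightarrow> R\<close>, where \<open>F\<^sub>i\<close> is free on basis elements
  \<open>e\<^sub>b\<close>, \<open>b < frank i\<close>, of degree \<open>shift i b\<close>. Here \<open>mat i b \<in> F\<^sub>i\<close> is the image of the
  \<open>b\<close>-th basis element of \<open>F\<^bsub>i+1\<^esub>\<close>, and \<open>aug b \<in> R\<close> is the image of the \<open>b\<close>-th basis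
  element of \<open>F\<^sub>0\<close>.
\<close>

record (overloaded) ('g, 'n, 'k) free_seq =
  frank :: "nat \<Rightarrow> nat"
  shift :: "nat \<Rightarrow> nat \<Rightarrow> 'g"
  mat :: "nat \<Rightarrow> nat \<Rightarrow> (nat \<Rightarrow>\<^sub>0 ('n, 'k) mpoly)"
  aug :: "nat \<Rightarrow> ('n, 'k) mpoly"

definition bdry ::
  "('g, 'n, 'k::field) free_seq \<Rightarrow> nat \<Rightarrow> (nat \<Rightarrow>\<^sub>0 ('n, 'k) mpoly) \<Rightarrow> (nat \<Rightarrow>\<^sub>0 ('n, 'k) mpoly)" where
  "bdry F i v = (\<Sum>b\<in>Poly_Mapping.keys v. scale (Poly_Mapping.lookup v b) (mat F i b))"

definition augment ::
  "('g, 'n, 'k::field) free_seq \<Rightarrow> (nat \<Rightarrow>\<^sub>0 ('n, 'k) mpoly) \<Rightarrow> ('n, 'k) mpoly" where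
  "augment F v = (\<Sum>b\<in>Poly_Mapping.keys v. Poly_Mapping.lookup v b * aug F b)"

text \<open>
  All maps preserve degrees, the image of \<open>F\<^sub>0 \<rightarrow> R\<close> is \<open>L\<close>, and the sequence is exact at
  every \<open>F\<^sub>i\<close>.
\<close>

definition graded_free_resolution ::
  "(('n \<Rightarrow>\<^sub>0 nat) \<Rightarrow> 'g::comm_monoid_add) \<Rightarrow> ('g, 'n, 'k::field) free_seq \<Rightarrow> ('n, 'k) mpoly set \<Rightarrow> bool" where
  "graded_free_resolution gr F L \<longleftrightarrow>
     (\<forall>b < frank F 0. homogeneous gr (shift F 0 b) (aug F b)) \<and>
     (\<forall>i. \<forall>b < frank F (Suc i). mat F i b \<in> free_module (frank F i) \<and>
        (\<forall>c. \<forall>t\<in>Poly_Mapping.keys (Poly_Mapping.lookup (mat F i b) c).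
           gr t + shift F i c = shift F (Suc i) b)) \<and>
     augment F ` free_module (frank F 0) = L \<and>
     {v \<in> free_module (frank F 0). augment F v = 0} = bdry F 0 ` free_module (frank F 1) \<and>
     (\<forall>i. {v \<in> free_module (frank F (Suc i)). bdry F i v = 0} =
        bdry F (Suc i) ` free_module (frank F (Suc (Suc i))))"

text \<open>
  Minimality: \<open>F\<^bsub>i+1\<^esub>\<close> is mapped into \<open>\<mm> F\<^sub>i\<close> for \<open>\<mm> = (x\<^sub>1, \<dots>, x\<^sub>n)\<close>, that is, no
  matrix entry has a nonzero constant term.
\<close>

definition minimal_resolution ::
  "(('n \<Rightarrow>\<^sub>0 nat) \<Rightarrow> 'g::comm_monoid_add) \<Rightarrow> ('g, 'n, 'k::field) free_seq \<Rightarrow> ('n, 'k) mpoly set \<Rightarrow> bool" where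
  "minimal_resolution gr F L \<longleftrightarrow> graded_free_resolution gr F L \<and>
     (\<forall>i. \<forall>b < frank F (Suc i). \<forall>c.
        Poly_Mapping.lookup (Poly_Mapping.lookup (mat F i b) c) 0 = 0)"

definition generated_in_degree :: "nat \<Rightarrow> ('n::finite, 'k::field) mpoly set \<Rightarrow> bool" where
  "generated_in_degree d L \<longleftrightarrow> L = ideal_span {f \<in> L. homogeneous total_degree d f}"

text \<open>
  The minimal graded free resolution is unique up to isomorphism, and isomorphic graded
  free modules have the same degrees of basis elements, so it is enough to exhibit one.
\<close>

definition has_linear_resolution :: "('n::finite, 'k::field) mpoly set \<Rightarrow> bool" where
  "has_linear_resolution L \<longleftrightarrow>
     (\<exists>d. generated_in_degree d L \<and>
        (\<exists>F. minimal_resolution total_degree F L \<and>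
           (\<forall>i. \<forall>b < frank F i. shift F i b = i + d)))"


section \<open>Tor and multigraded Betti numbers\<close>

text \<open>
  \<open>Tor\<^sub>i(k, L)\<close> is the homology of \<open>k \<otimes>\<^sub>R F\<close> for a free resolution \<open>F\<close> of \<open>L\<close>. Since
  \<open>k = R/\<mm>\<close>, the space \<open>k \<otimes>\<^sub>R F\<^sub>i\<close> is \<open>k^(frank i)\<close>, its part of degree \<open>j\<close> is spanned by
  the basis elements of degree \<open>j\<close>, and the differential has the constant terms of the
  entries of \<open>mat\<close> as its entries.
\<close>

definition fiber :: "('g, 'n, 'k::field) free_seq \<Rightarrow> nat \<Rightarrow> 'g \<Rightarrow> (nat \<Rightarrow>\<^sub>0 'k) set" where
  "fiber F i j = {v. Poly_Mapping.keys v \<subseteq> {b. b < frank F i \<and> shift F i b = j}}"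

definition fiber_bdry ::
  "('g, 'n, 'k::field) free_seq \<Rightarrow> nat \<Rightarrow> (nat \<Rightarrow>\<^sub>0 'k) \<Rightarrow> (nat \<Rightarrow>\<^sub>0 'k)" where
  "fiber_bdry F i v = (\<Sum>b\<in>Poly_Mapping.keys v.
     scale (Poly_Mapping.lookup v b)
       (Poly_Mapping.map (\<lambda>f. Poly_Mapping.lookup f 0) (mat F i b)))"

definition fiber_cycles :: "('g, 'n, 'k::field) free_seq \<Rightarrow> nat \<Rightarrow> 'g \<Rightarrow> (nat \<Rightarrow>\<^sub>0 'k) set" where
  "fiber_cycles F i j = {v \<in> fiber F i j. case i of 0 \<Rightarrow> True | Suc i' \<Rightarrow> fiber_bdry F i' v = 0}"

definition fiber_boundaries :: "('g, 'n, 'k::field) free_seq \<Rightarrow> nat \<Rightarrow> 'g \<Rightarrow> (nat \<Rightarrow>\<^sub>0 'k) set" where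
  "fiber_boundaries F i j = fiber_bdry F i ` fiber F (Suc i) j"

text \<open>
  Boundaries are cycles and all spaces are finite-dimensional, so the truncated
  subtraction is the dimension of the quotient.
\<close>

definition tor_dim :: "('g, 'n, 'k::field) free_seq \<Rightarrow> nat \<Rightarrow> 'g \<Rightarrow> nat" where
  "tor_dim F i j = fin_vec.dim (fiber_cycles F i j) - fin_vec.dim (fiber_boundaries F i j)"

text \<open>
  Tor does not depend on the choice of the resolution; the multigrading on it comes from
  a multigraded resolution. Every monomial ideal has one of finite rank in each step, as
  \<open>R\<close> is Noetherian.
\<close>

definition betti :: "('n, 'k::field) mpoly set \<Rightarrow> nat \<Rightarrow> ('n \<Rightarrow>\<^sub>0 nat) \<Rightarrow> nat" where
  "betti L i j = tor_dim (SOME F. graded_free_resolution (\<lambda>t. t) F L) i j"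

definition betti_splitting ::
  "('n, 'k::field) mpoly set \<Rightarrow> ('n, 'k) mpoly set \<Rightarrow> ('n, 'k) mpoly set \<Rightarrow> bool" where
  "betti_splitting I J K \<longleftrightarrow>
     monomial_ideal I \<and> monomial_ideal J \<and> monomial_ideal K \<and>
     I = {f + g |f g. f \<in> J \<and> g \<in> K} \<and>
     mingens I = mingens J \<union> mingens K \<and> mingens J \<inter> mingens K = {} \<and>
     (\<forall>i j. betti I i j =
        betti J i j + betti K i j + (case i of 0 \<Rightarrow> 0 | Suc i' \<Rightarrow> betti (J \<inter> K) i' j))"

end

theory Submission
  imports Defs "HOL-Library.Function_Algebras" "HOL-Library.Countable"
begin

text \<open>
  Betti numbers are computed by Koszul homology: for every grading and every resolution \<open>F\<close> of \<open>L\<close>,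
  dimension shifting along the syzygy modules identifies the homology of \<open>k \<otimes> F\<close> with that of the
  Koszul complex with coefficients in \<open>L\<close>. For a monomial ideal a resolution exists by Dickson's lemma.

  In a fixed multidegree the Koszul complexes of \<open>J\<close> and \<open>K\<close> have sum that of \<open>I\<close> and intersection
  that of \<open>J \<inter> K\<close>, so counting dimensions in this Mayer--Vietoris situation gives the splitting formula as
  soon as every cycle of \<open>J \<inter> K\<close> is a boundary in \<open>J\<close> and in \<open>K\<close>. For \<open>J\<close> this is the hypothesis on
  Betti numbers. For \<open>K\<close> it is automatic: \<open>J \<inter> K\<close> lives in multidegrees \<open>j\<close> with \<open>j\<^sub>p > 0\<close>, where the
  complex of \<open>K\<close> is a cone.

  If \<open>J\<close> has a linear resolution with generators in degree \<open>d\<close>, then \<open>\<beta>\<^sub>i(J)\<close> is supported in total degree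
  \<open>i + d\<close>, whereas all monomials of \<open>J \<inter> K\<close> have degree greater than \<open>d\<close>, so \<open>\<beta>\<^sub>i(J \<inter> K)\<close> is supported
  in total degrees greater than \<open>i + d\<close>.
\<close>

section \<open>Finite-dimensional subspaces\<close>

text \<open>\<open>betti\<close> is computed from an unspecified resolution, and the resolution in
  the linear case is graded by total degree only. No maps between resolutions of different ideals
  are at hand, so nothing can be compared before Tor is known to be independent of the resolution.
  The Koszul complex with coefficients in L is intrinsic and monotone in L, and for all ideals it
  lies in one common space; this turns the long exact sequence into statements about sums and
  intersections of subspaces. The comparison works without quotient spaces: two homology spaces have
  equal dimension if both are subquotients of one space X of lifted chains and the preimages in X of
  the two spaces of boundaries coincide. The hypothesis says that, in each degree, the source or the
  target of the map from Tor_i(k, J \<inter> K) to Tor_i(k, J) vanishes. Either alternative makes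
  the map zero, and it is the vanishing of this map and of its counterpart for K that splits the
  sequence.\<close>

definition (in vector_space) fin_dim :: "'b set \<Rightarrow> bool" where
  "fin_dim W \<longleftrightarrow> (\<exists>S. finite S \<and> W \<subseteq> span S)"

lemma (in vector_space) fin_dim_subset: "fin_dim W \<Longrightarrow> V \<subseteq> W \<Longrightarrow> fin_dim V"
  unfolding fin_dim_def by blast

lemma (in vector_space) fin_dim_independent_finite:
  assumes "fin_dim W" "independent B" "B \<subseteq> W"
  shows "finite B"
proof -
  obtain S where "finite S" "W \<subseteq> span S" using assms(1) unfolding fin_dim_def by blast
  then show ?thesis using independent_span_bound[of S B] assms by blast
qed

lemma (in vector_space) fin_dim_basis:
  assumes "fin_dim W" "subspace W"
  obtains B where "finite B" "B \<subseteq> W" "independent B" "span B = W" "card B = dim W"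
proof -
  obtain B where B: "B \<subseteq> W" "independent B" "W \<subseteq> span B" "card B = dim W"
    using basis_exists[of W] by blast
  moreover have "span B = W"
    using B assms(2) by (metis span_minimal subset_antisym)
  ultimately show ?thesis using that fin_dim_independent_finite[OF assms(1)] by blast
qed

text \<open>The map kills a basis of \<open>A\<close> and fixes the rest of a basis of
  \<open>W\<close> extending it. It stands in for the quotient map by \<open>A\<close>, so that
  dimensions relative to \<open>A\<close> become dimensions of images.\<close>

lemma (in vector_space) exists_projection:
  assumes "subspace A" "subspace W" "A \<subseteq> W"
  shows "\<exists>p. Vector_Spaces.linear scale scale p \<and> (\<forall>x\<in>W. p x = 0 \<longleftrightarrow> x \<in> A)"
proof -
  have vp: "vector_space_pair scale scale" by unfold_locales
  obtain B0 where B0: "B0 \<subseteq> A" "independent B0" "A \<subseteq> span B0"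
    by (rule maximal_independent_subset)
  obtain B where B: "B0 \<subseteq> B" "B \<subseteq> W" "independent B" "W \<subseteq> span B"
    by (rule maximal_independent_subset_extend[OF subset_trans[OF B0(1) assms(3)] B0(2)])
  obtain p where lin: "Vector_Spaces.linear scale scale p"
    and pB: "\<And>b. b \<in> B \<Longrightarrow> p b = (if b \<in> B0 then 0 else b)"
    using vector_space_pair.linear_independent_extend[OF vp B(3), of "\<lambda>b. if b \<in> B0 then 0 else b"] by blast
  have p_add: "p (x + y) = p x + p y" and p_scale: "p (scale c x) = scale c (p x)" for x y c
    using lin unfolding Vector_Spaces.linear_iff by blast+
  have pA: "p x = 0" if "x \<in> A" for x
  proof -
    have "x \<in> span B0" using that B0 by blast
    then show ?thesis
    proof (induction rule: span_induct_alt)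
      case base then show ?case using p_scale[of 0 0] by simp
    next
      case (step c b y) then show ?case using pB[of b] B(1) by (auto simp: p_add p_scale)
    qed
  qed
  have diff: "x - p x \<in> A" if "x \<in> W" for x
  proof -
    have "x \<in> span B" using that B by blast
    then show ?thesis
    proof (induction rule: span_induct_alt)
      case base then show ?case using assms p_scale[of 0 0] by (simp add: subspace_0)
    next
      case (step c b y)
      have "b - p b \<in> A" using pB[OF step(1)] step(1) B0 assms(1) by (auto simp: subspace_0)
      then have "scale c (b - p b) + (y - p y) \<in> A"
        using step assms(1) by (simp add: subspace_add subspace_scale)
      then show ?case by (simp add: p_add p_scale scale_right_diff_distrib algebra_simps)
    qed
  qed
  have "p x = 0 \<longleftrightarrow> x \<in> A" if "x \<in> W" for x
    using diff[OF that] pA[of x] by auto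
  then show ?thesis using lin by blast
qed

text \<open>The linear map that kills \<open>B0\<close> and fixes \<open>B - B0\<close> sends x to 0
  by the first membership and to itself by the second.\<close>

lemma (in vector_space) independent_Diff_span_inter:
  assumes B: "independent B" "B0 \<subseteq> B" and x: "x \<in> span B0" "x \<in> span (B - B0)"
  shows "x = 0"
proof -
  have "vector_space_pair scale scale" by unfold_locales
  then obtain p where lin: "Vector_Spaces.linear scale scale p"
    and pB: "\<And>b. b \<in> B \<Longrightarrow> p b = (if b \<in> B0 then 0 else b)"
    using vector_space_pair.linear_independent_extend[OF _ B(1), of scale "\<lambda>b. if b \<in> B0 then 0 else b"] by blast
  have p_add: "p (x + y) = p x + p y" and p_scale: "p (scale c x) = scale c (p x)" for x y c
    using lin unfolding Vector_Spaces.linear_iff by blast+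
  have p0: "p 0 = 0" using p_scale[of 0 0] by simp
  have "p x = 0" using x(1)
  proof (induction rule: span_induct_alt)
    case (step c b y) then show ?case using pB[of b] B(2) by (auto simp: p_add p_scale)
  qed (rule p0)
  moreover have "p x = x" using x(2)
  proof (induction rule: span_induct_alt)
    case (step c b y) then show ?case using pB[of b] by (auto simp: p_add p_scale)
  qed (rule p0)
  ultimately show ?thesis by simp
qed

text \<open>Finiteness is asked of \<open>W\<close> only, since the space of all Koszul chains is
  infinite-dimensional. \<open>E\<close> completes a basis of the kernel to one of \<open>W\<close>;
  on its span \<open>f\<close> is injective and has the same image as on \<open>W\<close>.\<close>

lemma (in vector_space_pair) rank_nullity:
  assumes f: "Vector_Spaces.linear s1 s2 f" and W: "vs1.subspace W" "vs1.fin_dim W"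
  shows "vs1.dim W = vs1.dim {x \<in> W. f x = 0} + vs2.dim (f ` W)"
proof -
  interpret f: Vector_Spaces.linear s1 s2 f by (rule f)
  let ?K = "{x \<in> W. f x = 0}"
  obtain B0 where B0: "B0 \<subseteq> ?K" "vs1.independent B0" "?K \<subseteq> vs1.span B0" "card B0 = vs1.dim ?K"
    using vs1.basis_exists[of ?K] by blast
  obtain B where B: "B0 \<subseteq> B" "B \<subseteq> W" "vs1.independent B" "W \<subseteq> vs1.span B"
    using vs1.maximal_independent_subset_extend[of B0 W] B0 by blast
  have finB: "finite B" using vs1.fin_dim_independent_finite W B by blast
  define E where "E = B - B0"
  have EW: "vs1.span E \<subseteq> W" using B W unfolding E_def by (intro vs1.span_minimal) auto
  have indE: "vs1.independent E" using B vs1.independent_mono unfolding E_def by blast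
  have zero: "x = 0" if x: "x \<in> vs1.span E" "f x = 0" for x
  proof -
    have "x \<in> vs1.span B0" using x EW B0 by blast
    then show ?thesis using vs1.independent_Diff_span_inter[OF B(3,1)] x(1) unfolding E_def by blast
  qed
  have inj: "inj_on f (vs1.span E)"
  proof (rule inj_onI)
    fix x y assume "x \<in> vs1.span E" "y \<in> vs1.span E" "f x = f y"
    then have "x - y = 0" by (intro zero) (simp_all add: f.diff vs1.span_diff)
    then show "x = y" by simp
  qed
  have ind: "vs2.independent (f ` E)"
    using linear_independent_injective_image[OF f indE inj] .
  have "f ` W \<subseteq> vs2.span (f ` E)"
  proof -
    have "f ` W \<subseteq> f ` vs1.span B" using B by blast
    also have "\<dots> = vs2.span (f ` B)" using linear_span_image[OF f] by simp
    also have "\<dots> \<subseteq> vs2.span (f ` E)"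
    proof (rule vs2.span_minimal)
      show "f ` B \<subseteq> vs2.span (f ` E)"
      proof (rule image_subsetI)
        fix b assume "b \<in> B"
        then show "f b \<in> vs2.span (f ` E)"
          using B0(1) vs2.span_zero[of "f ` E"] vs2.span_base[of "f b" "f ` E"]
          unfolding E_def by (cases "b \<in> B0") force+
      qed
    qed simp
    finally show ?thesis .
  qed
  then have "vs2.dim (f ` W) = card (f ` E)"
    using vs2.basis_card_eq_dim[of "f ` E" "f ` W"] ind
      image_mono[OF order_trans[OF vs1.span_superset EW], of f] by simp
  also have "\<dots> = card E"
    by (rule card_image[OF inj_on_subset[OF inj vs1.span_superset]])
  finally have "vs2.dim (f ` W) = card E" .
  moreover have "card B = vs1.dim W" using vs1.basis_card_eq_dim[of B W] B by blast
  moreover have "card B = card B0 + card E"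
    unfolding E_def using finB B(1) by (simp add: card_Diff_subset finite_subset card_mono)
  ultimately show ?thesis using B0(4) by linarith
qed

text \<open>The projection with kernel \<open>A\<close> has the same image on the sum as on
  \<open>B\<close>, and its kernels there are \<open>A\<close> and \<open>A \<inter> B\<close>.
  Rank-nullity for both gives the formula.\<close>

lemma (in vector_space) dim_sums_fin_dim:
  assumes A: "subspace A" "fin_dim A" and B: "subspace B" "fin_dim B"
  shows "dim {x + y |x y. x \<in> A \<and> y \<in> B} + dim (A \<inter> B) = dim A + dim B"
proof -
  have vp: "vector_space_pair scale scale" by unfold_locales
  let ?W = "{x + y |x y. x \<in> A \<and> y \<in> B}"
  have W: "subspace ?W" using subspace_sums A B by blast
  have AW: "A \<subseteq> ?W" using subspace_0[OF B(1)] by force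
  have BW: "B \<subseteq> ?W" using subspace_0[OF A(1)] by force
  obtain S S' where S: "finite S" "A \<subseteq> span S" "finite S'" "B \<subseteq> span S'"
    using A B unfolding fin_dim_def by blast
  have fdW: "fin_dim ?W"
    unfolding fin_dim_def
  proof (intro exI conjI subsetI)
    show "finite (S \<union> S')" using S by simp
    fix w assume "w \<in> ?W"
    then obtain a b where "w = a + b" "a \<in> A" "b \<in> B" by blast
    moreover then have "a \<in> span (S \<union> S')" "b \<in> span (S \<union> S')"
      using S span_mono[of S "S \<union> S'"] span_mono[of S' "S \<union> S'"] by auto
    ultimately show "w \<in> span (S \<union> S')" by (simp add: span_add)
  qed
  obtain p where p: "Vector_Spaces.linear scale scale p" "\<forall>x\<in>?W. p x = 0 \<longleftrightarrow> x \<in> A"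
    using exists_projection[OF A(1) W AW] by (elim exE conjE)
  have p_add: "p (x + y) = p x + p y" for x y using p(1) unfolding Vector_Spaces.linear_iff by blast
  have "p ` ?W = p ` B"
  proof (intro equalityI image_subsetI)
    fix x assume "x \<in> ?W"
    then obtain a b where "x = a + b" "a \<in> A" "b \<in> B" by blast
    moreover then have "p a = 0" using bspec[OF p(2), of a] subsetD[OF AW, of a] by simp
    ultimately show "p x \<in> p ` B" by (simp add: p_add)
  qed (use BW in blast)
  moreover have "dim ?W = dim {x \<in> ?W. p x = 0} + dim (p ` ?W)"
    by (rule vector_space_pair.rank_nullity[OF vp p(1) W fdW])
  moreover have "dim B = dim {x \<in> B. p x = 0} + dim (p ` B)"
    by (rule vector_space_pair.rank_nullity[OF vp p(1) B])
  moreover have "{x \<in> ?W. p x = 0} = A"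
  proof (intro equalityI subsetI)
    fix x assume "x \<in> {x \<in> ?W. p x = 0}" then show "x \<in> A" using bspec[OF p(2), of x] by simp
  next
    fix x assume "x \<in> A" then show "x \<in> {x \<in> ?W. p x = 0}" using bspec[OF p(2), of x] subsetD[OF AW, of x] by simp
  qed
  moreover have "{x \<in> B. p x = 0} = A \<inter> B"
  proof (intro equalityI subsetI)
    fix x assume "x \<in> {x \<in> B. p x = 0}"
    then show "x \<in> A \<inter> B" using bspec[OF p(2), of x] subsetD[OF BW, of x] by simp
  next
    fix x assume "x \<in> A \<inter> B"
    then show "x \<in> {x \<in> B. p x = 0}" using bspec[OF p(2), of x] subsetD[OF AW, of x] by simp
  qed
  ultimately show ?thesis by simp
qed

lemma (in vector_space) dim_mono_fin_dim:
  assumes "subspace A" "subspace B" "A \<subseteq> B" "fin_dim B"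
  shows "dim A \<le> dim B"
proof -
  obtain S where S: "finite S" "S \<subseteq> B" "independent S" "span S = B" "card S = dim B"
    using fin_dim_basis[OF assms(4,2)] by blast
  then show ?thesis using dim_le_card[of A S] assms by simp
qed

lemma (in vector_space) subspace_eq_fin_dim:
  assumes "subspace A" "subspace B" "A \<subseteq> B" "fin_dim B" "dim B \<le> dim A"
  shows "A = B"
proof (rule ccontr)
  assume "A \<noteq> B"
  then obtain x where x: "x \<in> B" "x \<notin> A" using assms by blast
  have "fin_dim A" using assms fin_dim_subset by blast
  then obtain S where S: "finite S" "S \<subseteq> A" "independent S" "span S = A" "card S = dim A"
    using fin_dim_basis[OF _ assms(1)] by metis
  have "x \<notin> S" using S x by blast
  moreover have "independent (insert x S)" using S x by (simp add: independent_insertI)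
  moreover obtain T where T: "finite T" "B \<subseteq> span T" "card T = dim B"
    using fin_dim_basis[OF assms(4,2)] by (metis order_refl)
  ultimately have "card (insert x S) \<le> card T"
    using independent_span_bound[of T "insert x S"] S x assms by auto
  then show False using S T assms \<open>x \<notin> S\<close> by simp
qed

text \<open>\<open>f\<close> has the same kernel on \<open>X\<close> and on the preimage of
  \<open>B\<close>, so the codimension of \<open>B\<close> in the image is that of its preimage in
  \<open>X\<close>. Integers avoid truncated subtraction.\<close>

lemma (in vector_space_pair) dim_image_quotient:
  assumes f: "Vector_Spaces.linear s1 s2 f" and X: "vs1.subspace X" "vs1.fin_dim X"
    and B: "vs2.subspace B" "B \<subseteq> f ` X"
  shows "int (vs1.dim X) - int (vs1.dim {x \<in> X. f x \<in> B}) = int (vs2.dim (f ` X)) - int (vs2.dim B)"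
proof -
  interpret f: Vector_Spaces.linear s1 s2 f by (rule f)
  let ?U = "{x \<in> X. f x \<in> B}"
  have U: "vs1.subspace ?U"
    using X B by (auto simp: vs1.subspace_def vs2.subspace_def f.add f.scale f.zero)
  have "f ` ?U = B" using B by blast
  moreover have "{x \<in> ?U. f x = 0} = {x \<in> X. f x = 0}"
    using B vs2.subspace_0 by force
  ultimately show ?thesis
    using rank_nullity[OF f X] rank_nullity[OF f U vs1.fin_dim_subset[OF X(2)]] by auto
qed

text \<open>Both sides are the codimension in \<open>X\<close> of one subspace, the common preimage
  of \<open>B\<close> and \<open>B'\<close>. This compares two homology spaces through a common
  space of lifts, without an explicit isomorphism.\<close>

lemma subquotient_dim_eq:
  assumes "vector_space_pair s1 s2" "vector_space_pair s1 s3"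
    and "Vector_Spaces.linear s1 s2 f" "Vector_Spaces.linear s1 s3 f'"
    and "module.subspace s1 X" "vector_space.fin_dim s1 X"
    and "module.subspace s2 B" "B \<subseteq> f ` X"
    and "module.subspace s3 B'" "B' \<subseteq> f' ` X"
    and eq: "\<And>x. x \<in> X \<Longrightarrow> f x \<in> B \<longleftrightarrow> f' x \<in> B'"
  shows "vector_space.dim s2 (f ` X) - vector_space.dim s2 B
       = vector_space.dim s3 (f' ` X) - vector_space.dim s3 B'"
proof -
  interpret p: vector_space_pair s1 s2 by fact
  interpret q: vector_space_pair s1 s3 by fact
  have "{x \<in> X. f x \<in> B} = {x \<in> X. f' x \<in> B'}" using eq by blast
  then show ?thesis
    using p.dim_image_quotient[of f X B] q.dim_image_quotient[of f' X B'] assms by (simp; linarith)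
qed

section \<open>The Koszul differential and its homotopies\<close>

type_synonym ('n, 'k) pvec = "nat \<Rightarrow>\<^sub>0 ('n, 'k) mpoly"
type_synonym ('n, 'k) kchain = "'n set \<Rightarrow> nat \<Rightarrow>\<^sub>0 ('n, 'k) mpoly"

section \<open>Coefficients of polynomial vectors and division by a variable\<close>

definition ei :: "'n \<Rightarrow> 'n \<Rightarrow>\<^sub>0 nat" where "ei s = Poly_Mapping.single s 1"

lemma lookup_ei: "Poly_Mapping.lookup (ei s) u = (if s = u then 1 else 0)"
  by (simp add: ei_def lookup_single when_def)

definition cf :: "('n, 'k::zero) pvec \<Rightarrow> nat \<Rightarrow> ('n \<Rightarrow>\<^sub>0 nat) \<Rightarrow> 'k" where
  "cf v b t = Poly_Mapping.lookup (Poly_Mapping.lookup v b) t"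

lemma pvec_eqI: "(\<And>b t. cf v b t = cf w b t) \<Longrightarrow> v = w"
  unfolding cf_def by (intro poly_mapping_eqI) blast

lemma cf_simps [simp]:
  "cf 0 b t = 0"
  "cf (v + w) b t = cf v b t + cf w b t"
  "cf (v - w) b t = cf v b t - cf w b t"
  "cf (- v) b t = - cf v b t"
  for v w :: "('n, 'k::ab_group_add) pvec"
  by (simp_all add: cf_def lookup_add lookup_minus)

lemma cf_sum: "cf (\<Sum>x\<in>A. f x) b t = (\<Sum>x\<in>A. cf (f x) b t)"
  for f :: "'x \<Rightarrow> ('n, 'k::comm_monoid_add) pvec"
  by (simp add: cf_def lookup_sum)

lemma exponent_decompose: "Poly_Mapping.lookup t s > 0 \<Longrightarrow> t = ei s + (t - ei s)"
  by (rule poly_mapping_eqI) (auto simp: lookup_add lookup_minus lookup_ei)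

lemma lookup_single_times_add [simp]:
  fixes a :: "'a::cancel_comm_monoid_add" and f :: "'a \<Rightarrow>\<^sub>0 'k::semiring_0"
  shows
  "Poly_Mapping.lookup (Poly_Mapping.single a c * f) (a + u) = c * Poly_Mapping.lookup f u"
  by (simp add: lookup_mult lookup_single when_mult)

lemma lookup_single_times_eq_0:
  fixes a :: "'a::cancel_comm_monoid_add" and f :: "'a \<Rightarrow>\<^sub>0 'k::semiring_0"
  assumes "\<And>u. t \<noteq> a + u"
  shows "Poly_Mapping.lookup (Poly_Mapping.single a c * f) t = 0"
  using assms by (simp add: lookup_mult lookup_single when_mult)

lemma lookup_const_times [simp]:
  "Poly_Mapping.lookup (Poly_Mapping.single 0 c * f) t = c * Poly_Mapping.lookup f t"
  for f :: "'a::cancel_comm_monoid_add \<Rightarrow>\<^sub>0 'k::semiring_0"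
  using lookup_single_times_add[of 0 c f t] by simp

lemma cf_scale_var:
  "cf (scale (var s) v) b t = (if Poly_Mapping.lookup t s > 0 then cf v b (t - ei s) else 0)"
proof (cases "Poly_Mapping.lookup t s > 0")
  case True
  then have "Poly_Mapping.lookup (var s * Poly_Mapping.lookup v b) (ei s + (t - ei s))
      = Poly_Mapping.lookup (Poly_Mapping.lookup v b) (t - ei s)"
    unfolding var_def monom_def ei_def by (simp only: lookup_single_times_add) simp
  then show ?thesis using True exponent_decompose[OF True] by (simp add: cf_def)
next
  case False
  then have "\<And>u. t \<noteq> ei s + u" by (auto simp: lookup_add lookup_ei)
  then show ?thesis using False lookup_single_times_eq_0[of t "ei s"]
    by (simp add: cf_def var_def monom_def ei_def)
qed

lemma cf_scale_const [simp]: "cf (scale (Poly_Mapping.single 0 a) v) b t = a * cf v b t"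
  by (simp add: cf_def)

definition divx :: "'n \<Rightarrow> ('n, 'k::comm_ring_1) pvec \<Rightarrow> ('n, 'k) pvec" where
  "divx s v = Poly_Mapping.map (Poly_Mapping.map_key (\<lambda>t. ei s + t)) v"

lemma lookup_divx:
  "Poly_Mapping.lookup (divx s v) b = Poly_Mapping.map_key (\<lambda>t. ei s + t) (Poly_Mapping.lookup v b)"
  unfolding divx_def by (simp add: Poly_Mapping.map.rep_eq when_def map_key_zero)

lemma cf_divx [simp]: "cf (divx s v) b t = cf v b (ei s + t)"
  unfolding cf_def lookup_divx by (simp add: map_key.rep_eq inj_on_def)

lemma divx_add: "divx s (v + w) = divx s v + divx s w"
  by (rule pvec_eqI) simp

lemma divx_zero [simp]: "divx s 0 = 0"
  by (rule pvec_eqI) simp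

lemma divx_var: "divx s (scale (var u) v) = (if s = u then v else scale (var u) (divx s v))"
proof (rule pvec_eqI)
  fix b t
  have "Poly_Mapping.lookup t u > 0 \<Longrightarrow> ei s + t - ei u = ei s + (t - ei u)"
    by (rule poly_mapping_eqI) (auto simp: lookup_add lookup_minus lookup_ei)
  then show "cf (divx s (scale (var u) v)) b t = cf (if s = u then v else scale (var u) (divx s v)) b t"
    by (auto simp: cf_scale_var lookup_add lookup_ei)
qed

lemma cf_var_divx: "cf (scale (var s) (divx s v)) b t = (if Poly_Mapping.lookup t s > 0 then cf v b t else 0)"
  by (auto simp: cf_scale_var simp flip: exponent_decompose)

text \<open>The sign that sorts the exterior product of e_s and e_T. A finite index type carries no
  order, so \<open>to_nat\<close> supplies an arbitrary one.\<close>

definition ksgn :: "'n::countable \<Rightarrow> 'n set \<Rightarrow> 'v \<Rightarrow> 'v::ab_group_add" where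
  "ksgn s T v = (if even (card {t \<in> T. to_nat t < to_nat s}) then v else - v)"

lemma ksgn_ksgn [simp]: "ksgn s T (ksgn s T v) = v"
  by (simp add: ksgn_def)

lemma ksgn_zero [simp]: "ksgn s T 0 = 0"
  by (simp add: ksgn_def)

lemma ksgn_add: "ksgn s T (v + w) = ksgn s T v + ksgn s T w"
  by (simp add: ksgn_def)

lemma ksgn_sum: "ksgn s T (\<Sum>x\<in>A. f x) = (\<Sum>x\<in>A. ksgn s T (f x))"
  by (simp add: ksgn_def sum_negf)

lemma ksgn_hom:
  fixes D :: "'a::ab_group_add \<Rightarrow> 'b::ab_group_add"
  assumes "\<And>v w. D (v + w) = D v + D w"
  shows "D (ksgn s T v) = ksgn s T (D v)"
proof -
  have "D 0 = 0" using assms[of 0 0] by simp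
  then have "D (- v) = - D v" using assms[of v "- v"] by (intro minus_unique[symmetric]) simp
  then show ?thesis by (simp add: ksgn_def)
qed

lemma scale_ksgn: "scale a (ksgn s T v) = ksgn s T (scale a v)"
  by (rule ksgn_hom) (rule free_mod.scale_right_distrib)

lemma divx_ksgn: "divx u (ksgn s T v) = ksgn s T (divx u v)"
  by (rule ksgn_hom) (rule divx_add)

lemma divx_sum: "divx s (\<Sum>x\<in>A. f x) = (\<Sum>x\<in>A. divx s (f x))"
  using sum_comp_morphism[of "divx s" f A] by (simp add: divx_add o_def)

lemma ksgn_insert:
  assumes "finite T" "u \<notin> T"
  shows "ksgn s (insert u T) v = (if to_nat u < to_nat s then - ksgn s T v else ksgn s T v)"
proof -
  have "{t \<in> insert u T. to_nat t < to_nat s} = (if to_nat u < to_nat s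
      then insert u {t \<in> T. to_nat t < to_nat s} else {t \<in> T. to_nat t < to_nat s})" by auto
  then show ?thesis using assms by (simp add: ksgn_def)
qed

text \<open>Anticommutation in the exterior algebra: exactly one of s and u precedes the other, so
  exactly one of the two insertions changes a sign.\<close>

lemma ksgn_swap:
  assumes "finite T" "s \<noteq> u" "s \<notin> T" "u \<notin> T"
  shows "ksgn s T (ksgn u (insert s T) v) = - ksgn u T (ksgn s (insert u T) v)"
proof -
  have "to_nat s \<noteq> to_nat u" using assms by simp
  then show ?thesis using assms by (simp add: ksgn_insert) (auto simp: ksgn_def)
qed

text \<open>
  A Koszul chain \<open>c\<close> with coefficients in \<open>R\<^sup>r\<close> is given by its coefficients \<open>c S\<close> at the exterior basis
  elements \<open>e\<^sub>S\<close>. Division by \<open>x\<^sub>s\<close>, which kills the monomials not divisible by \<open>x\<^sub>s\<close>, makes \<open>kh s\<close> a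
  contraction of all multidegrees in which \<open>x\<^sub>s\<close> occurs.
\<close>

definition kd :: "('n::finite, 'k::field) kchain \<Rightarrow> ('n, 'k) kchain" where
  "kd c = (\<lambda>T. \<Sum>s\<in>-T. ksgn s T (scale (var s) (c (insert s T))))"

definition kh :: "'n::finite \<Rightarrow> ('n, 'k::field) kchain \<Rightarrow> ('n, 'k) kchain" where
  "kh s c = (\<lambda>S. if s \<in> S then ksgn s (S - {s}) (divx s (c (S - {s}))) else 0)"

lemma kd_add: "kd (c + c') = kd c + kd c'"
  by (rule ext) (simp add: kd_def free_mod.scale_right_distrib ksgn_add sum.distrib)

lemma kd_zero [simp]: "kd 0 = 0"
  by (rule ext) (simp add: kd_def)

lemma kd_uminus: "kd (- c) = - kd c"
  using kd_add[of c "- c"] by (intro minus_unique[symmetric]) simp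

lemma kd_diff: "kd (c - c') = kd c - kd c'"
  using kd_add[of c "- c'"] by (simp add: kd_uminus)

lemma kd_hom:
  assumes "module_hom scale scale D"
  shows "kd (\<lambda>S. D (c S)) = (\<lambda>T. D (kd c T))"
proof -
  interpret module_hom scale scale D by fact
  show ?thesis by (rule ext) (simp add: kd_def sum ksgn_hom[OF add] scale)
qed

text \<open>The terms are paired through the order by \<open>to_nat\<close>. Showing that the sum
  equals its own negative would not suffice in characteristic 2.\<close>

lemma sum_antisymmetric_eq_0:
  fixes g :: "'n::{finite, countable} \<Rightarrow> 'n \<Rightarrow> 'v::ab_group_add"
  assumes "\<And>s u. s \<noteq> u \<Longrightarrow> s \<in> A \<Longrightarrow> u \<in> A \<Longrightarrow> g s u = - g u s"
  shows "(\<Sum>s\<in>A. \<Sum>u\<in>A - {s}. g s u) = 0"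
proof -
  let ?L = "{(s, u). s \<in> A \<and> u \<in> A \<and> to_nat s < to_nat u}"
  let ?G = "{(s, u). s \<in> A \<and> u \<in> A \<and> to_nat u < to_nat s}"
  have "(\<Sum>s\<in>A. \<Sum>u\<in>A - {s}. g s u) = (\<Sum>(s, u)\<in>(SIGMA s:A. A - {s}). g s u)"
    by (rule sum.Sigma) auto
  also have "(SIGMA s:A. A - {s}) = ?L \<union> ?G"
    by (auto simp: neq_iff) (metis linorder_less_linear to_nat_split)
  also have "(\<Sum>(s, u)\<in>?L \<union> ?G. g s u) = (\<Sum>(s, u)\<in>?L. g s u) + (\<Sum>(s, u)\<in>?G. g s u)"
    by (rule sum.union_disjoint) auto
  also have "(\<Sum>(s, u)\<in>?G. g s u) = (\<Sum>(s, u)\<in>?L. g u s)"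
    by (rule sum.reindex_bij_witness[of _ prod.swap prod.swap]) auto
  also have "\<dots> = (\<Sum>(s, u)\<in>?L. - g s u)"
    by (rule sum.cong) (auto intro: assms)
  finally show ?thesis by (simp add: case_prod_unfold sum_negf)
qed

lemma kd_kd [simp]: "kd (kd c) = 0"
proof (rule ext)
  fix T
  define g where "g s u = ksgn s T (ksgn u (insert s T) (scale (var s * var u) (c (insert s (insert u T)))))" for s u
  have "kd (kd c) T = (\<Sum>s\<in>-T. \<Sum>u\<in>-T - {s}. g s u)"
    unfolding kd_def g_def
  proof (intro sum.cong refl)
    fix s
    have "- insert s T = -T - {s}" by auto
    then show "ksgn s T (scale (var s) (\<Sum>u\<in>- insert s T. ksgn u (insert s T) (scale (var u) (c (insert u (insert s T))))))
      = (\<Sum>u\<in>-T - {s}. ksgn s T (ksgn u (insert s T) (scale (var s * var u) (c (insert s (insert u T))))))"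
      by (simp add: free_mod.scale_sum_right ksgn_sum scale_ksgn insert_commute)
  qed
  also have "\<dots> = 0"
  proof (rule sum_antisymmetric_eq_0)
    fix s u assume "s \<noteq> u" "s \<in> -T" "u \<in> -T"
    then show "g s u = - g u s"
      unfolding g_def using ksgn_swap[of T s u] by (simp add: mult.commute[of "var s"] insert_commute[of s])
  qed
  finally show "kd (kd c) T = 0 T" by simp
qed

text \<open>\<open>kd\<close> contracts with the variables, and \<open>kh s\<close> is the exterior
  product with e_s after division by x_s. The terms in directions other than s vanish or cancel,
  because multiplication by x_u commutes with \<open>divx s\<close>. In direction s, multiplying and
  then dividing is the identity, whereas dividing and then multiplying loses the monomials without
  x_s; which order occurs depends on whether s lies in T.\<close>

lemma kh_homotopy:
  "kd (kh s c) T + kh s (kd c) T = (if s \<in> T then c T else scale (var s) (divx s (c T)))"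
proof (cases "s \<in> T")
  case False
  have "kd (kh s c) T = (\<Sum>u\<in>-T. if u = s then scale (var s) (divx s (c T)) else 0)"
    unfolding kd_def kh_def using False
    by (intro sum.cong) (auto simp: scale_ksgn)
  also have "\<dots> = scale (var s) (divx s (c T))" using False by simp
  finally show ?thesis using False by (simp add: kh_def)
next
  case True
  define T' where "T' = T - {s}"
  have T: "T = insert s T'" "s \<notin> T'" using True by (auto simp: T'_def)
  have ins: "insert u (insert s T') - {s} = insert u T'" if "u \<noteq> s" for u using that T by auto
  have 1: "kd (kh s c) T = (\<Sum>u\<in>-T. - ksgn s T' (ksgn u T' (scale (var u) (divx s (c (insert u T'))))))"
    unfolding kd_def kh_def
  proof (intro sum.cong refl)
    fix u assume u: "u \<in> -T"
    then have us: "u \<noteq> s" "u \<notin> T'" using T by auto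
    have "ksgn u T (scale (var u) (if s \<in> insert u T then ksgn s (insert u T - {s}) (divx s (c (insert u T - {s}))) else 0))
       = ksgn u (insert s T') (ksgn s (insert u T') (scale (var u) (divx s (c (insert u T')))))"
      using us T by (simp add: ins scale_ksgn)
    also have "\<dots> = - ksgn s T' (ksgn u T' (scale (var u) (divx s (c (insert u T')))))"
    proof -
      have "to_nat s \<noteq> to_nat u" using us by simp
      then show ?thesis using us T by (simp add: ksgn_insert) (auto simp: ksgn_def)
    qed
    finally show "ksgn u T (scale (var u) (if s \<in> insert u T then ksgn s (insert u T - {s}) (divx s (c (insert u T - {s}))) else 0))
       = - ksgn s T' (ksgn u T' (scale (var u) (divx s (c (insert u T')))))" .
  qed
  have "kh s (kd c) T = ksgn s T' (\<Sum>u\<in>-T'. ksgn u T' (divx s (scale (var u) (c (insert u T')))))"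
    unfolding kd_def kh_def using True
    by (simp add: T'_def[symmetric] divx_ksgn divx_sum)
  \<comment> \<open>The additional index s contributes c T; the remaining terms are those of
    \<open>1\<close> with opposite sign.\<close>
  also have "-T' = insert s (-T)" using T by auto
  also have "(\<Sum>u\<in>insert s (-T). ksgn u T' (divx s (scale (var u) (c (insert u T'))))) =
      ksgn s T' (c T) + (\<Sum>u\<in>-T. ksgn u T' (scale (var u) (divx s (c (insert u T')))))"
  proof -
    have "(\<Sum>u\<in>-T. ksgn u T' (divx s (scale (var u) (c (insert u T'))))) =
      (\<Sum>u\<in>-T. ksgn u T' (scale (var u) (divx s (c (insert u T')))))"
      using T by (intro sum.cong) (auto simp: divx_var)
    then show ?thesis using T by (simp add: divx_var)
  qed
  finally have 2: "kh s (kd c) T = c T +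
     (\<Sum>u\<in>-T. ksgn s T' (ksgn u T' (scale (var u) (divx s (c (insert u T'))))))"
    by (simp add: ksgn_add ksgn_sum)
  show ?thesis unfolding 1 2 using True by (simp add: sum_negf)
qed

section \<open>Graded Koszul chains\<close>

text \<open>The multidegree of the exterior basis element e_S.\<close>

definition ind :: "'n::finite set \<Rightarrow> 'n \<Rightarrow>\<^sub>0 nat" where "ind S = (\<Sum>s\<in>S. ei s)"

lemma ind_empty [simp]: "ind {} = 0"
  by (simp add: ind_def)

lemma ind_insert: "s \<notin> S \<Longrightarrow> ind (insert s S) = ei s + ind S"
  by (simp add: ind_def)

lemma lookup_ind: "Poly_Mapping.lookup (ind S) u = (if u \<in> S then 1 else 0)"
  by (simp add: ind_def lookup_sum lookup_ei)

text \<open>The strand of degree \<open>g\<close> of the Koszul module in exterior degree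
  \<open>i\<close> with coefficients in \<open>M\<close>. Here \<open>M\<close> need not be free; it
  inherits its degrees from an ambient free module whose b-th basis element has degree
  \<open>sh b\<close>.\<close>

definition kchains ::
  "(('n::finite \<Rightarrow>\<^sub>0 nat) \<Rightarrow> 'g::comm_monoid_add) \<Rightarrow> (nat \<Rightarrow> 'g) \<Rightarrow> ('n, 'k::field) pvec set \<Rightarrow> nat \<Rightarrow> 'g \<Rightarrow> ('n, 'k) kchain set" where
  "kchains gr sh M i g = {c. (\<forall>S. c S \<in> M) \<and> (\<forall>S. card S \<noteq> i \<longrightarrow> c S = 0) \<and>
     (\<forall>S b t. cf (c S) b t \<noteq> 0 \<longrightarrow> gr (t + ind S) + sh b = g)}"

definition kcycles ::
  "(('n::finite \<Rightarrow>\<^sub>0 nat) \<Rightarrow> 'g::comm_monoid_add) \<Rightarrow> (nat \<Rightarrow> 'g) \<Rightarrow> ('n, 'k::field) pvec set \<Rightarrow> nat \<Rightarrow> 'g \<Rightarrow> ('n, 'k) kchain set" where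
  "kcycles gr sh M i g = {c \<in> kchains gr sh M i g. kd c = 0}"

definition kbounds ::
  "(('n::finite \<Rightarrow>\<^sub>0 nat) \<Rightarrow> 'g::comm_monoid_add) \<Rightarrow> (nat \<Rightarrow> 'g) \<Rightarrow> ('n, 'k::field) pvec set \<Rightarrow> nat \<Rightarrow> 'g \<Rightarrow> ('n, 'k) kchain set" where
  "kbounds gr sh M i g = kd ` kchains gr sh M (Suc i) g"

text \<open>Homology is taken over the field, which acts through constant polynomials.\<close>

definition kscale :: "'k::field \<Rightarrow> ('n, 'k) kchain \<Rightarrow> ('n, 'k) kchain" where
  "kscale a c = (\<lambda>S. scale (Poly_Mapping.single 0 a) (c S))"

interpretation kch: vector_space "kscale :: 'k::field \<Rightarrow> ('n, 'k) kchain \<Rightarrow> ('n, 'k) kchain"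
  by standard (auto simp: kscale_def fun_eq_iff intro!: pvec_eqI simp: algebra_simps mult_single)

lemma chainsI:
  assumes "\<And>S. c S \<in> M" "\<And>S. card S \<noteq> i \<Longrightarrow> c S = 0"
    and "\<And>S b t. cf (c S) b t \<noteq> 0 \<Longrightarrow> gr (t + ind S) + sh b = g"
  shows "c \<in> kchains gr sh M i g"
  using assms unfolding kchains_def by blast

lemma chainsD:
  assumes "c \<in> kchains gr sh M i g"
  shows "c S \<in> M" "card S \<noteq> i \<Longrightarrow> c S = 0" "cf (c S) b t \<noteq> 0 \<Longrightarrow> gr (t + ind S) + sh b = g"
  using assms unfolding kchains_def by blast+

lemma chains_mono: "M \<subseteq> N \<Longrightarrow> kchains gr sh M i g \<subseteq> kchains gr sh N i g"
  unfolding kchains_def by blast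

lemma cycles_subset_chains: "kcycles gr sh M i g \<subseteq> kchains gr sh M i g"
  unfolding kcycles_def by blast

lemma subspace_kchains:
  assumes "free_mod.subspace M"
  shows "kch.subspace (kchains gr sh M i g)"
proof (rule kch.subspaceI)
  show "0 \<in> kchains gr sh M i g"
    by (rule chainsI) (simp_all add: free_mod.subspace_0[OF assms])
next
  fix c c' assume cc: "c \<in> kchains gr sh M i g" "c' \<in> kchains gr sh M i g"
  show "c + c' \<in> kchains gr sh M i g"
  proof (rule chainsI)
    fix S b t assume "cf ((c + c') S) b t \<noteq> 0"
    then have "cf (c S) b t \<noteq> 0 \<or> cf (c' S) b t \<noteq> 0" by auto
    then show "gr (t + ind S) + sh b = g" using chainsD(3)[OF cc(1)] chainsD(3)[OF cc(2)] by blast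
  qed (simp_all add: free_mod.subspace_add[OF assms] chainsD(1,2)[OF cc(1)] chainsD(1,2)[OF cc(2)])
next
  fix a c assume c: "c \<in> kchains gr sh M i g"
  show "kscale a c \<in> kchains gr sh M i g"
  proof (rule chainsI)
    fix S b t assume "cf (kscale a c S) b t \<noteq> 0"
    then have "cf (c S) b t \<noteq> 0" by (auto simp: kscale_def)
    then show "gr (t + ind S) + sh b = g" using chainsD(3)[OF c] by blast
  qed (simp_all add: kscale_def free_mod.subspace_scale[OF assms] chainsD(1,2)[OF c])
qed

lemma kd_kscale: "kd (kscale a c) = kscale a (kd c)"
  by (rule ext) (simp add: kd_def kscale_def free_mod.scale_sum_right scale_ksgn mult.commute)

lemma linear_kd: "Vector_Spaces.linear kscale kscale kd"
  using kch.vector_space_axioms by (simp add: Vector_Spaces.linear_iff kd_add kd_kscale)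

lemma kch_pair: "vector_space_pair kscale kscale"
  by unfold_locales

lemma subspace_kcycles:
  assumes "free_mod.subspace M" shows "kch.subspace (kcycles gr sh M i g)"
proof (rule kch.subspaceI)
  note s = subspace_kchains[OF assms, of gr sh i g]
  show "0 \<in> kcycles gr sh M i g" using kch.subspace_0[OF s] by (simp add: kcycles_def)
  show "c + c' \<in> kcycles gr sh M i g" if "c \<in> kcycles gr sh M i g" "c' \<in> kcycles gr sh M i g" for c c'
    using that kch.subspace_add[OF s, of c c'] by (simp add: kcycles_def kd_add)
  show "kscale a c \<in> kcycles gr sh M i g" if "c \<in> kcycles gr sh M i g" for a c
    using that kch.subspace_scale[OF s, of c a] by (simp add: kcycles_def kd_kscale)
qed

lemma subspace_kbounds:
  assumes "free_mod.subspace M" shows "kch.subspace (kbounds gr sh M i g)"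
proof (rule kch.subspaceI)
  note s = subspace_kchains[OF assms, of gr sh "Suc i" g]
  show "0 \<in> kbounds gr sh M i g" unfolding kbounds_def using kch.subspace_0[OF s] kd_zero by (metis imageI)
  show "x + y \<in> kbounds gr sh M i g" if xy: "x \<in> kbounds gr sh M i g" "y \<in> kbounds gr sh M i g" for x y
  proof -
    obtain c c' where "x = kd c" "y = kd c'" "c \<in> kchains gr sh M (Suc i) g" "c' \<in> kchains gr sh M (Suc i) g"
      using xy unfolding kbounds_def by auto
    then show ?thesis unfolding kbounds_def
      using kch.subspace_add[OF s, of c c'] kd_add[of c c'] by (metis imageI)
  qed
  show "kscale a x \<in> kbounds gr sh M i g" if x: "x \<in> kbounds gr sh M i g" for a x
  proof -
    obtain c where "x = kd c" "c \<in> kchains gr sh M (Suc i) g"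
      using x unfolding kbounds_def by auto
    then show ?thesis unfolding kbounds_def
      using kch.subspace_scale[OF s, of c a] kd_kscale[of a c] by (metis imageI)
  qed
qed

lemma subspace_ksgn:
  assumes "free_mod.subspace M" "v \<in> M" shows "ksgn s T v \<in> M"
  using assms free_mod.subspace_neg unfolding ksgn_def by auto

lemma cf_ksgn_eq_0 [simp]: "cf (ksgn s T v) b t = 0 \<longleftrightarrow> cf v b t = 0"
  for v :: "('n, 'k::field) pvec"
  by (simp add: ksgn_def)

lemma kd_chains:
  assumes M: "free_mod.subspace M" and c: "c \<in> kchains gr sh M (Suc i) g"
  shows "kd c \<in> kchains gr sh M i g"
proof (rule chainsI)
  fix S
  show "kd c S \<in> M"
    unfolding kd_def
    by (intro free_mod.subspace_sum[OF M] subspace_ksgn[OF M] free_mod.subspace_scale[OF M] chainsD(1)[OF c])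
  show "kd c S = 0" if "card S \<noteq> i"
  proof -
    have "c (insert s S) = 0" if "s \<in> -S" for s
      using that \<open>card S \<noteq> i\<close> by (intro chainsD(2)[OF c]) simp
    then show ?thesis by (simp add: kd_def)
  qed
  fix b t assume "cf (kd c S) b t \<noteq> 0"
  then have "\<exists>s\<in>-S. cf (ksgn s S (scale (var s) (c (insert s S)))) b t \<noteq> 0"
    unfolding kd_def cf_sum by (meson sum.neutral)
  then obtain s where s: "s \<in> -S" "cf (scale (var s) (c (insert s S))) b t \<noteq> 0" by auto
  then have t: "Poly_Mapping.lookup t s > 0" and "cf (c (insert s S)) b (t - ei s) \<noteq> 0"
    by (auto simp: cf_scale_var split: if_splits)
  then have "gr (t - ei s + ind (insert s S)) + sh b = g" using chainsD(3)[OF c] by blast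
  moreover have "t - ei s + ind (insert s S) = ei s + (t - ei s) + ind S"
    using s by (simp add: ind_insert algebra_simps)
  ultimately show "gr (t + ind S) + sh b = g"
    using exponent_decompose[OF t] by simp
qed

lemma kh_chains:
  assumes M: "free_mod.subspace M" "\<And>v. v \<in> M \<Longrightarrow> divx s v \<in> M" and c: "c \<in> kchains gr sh M i g"
  shows "kh s c \<in> kchains gr sh M (Suc i) g"
proof (rule chainsI)
  fix S
  show "kh s c S \<in> M"
    unfolding kh_def
    by (simp add: free_mod.subspace_0[OF M(1)] subspace_ksgn[OF M(1) M(2)[OF chainsD(1)[OF c]]])
  show "kh s c S = 0" if "card S \<noteq> Suc i"
  proof (cases "s \<in> S")
    case True
    then have "card (S - {s}) \<noteq> i" using that card_Suc_Diff1[of S s] by auto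
    then show ?thesis using chainsD(2)[OF c, of "S - {s}"] by (simp add: kh_def)
  qed (simp add: kh_def)
  fix b t assume "cf (kh s c S) b t \<noteq> 0"
  then have s: "s \<in> S" and "cf (c (S - {s})) b (ei s + t) \<noteq> 0"
    by (auto simp: kh_def split: if_splits)
  then have "gr (ei s + t + ind (S - {s})) + sh b = g" using chainsD(3)[OF c] by blast
  moreover have "ind S = ei s + ind (S - {s})"
    using ind_insert[of s "S - {s}"] s by (simp add: insert_absorb)
  ultimately show "gr (t + ind S) + sh b = g" by (simp add: algebra_simps)
qed

lemma bounds_subset_cycles:
  assumes "free_mod.subspace M"
  shows "kbounds gr sh M i g \<subseteq> kcycles gr sh M i g"
  unfolding kbounds_def kcycles_def using kd_chains[OF assms] by auto

lemma bounds_mono: "M \<subseteq> N \<Longrightarrow> kbounds gr sh M i g \<subseteq> kbounds gr sh N i g"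
  unfolding kbounds_def using chains_mono by blast

lemma cycles_0:
  assumes "free_mod.subspace M"
  shows "kcycles gr sh M 0 g = kchains gr sh M 0 g"
proof -
  have "kd c = 0" if "c \<in> kchains gr sh M 0 g" for c
    by (rule ext) (simp add: kd_def chainsD(2)[OF that])
  then show ?thesis unfolding kcycles_def by blast
qed

section \<open>Koszul homology of free modules\<close>

lemma free_module_iff: "v \<in> free_module r \<longleftrightarrow> (\<forall>b. r \<le> b \<longrightarrow> Poly_Mapping.lookup v b = 0)"
  by (auto simp: free_module_def subset_iff in_keys_iff not_le[symmetric])

lemma subspace_free_module: "free_mod.subspace (free_module r :: ('n, 'k::field) pvec set)"
  by (rule free_mod.subspaceI) (auto simp: free_module_iff lookup_add)

lemma divx_free_module: "v \<in> free_module r \<Longrightarrow> divx s v \<in> free_module r"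
  by (simp add: free_module_iff lookup_divx map_key_zero)

lemma eq_of_diff_eq_0: "(\<And>S. (c - d) S = 0) \<Longrightarrow> c = d" for c d :: "'a \<Rightarrow> 'b::group_add"
  by (rule ext) simp

lemma kh_zero [simp]: "kh s 0 = 0"
  by (rule ext) (simp add: kh_def)

text \<open>For each s in \<open>A\<close> in turn, the homotopy \<open>kh s\<close> removes from
  the cycle, up to a boundary, every e_S with s in S and every monomial divisible by x_s. A later
  direction only deletes further terms, so what has been achieved persists. When \<open>A\<close>
  contains all variables, only constants at the empty set are left.\<close>

lemma free_reduction:
  fixes c :: "('n::finite, 'k::field) kchain"
  assumes c: "c \<in> kcycles gr sh (free_module r) i g" and "finite A"
  shows "\<exists>e \<in> kchains gr sh (free_module r) (Suc i) g.
    \<forall>S. (S \<inter> A \<noteq> {} \<longrightarrow> (c - kd e) S = 0) \<and>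
        (\<forall>s\<in>A. \<forall>b t. Poly_Mapping.lookup t s > 0 \<longrightarrow> cf ((c - kd e) S) b t = 0)"
  using assms(2)
proof induction
  case empty
  show ?case
    by (rule bexI[of _ 0]) (auto intro: kch.subspace_0 subspace_kchains subspace_free_module)
next
  case (insert s A)
  from insert.IH obtain e where e: "e \<in> kchains gr sh (free_module r) (Suc i) g"
    and eall: "\<forall>S. (S \<inter> A \<noteq> {} \<longrightarrow> (c - kd e) S = 0) \<and>
        (\<forall>s\<in>A. \<forall>b t. Poly_Mapping.lookup t s > 0 \<longrightarrow> cf ((c - kd e) S) b t = 0)"
    by (elim bexE)
  have eA: "(c - kd e) S = 0" if "S \<inter> A \<noteq> {}" for S
    using spec[OF eall, of S] that by simp
  have eb: "cf ((c - kd e) S) b t = 0" if "u \<in> A" "Poly_Mapping.lookup t u > 0" for S u b t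
    using spec[OF eall, of S] that by simp
  let ?M = "free_module r :: ('n, 'k) pvec set"
  define c1 where "c1 = c - kd e"
  note sub = subspace_kchains[OF subspace_free_module]
  have c1: "c1 \<in> kchains gr sh ?M i g"
    unfolding c1_def
    by (rule kch.subspace_diff[OF sub subsetD[OF cycles_subset_chains c] kd_chains[OF subspace_free_module e]])
  have kd1: "kd c1 = 0" using c unfolding c1_def by (simp add: kd_diff kcycles_def)
  have h: "kh s c1 \<in> kchains gr sh ?M (Suc i) g"
    using kh_chains[OF subspace_free_module divx_free_module c1] .
  have P: "kd (kh s c1) T = (if s \<in> T then c1 T else scale (var s) (divx s (c1 T)))" for T
    using kh_homotopy[of s c1 T] kd1 by simp
  \<comment> \<open>The new cycle is \<open>c1\<close> with terms deleted: everything at T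
    containing s, and elsewhere the monomials divisible by x_s.\<close>
  have eq: "(c - kd (e + kh s c1)) T = (if s \<in> T then 0 else c1 T - scale (var s) (divx s (c1 T)))" for T
    using P[of T] by (auto simp: kd_add c1_def algebra_simps)
  show ?case
  proof (rule bexI[of _ "e + kh s c1"], intro allI conjI impI ballI)
    show "e + kh s c1 \<in> kchains gr sh ?M (Suc i) g" by (rule kch.subspace_add[OF sub e h])
    fix S
    show "(c - kd (e + kh s c1)) S = 0" if "S \<inter> insert s A \<noteq> {}"
    proof (cases "s \<in> S")
      case False
      then have "c1 S = 0" using eA[of S] that unfolding c1_def by auto
      then show ?thesis unfolding eq by simp
    qed (simp only: eq if_True)
    fix u b and t :: "'n \<Rightarrow>\<^sub>0 nat" assume u: "u \<in> insert s A" "Poly_Mapping.lookup t u > 0"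
    show "cf ((c - kd (e + kh s c1)) S) b t = 0"
    proof (cases "u = s")
      case True then show ?thesis using u unfolding eq by (simp add: cf_var_divx)
    next
      case False
      then have "cf (c1 S) b t = 0" using eb[of u t S b] u unfolding c1_def by simp
      then show ?thesis unfolding eq by (simp add: cf_var_divx)
    qed
  qed
qed

text \<open>What survives \<open>free_reduction\<close> sits at the empty set, where chains of
  positive exterior degree vanish.\<close>

lemma free_acyclic:
  fixes gr :: "('n::finite \<Rightarrow>\<^sub>0 nat) \<Rightarrow> 'g::comm_monoid_add"
  assumes "0 < i"
  shows "kcycles gr sh (free_module r :: ('n, 'k::field) pvec set) i g = kbounds gr sh (free_module r) i g"
proof
  show "kcycles gr sh (free_module r :: ('n, 'k) pvec set) i g \<subseteq> kbounds gr sh (free_module r) i g"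
  proof
    fix c :: "('n, 'k) kchain" assume c: "c \<in> kcycles gr sh (free_module r) i g"
    then obtain e where e: "e \<in> kchains gr sh (free_module r) (Suc i) g"
      and z: "\<And>S. S \<noteq> {} \<Longrightarrow> (c - kd e) S = 0"
      using free_reduction[OF c finite_UNIV] by auto
    have "c {} = 0"
      by (rule chainsD(2)[OF subsetD[OF cycles_subset_chains c]]) (use assms in simp)
    moreover have "kd e {} = 0"
      by (rule chainsD(2)[OF kd_chains[OF subspace_free_module e]]) (use assms in simp)
    ultimately have "(c - kd e) {} = 0" by simp
    then have "c = kd e" by (intro eq_of_diff_eq_0) (metis z)
    then show "c \<in> kbounds gr sh (free_module r) i g" using e unfolding kbounds_def by blast
  qed
qed (rule bounds_subset_cycles[OF subspace_free_module])

text \<open>Boundaries have coefficients in the maximal ideal; conversely,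
  \<open>free_reduction\<close> leaves nothing but constant terms. So the homology in exterior
  degree 0 is reduction modulo the maximal ideal.\<close>

lemma free_bounds_0:
  assumes c: "c \<in> kchains gr sh (free_module r) 0 g"
  shows "c \<in> kbounds gr sh (free_module r) 0 g \<longleftrightarrow> (\<forall>b. cf (c {}) b 0 = 0)"
proof
  assume "c \<in> kbounds gr sh (free_module r) 0 g"
  then obtain e where "c = kd e" unfolding kbounds_def by auto
  then show "\<forall>b. cf (c {}) b 0 = 0"
    by (auto simp: kd_def cf_sum ksgn_def cf_scale_var intro!: sum.neutral)
next
  assume 0: "\<forall>b. cf (c {}) b 0 = 0"
  have "c \<in> kcycles gr sh (free_module r) 0 g" using c by (simp add: cycles_0[OF subspace_free_module])
  then obtain e where e: "e \<in> kchains gr sh (free_module r) (Suc 0) g"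
    and z: "\<And>S. S \<noteq> {} \<Longrightarrow> (c - kd e) S = 0"
    and zt: "\<And>S s b t. Poly_Mapping.lookup t s > 0 \<Longrightarrow> cf ((c - kd e) S) b t = 0"
    using free_reduction[OF _ finite_UNIV, of c gr sh r 0 g] by auto
  have "(c - kd e) {} = 0"
  proof (rule pvec_eqI)
    fix b t
    show "cf ((c - kd e) {}) b t = cf 0 b t"
    proof (cases "t = 0")
      case True
      have "cf (kd e {}) b 0 = 0"
        by (auto simp: kd_def cf_sum ksgn_def cf_scale_var intro!: sum.neutral)
      then show ?thesis using 0 True by simp
    next
      case False
      then obtain s where "Poly_Mapping.lookup t s > 0" by (metis poly_mapping_eqI gr0I lookup_zero)
      then show ?thesis using zt by simp
    qed
  qed
  then have "c = kd e" by (intro eq_of_diff_eq_0) (metis z)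
  then show "c \<in> kbounds gr sh (free_module r) 0 g" using e unfolding kbounds_def by blast
qed

section \<open>Graded maps of free modules\<close>

text \<open>Kept independent of \<open>free_seq\<close>, so that boundary maps and the augmentation
  are instances of one notion.\<close>

definition lin :: "(nat \<Rightarrow> ('n, 'k::field) pvec) \<Rightarrow> ('n, 'k) pvec \<Rightarrow> ('n, 'k) pvec" where
  "lin m v = (\<Sum>b\<in>Poly_Mapping.keys v. scale (Poly_Mapping.lookup v b) (m b))"

lemma lin_superset:
  assumes "finite A" "Poly_Mapping.keys v \<subseteq> A"
  shows "lin m v = (\<Sum>b\<in>A. scale (Poly_Mapping.lookup v b) (m b))"
  unfolding lin_def by (rule sum.mono_neutral_left) (use assms in \<open>auto simp: in_keys_iff\<close>)

lemma module_hom_lin: "module_hom scale scale (lin m)"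
proof unfold_locales
  fix v w :: "('a, 'b) pvec" and a
  show "lin m (v + w) = lin m v + lin m w"
    using Poly_Mapping.keys_add[of v w]
    by (simp add: lin_superset[of "Poly_Mapping.keys v \<union> Poly_Mapping.keys w"] lookup_add
        free_mod.scale_left_distrib sum.distrib)
  have "Poly_Mapping.keys (scale a v) \<subseteq> Poly_Mapping.keys v" by (auto simp: in_keys_iff)
  then show "lin m (scale a v) = scale a (lin m v)"
    by (simp add: lin_superset[of "Poly_Mapping.keys v"] free_mod.scale_sum_right)
qed

lemmas lin_add = module_hom.add[OF module_hom_lin]
  and lin_diff = module_hom.diff[OF module_hom_lin]
  and lin_zero [simp] = module_hom.zero[OF module_hom_lin]
  and lin_scale = module_hom.scale[OF module_hom_lin]

lemma kd_lin: "kd (\<lambda>S. lin m (c S)) = (\<lambda>T. lin m (kd c T))"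
  by (rule kd_hom[OF module_hom_lin])

section \<open>Homogeneous components and reduction modulo the maximal ideal\<close>

definition prj :: "(nat \<Rightarrow> ('n \<Rightarrow>\<^sub>0 nat) \<Rightarrow> bool) \<Rightarrow> ('n, 'k::field) pvec \<Rightarrow> ('n, 'k) pvec" where
  "prj P v = Poly_Mapping.mapp (\<lambda>b. Poly_Mapping.mapp (\<lambda>t a. if P b t then a else 0)) v"

lemma cf_prj [simp]: "cf (prj P v) b t = (if P b t then cf v b t else 0)"
  unfolding prj_def cf_def by (auto simp: lookup_mapp when_def in_keys_iff)

lemma prj_free_module: "v \<in> free_module r \<Longrightarrow> prj P v \<in> free_module r"
  by (auto simp: free_module_iff prj_def lookup_mapp when_def in_keys_iff)

definition const0 :: "('n, 'k::field) pvec \<Rightarrow> nat \<Rightarrow>\<^sub>0 'k" where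
  "const0 v = Poly_Mapping.map (\<lambda>f. Poly_Mapping.lookup f 0) v"

lemma lookup_const0 [simp]: "Poly_Mapping.lookup (const0 v) b = cf v b 0"
  unfolding const0_def cf_def by (simp add: Poly_Mapping.map.rep_eq when_def)

lemma lookup_times_0: "Poly_Mapping.lookup (f * h) 0 = Poly_Mapping.lookup f 0 * Poly_Mapping.lookup h 0"
  for f h :: "('n, 'k::field) mpoly"
proof -
  define f' where "f' = f - Poly_Mapping.single 0 (Poly_Mapping.lookup f 0)"
  have f: "f = Poly_Mapping.single 0 (Poly_Mapping.lookup f 0) + f'" by (simp add: f'_def)
  have f'0: "Poly_Mapping.lookup f' 0 = 0" by (simp add: f'_def lookup_minus)
  have "Poly_Mapping.lookup (f' * h) 0 = 0"
  proof (rule ccontr)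
    assume "Poly_Mapping.lookup (f' * h) 0 \<noteq> 0"
    then have "0 \<in> Poly_Mapping.keys (f' * h)" by (simp add: in_keys_iff)
    then obtain s t where "0 = s + t" "s \<in> Poly_Mapping.keys f'" using keys_mult by blast
    moreover have "s = 0"
    proof (rule poly_mapping_eqI)
      fix x
      have "Poly_Mapping.lookup (s + t) x = 0" by (simp flip: \<open>0 = s + t\<close>)
      then show "Poly_Mapping.lookup s x = Poly_Mapping.lookup 0 x" by (simp add: lookup_add)
    qed
    ultimately show False using f'0 by (simp add: in_keys_iff)
  qed
  then show ?thesis by (subst f) (simp add: distrib_right lookup_add)
qed

text \<open>The map that \<open>lin m\<close> induces after tensoring with k.\<close>

definition fbd :: "(nat \<Rightarrow> ('n, 'k::field) pvec) \<Rightarrow> (nat \<Rightarrow>\<^sub>0 'k) \<Rightarrow> (nat \<Rightarrow>\<^sub>0 'k)" where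
  "fbd m v = (\<Sum>b\<in>Poly_Mapping.keys v. scale (Poly_Mapping.lookup v b) (const0 (m b)))"

lemma const0_lin: "const0 (lin m v) = fbd m (const0 v)"
proof -
  have k: "Poly_Mapping.keys (const0 v) \<subseteq> Poly_Mapping.keys v"
    by (auto simp: in_keys_iff cf_def)
  have "fbd m (const0 v) = (\<Sum>b\<in>Poly_Mapping.keys v. scale (Poly_Mapping.lookup (const0 v) b) (const0 (m b)))"
    unfolding fbd_def by (rule sum.mono_neutral_left) (use k in \<open>auto simp: in_keys_iff\<close>)
  then show ?thesis
    by (intro poly_mapping_eqI) (simp add: lookup_sum lin_def cf_sum, simp add: cf_def lookup_times_0)
qed

text \<open>One treatment for two gradings: Betti numbers use the multigrading, a linear resolution
  the total degree. \<open>finite_gr\<close> makes all strands finite-dimensional.\<close>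

locale grading =
  fixes gr :: "('n::finite \<Rightarrow>\<^sub>0 nat) \<Rightarrow> 'g::cancel_comm_monoid_add"
  assumes gr_add: "gr (s + t) = gr s + gr t"
    and gr_eq_0: "gr t = 0 \<Longrightarrow> t = 0"
    and finite_gr: "finite {t. gr t = g}"
begin

lemma gr_0: "gr 0 = 0"
  using gr_add[of 0 0] by simp

definition graded_map :: "nat \<Rightarrow> (nat \<Rightarrow> 'g) \<Rightarrow> nat \<Rightarrow> (nat \<Rightarrow> 'g) \<Rightarrow> (nat \<Rightarrow> ('n, 'k::field) pvec) \<Rightarrow> bool" where
  "graded_map r' sh' r sh m \<longleftrightarrow> (\<forall>b<r'. m b \<in> free_module r \<and>
      (\<forall>c t. cf (m b) c t \<noteq> 0 \<longrightarrow> gr t + sh c = sh' b))"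

lemma lin_in_free_module:
  assumes "graded_map r' sh' r sh m" "v \<in> free_module r'"
  shows "lin m v \<in> free_module r"
  unfolding lin_def
proof (intro free_mod.subspace_sum[OF subspace_free_module] free_mod.subspace_scale[OF subspace_free_module])
  fix b assume "b \<in> Poly_Mapping.keys v"
  then show "m b \<in> free_module r"
    using assms unfolding graded_map_def free_module_def[of r'] by auto
qed

text \<open>\<open>Q\<close> is an arbitrary condition on degrees, so that the lemma applies to a
  condition and to its negation; together these give \<open>lin_prj\<close>.\<close>

lemma lin_degree:
  assumes m: "graded_map r' sh' r sh m" and v: "v \<in> free_module r'"
    and Q: "\<And>b t. cf v b t \<noteq> 0 \<Longrightarrow> Q (gr t + sh' b)"
    and nz: "cf (lin m v) c t \<noteq> 0"
  shows "Q (gr t + sh c)"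
proof -
  have "\<exists>b\<in>Poly_Mapping.keys v. cf (scale (Poly_Mapping.lookup v b) (m b)) c t \<noteq> 0"
    using nz unfolding lin_def cf_sum by (meson sum.neutral)
  then obtain b where b: "b \<in> Poly_Mapping.keys v"
    and "t \<in> Poly_Mapping.keys (Poly_Mapping.lookup v b * Poly_Mapping.lookup (m b) c)"
    by (auto simp: cf_def in_keys_iff)
  then obtain t1 t2 where t: "t = t1 + t2" "cf v b t1 \<noteq> 0" "cf (m b) c t2 \<noteq> 0"
    using keys_mult by (fastforce simp: cf_def in_keys_iff)
  have "b < r'" using b v by (auto simp: free_module_def)
  then have "gr t2 + sh c = sh' b" using m t(3) unfolding graded_map_def by blast
  then have "gr t + sh c = gr t1 + sh' b" using t(1) by (simp add: gr_add add.assoc)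
  then show ?thesis using Q[OF t(2)] by simp
qed

lemma lin_prj:
  assumes m: "graded_map r' sh' r sh m" and v: "v \<in> free_module r'"
  shows "lin m (prj (\<lambda>b t. Q (gr t + sh' b)) v) = prj (\<lambda>c t. Q (gr t + sh c)) (lin m v)"
proof -
  let ?p = "\<lambda>Q. prj (\<lambda>b t. Q (gr t + sh' b)) v"
  have split: "v = ?p Q + ?p (\<lambda>h. \<not> Q h)" by (rule pvec_eqI) simp
  have 1: "cf (lin m (?p Q)) c t \<noteq> 0 \<Longrightarrow> Q (gr t + sh c)" for c t
    by (rule lin_degree[OF m prj_free_module[OF v]]) (auto split: if_splits)
  have 2: "cf (lin m (?p (\<lambda>h. \<not> Q h))) c t \<noteq> 0 \<Longrightarrow> \<not> Q (gr t + sh c)" for c t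
    by (rule lin_degree[OF m prj_free_module[OF v], where Q = "\<lambda>h. \<not> Q h"]) (auto split: if_splits)
  have "lin m v = lin m (?p Q) + lin m (?p (\<lambda>h. \<not> Q h))"
    by (subst split) (rule lin_add)
  then have sum: "cf (lin m v) c t = cf (lin m (?p Q)) c t + cf (lin m (?p (\<lambda>h. \<not> Q h))) c t" for c t
    by simp
  show ?thesis
  proof (rule pvec_eqI)
    fix c t
    show "cf (lin m (?p Q)) c t = cf (prj (\<lambda>c t. Q (gr t + sh c)) (lin m v)) c t"
    proof (cases "Q (gr t + sh c)")
      case True
      then have "cf (lin m (?p (\<lambda>h. \<not> Q h))) c t = 0" using 2[of c t] by blast
      then show ?thesis using True sum[of c t] by simp
    next
      case False
      then have "cf (lin m (?p Q)) c t = 0" using 1[of c t] by blast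
      then show ?thesis using False by simp
    qed
  qed
qed

text \<open>The component of any preimage in the degrees allowed by \<open>Q\<close> is again a
  preimage.\<close>

lemma lin_lift:
  assumes m: "graded_map r' sh' r sh m" and w: "w \<in> lin m ` free_module r'"
    and Q: "\<And>c t. cf w c t \<noteq> 0 \<Longrightarrow> Q (gr t + sh c)"
  obtains v where "v \<in> free_module r'" "lin m v = w" "\<And>b t. cf v b t \<noteq> 0 \<Longrightarrow> Q (gr t + sh' b)"
proof -
  obtain v where v: "v \<in> free_module r'" "w = lin m v" using w by blast
  let ?v = "prj (\<lambda>b t. Q (gr t + sh' b)) v"
  have "lin m ?v = prj (\<lambda>c t. Q (gr t + sh c)) w" using lin_prj[OF m v(1)] v(2) by simp
  also have "\<dots> = w" using Q by (intro pvec_eqI) auto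
  finally have eq: "lin m ?v = w" .
  show ?thesis by (rule that[OF prj_free_module[OF v(1)] eq]) (simp split: if_splits)
qed

text \<open>The degree type has no subtraction. In this form the condition on a coefficient at S is
  a predicate of its degree inside the free module, as \<open>lin_degree\<close> and
  \<open>lin_lift\<close> expect.\<close>

lemma chain_degree: "gr (t + ind S) + h = g \<longleftrightarrow> gr (ind S) + (gr t + h) = g"
  by (simp add: gr_add algebra_simps)

lemma lift_chain:
  assumes m: "graded_map r' sh' r sh m" and c: "c \<in> kchains gr sh (lin m ` free_module r') i g"
  obtains c' where "c' \<in> kchains gr sh' (free_module r') i g" "(\<lambda>S. lin m (c' S)) = c"
proof -
  have "\<exists>v. v \<in> free_module r' \<and> lin m v = c S \<and> (\<forall>b t. cf v b t \<noteq> 0 \<longrightarrow> gr (t + ind S) + sh' b = g)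
      \<and> (card S \<noteq> i \<longrightarrow> v = 0)" for S
  proof (cases "card S = i")
    case False
    then show ?thesis using chainsD(2)[OF c False] free_mod.subspace_0[OF subspace_free_module]
      by (intro exI[of _ 0]) simp
  next
    case True
    obtain v where "v \<in> free_module r'" "lin m v = c S"
      "\<And>b t. cf v b t \<noteq> 0 \<Longrightarrow> gr (ind S) + (gr t + sh' b) = g"
      by (rule lin_lift[OF m chainsD(1)[OF c, of S], where Q = "\<lambda>h. gr (ind S) + h = g"])
        (use chainsD(3)[OF c] chain_degree in blast)+
    then show ?thesis using True by (auto simp: chain_degree)
  qed
  then obtain c' where c': "\<And>S. c' S \<in> free_module r'" "\<And>S. lin m (c' S) = c S"
    "\<And>S b t. cf (c' S) b t \<noteq> 0 \<Longrightarrow> gr (t + ind S) + sh' b = g" "\<And>S. card S \<noteq> i \<Longrightarrow> c' S = 0"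
    by metis
  show ?thesis
    by (rule that[of c'], rule chainsI) (use c' in auto)
qed

lemma lin_chain:
  assumes m: "graded_map r' sh' r sh m" and c: "c \<in> kchains gr sh' M i g" and M: "M \<subseteq> free_module r'"
  shows "(\<lambda>S. lin m (c S)) \<in> kchains gr sh (lin m ` M) i g"
proof (rule chainsI)
  fix S b t assume nz: "cf (lin m (c S)) b t \<noteq> 0"
  have cS: "c S \<in> free_module r'" using chainsD(1)[OF c] M by blast
  have "gr (ind S) + (gr t + sh b) = g"
    by (rule lin_degree[OF m cS _ nz, where Q = "\<lambda>h. gr (ind S) + h = g"])
      (use chainsD(3)[OF c] chain_degree in blast)
  then show "gr (t + ind S) + sh b = g" by (simp add: chain_degree)
qed (use chainsD(1,2)[OF c] in auto)

text \<open>By cancellation, all solutions t have the same value of \<open>gr\<close>.\<close>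

lemma finite_degree_fiber: "finite {t. gr (t + ind S) + h = g}"
proof (cases "\<exists>t0. gr (t0 + ind S) + h = g")
  case True
  then obtain t0 where "gr (t0 + ind S) + h = g" by blast
  then have "{t. gr (t + ind S) + h = g} \<subseteq> {t. gr t = gr t0}"
    by (auto simp: gr_add) 
  then show ?thesis using finite_gr finite_subset by blast
qed simp

lemma fin_dim_kchains:
  assumes M: "M \<subseteq> free_module r"
  shows "kch.fin_dim (kchains gr sh M i g :: ('n, 'k::field) kchain set)"
  unfolding kch.fin_dim_def
proof (intro exI conjI subsetI)
  \<comment> \<open>The monomial chains: x^t in component b at e_S. Those of the right degree are
    finite in number, and their span contains the strand.\<close>
  define E :: "'n set \<Rightarrow> nat \<Rightarrow> ('n \<Rightarrow>\<^sub>0 nat) \<Rightarrow> ('n, 'k) kchain" where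
    "E S b t = (\<lambda>S'. if S' = S then Poly_Mapping.single b (Poly_Mapping.single t 1) else 0)" for S b t
  have cf_E: "cf (E S b t S') b' t' = (if S = S' \<and> b = b' \<and> t = t' then 1 else 0)" for S b t S' b' t'
    by (auto simp: E_def cf_def lookup_single when_def)
  define T where "T S b = {t. gr (t + ind S) + sh b = g}" for S b
  let ?I = "SIGMA S:UNIV. SIGMA b:{..<r}. T S b"
  have fin: "finite (T S b)" for S b unfolding T_def by (rule finite_degree_fiber)
  show "finite ((\<lambda>(S, b, t). E S b t) ` ?I)" using fin by (intro finite_imageI finite_SigmaI) auto
  fix c assume c: "c \<in> kchains gr sh M i g"
  have "c = (\<Sum>(S, b, t)\<in>?I. kscale (cf (c S) b t) (E S b t))"
  proof (rule ext, rule pvec_eqI)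
    fix S b t
    have ap: "(\<Sum>x\<in>A. f x) S = (\<Sum>x\<in>A. f x S)" for A and f :: "'n set \<times> nat \<times> ('n \<Rightarrow>\<^sub>0 nat) \<Rightarrow> ('n, 'k) kchain"
      by (induction A rule: infinite_finite_induct) auto
    have "cf ((\<Sum>(S, b, t)\<in>?I. kscale (cf (c S) b t) (E S b t)) S) b t
       = (\<Sum>x\<in>?I. if x = (S, b, t) then cf (c S) b t else 0)"
      unfolding ap cf_sum by (rule sum.cong) (auto simp: kscale_def cf_E split: if_splits)
    also have "\<dots> = (if (S, b, t) \<in> ?I then cf (c S) b t else 0)"
      using fin by (subst sum.delta) auto
    also have "\<dots> = cf (c S) b t"
    proof (cases "cf (c S) b t = 0")
      case False
      then have "Poly_Mapping.lookup (c S) b \<noteq> 0" by (auto simp: cf_def)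
      then have "b < r" using chainsD(1)[OF c, of S] M by (metis free_module_iff not_less subsetD)
      then show ?thesis using chainsD(3)[OF c False] by (simp add: T_def)
    qed simp
    finally show "cf (c S) b t = cf ((\<Sum>(S, b, t)\<in>?I. kscale (cf (c S) b t) (E S b t)) S) b t" ..
  qed
  also have "\<dots> \<in> kch.span ((\<lambda>(S, b, t). E S b t) ` ?I)"
  proof (rule kch.span_sum, clarify)
    fix S b t assume "b < r" "t \<in> T S b"
    then have "E S b t \<in> (\<lambda>(S, b, t). E S b t) ` ?I" by (intro image_eqI[of _ _ "(S, b, t)"]) auto
    then show "kscale (cf (c S) b t) (E S b t) \<in> kch.span ((\<lambda>(S, b, t). E S b t) ` ?I)"
      by (intro kch.span_scale kch.span_base)
  qed
  finally show "c \<in> kch.span ((\<lambda>(S, b, t). E S b t) ` ?I)" .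
qed

definition koszul_dim :: "(nat \<Rightarrow> 'g) \<Rightarrow> ('n, 'k::field) pvec set \<Rightarrow> nat \<Rightarrow> 'g \<Rightarrow> nat" where
  "koszul_dim sh M i g = kch.dim (kcycles gr sh M i g) - kch.dim (kbounds gr sh M i g)"

end

section \<open>Koszul homology and resolutions\<close>

definition push :: "(nat \<Rightarrow> ('n, 'k::field) pvec) \<Rightarrow> ('n, 'k) kchain \<Rightarrow> ('n, 'k) kchain" where
  "push m c = (\<lambda>S. lin m (c S))"

lemma push_add: "push m (c + c') = push m c + push m c'"
  by (rule ext) (simp add: push_def lin_add)

lemma push_diff: "push m (c - c') = push m c - push m c'"
  by (rule ext) (simp add: push_def lin_diff)

lemma linear_push: "Vector_Spaces.linear kscale kscale (push m)"
  using kch.vector_space_axioms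
  by (simp add: Vector_Spaces.linear_iff push_add) (simp add: push_def kscale_def lin_scale)

lemma kd_push: "kd (push m c) = push m (kd c)"
  unfolding push_def by (rule kd_lin)

definition const_part :: "('n, 'k::field) kchain \<Rightarrow> nat \<Rightarrow>\<^sub>0 'k" where
  "const_part c = const0 (c {})"

lemma const_part_add: "const_part (c + c') = const_part c + const_part c'"
  by (rule poly_mapping_eqI) (simp add: const_part_def lookup_add)

lemma linear_const_part: "Vector_Spaces.linear kscale scale const_part"
  using kch.vector_space_axioms fin_vec.vector_space_axioms
  by (simp add: Vector_Spaces.linear_iff const_part_add)
    (auto intro!: poly_mapping_eqI simp: const_part_def kscale_def)

lemma const_part_push: "const_part (push m c) = fbd m (const_part c)"
  by (simp add: const_part_def push_def const0_lin)

lemma const_part_eq_0: "const_part c = 0 \<longleftrightarrow> (\<forall>b. cf (c {}) b 0 = 0)"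
  unfolding poly_mapping_eq_iff fun_eq_iff const_part_def by simp

definition const_chain :: "(nat \<Rightarrow>\<^sub>0 'k::field) \<Rightarrow> ('n, 'k) kchain" where
  "const_chain v = (\<lambda>S. if S = {} then Poly_Mapping.map (Poly_Mapping.single 0) v else 0)"

lemma cf_const_chain: "cf (const_chain v S) b t = (if S = {} \<and> t = 0 then Poly_Mapping.lookup v b else 0)"
  by (simp add: const_chain_def cf_def Poly_Mapping.map.rep_eq when_def lookup_single)

lemma const_part_const_chain [simp]: "const_part (const_chain v) = v"
  by (rule poly_mapping_eqI) (simp add: const_part_def cf_const_chain)

text \<open>\<open>m q\<close> maps the free module at position q + 1 to the one at position q, and
  exactness starts at position 1. So \<open>Im 0\<close> is the module under study, and the free
  modules from position 1 on resolve it.\<close>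

locale graded_complex = grading gr
  for gr :: "('n::finite \<Rightarrow>\<^sub>0 nat) \<Rightarrow> 'g::cancel_comm_monoid_add" +
  fixes r :: "nat \<Rightarrow> nat" and sh :: "nat \<Rightarrow> nat \<Rightarrow> 'g" and m :: "nat \<Rightarrow> nat \<Rightarrow> ('n, 'k::field) pvec"
  assumes graded: "graded_map (r (Suc q)) (sh (Suc q)) (r q) (sh q) (m q)"
    and exact: "{v \<in> free_module (r (Suc q)). lin (m q) v = 0} = lin (m (Suc q)) ` free_module (r (Suc (Suc q)))"
begin

abbreviation Fr :: "nat \<Rightarrow> ('n, 'k) pvec set" where "Fr q \<equiv> free_module (r q)"

abbreviation Im :: "nat \<Rightarrow> ('n, 'k) pvec set" where "Im q \<equiv> lin (m q) ` free_module (r (Suc q))"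

definition fib :: "nat \<Rightarrow> 'g \<Rightarrow> (nat \<Rightarrow>\<^sub>0 'k) set" where
  "fib q g = {v. Poly_Mapping.keys v \<subseteq> {b. b < r q \<and> sh q b = g}}"

lemma subspace_Im: "free_mod.subspace (Im q)"
  by (rule module_hom.subspace_image[OF module_hom_lin subspace_free_module])

lemma Im_subset: "Im q \<subseteq> Fr q"
  using lin_in_free_module[OF graded] by blast

lemma subspace_chains_Fr: "kch.subspace (kchains gr (sh q) (Fr q) i g)"
  by (rule subspace_kchains[OF subspace_free_module])

lemma subspace_bounds_Fr: "kch.subspace (kbounds gr (sh q) (Fr q) i g)"
  by (rule subspace_kbounds[OF subspace_free_module])

lemma chains_Im_subset: "kchains gr (sh q) (Im q) i g \<subseteq> kchains gr (sh q) (Fr q) i g"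
  by (rule chains_mono[OF Im_subset])

lemma bounds_Im_subset: "kbounds gr (sh q) (Im q) i g \<subseteq> kchains gr (sh q) (Im q) i g \<inter> kbounds gr (sh q) (Fr q) i g"
  using bounds_mono[OF Im_subset, of gr "sh q" q i g] bounds_subset_cycles[OF subspace_Im, of gr "sh q" q i g]
    cycles_subset_chains[of gr "sh q" "Im q" i g] by blast

lemma fin_dim_chains_Fr: "kch.fin_dim (kchains gr (sh q) (Fr q) i g)"
  by (rule fin_dim_kchains[OF order_refl])

lemma push_chain: "c \<in> kchains gr (sh (Suc q)) (Fr (Suc q)) i g \<Longrightarrow> push (m q) c \<in> kchains gr (sh q) (Im q) i g"
  unfolding push_def by (rule lin_chain[OF graded]) simp_all

lemma push_lift:
  assumes "c \<in> kchains gr (sh q) (Im q) i g"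
  obtains c' where "c' \<in> kchains gr (sh (Suc q)) (Fr (Suc q)) i g" "push (m q) c' = c"
  using lift_chain[OF graded assms] unfolding push_def by blast

text \<open>Together with \<open>push_lift\<close>, this is the short exact sequence of Koszul
  complexes with coefficients in \<open>Im (Suc q)\<close>, the free module and
  \<open>Im q\<close>.\<close>

lemma push_eq_0:
  assumes c: "c \<in> kchains gr (sh (Suc q)) (Fr (Suc q)) i g"
  shows "push (m q) c = 0 \<longleftrightarrow> c \<in> kchains gr (sh (Suc q)) (Im (Suc q)) i g"
proof
  assume 0: "push (m q) c = 0"
  show "c \<in> kchains gr (sh (Suc q)) (Im (Suc q)) i g"
  proof (rule chainsI)
    fix S
    have "lin (m q) (c S) = 0" using fun_cong[OF 0, of S] by (simp add: push_def)
    then show "c S \<in> Im (Suc q)" using chainsD(1)[OF c] exact[of q] by blast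
  qed (use chainsD[OF c] in auto)
next
  assume c: "c \<in> kchains gr (sh (Suc q)) (Im (Suc q)) i g"
  show "push (m q) c = 0"
    by (rule ext) (use chainsD(1)[OF c] exact[of q] in \<open>auto simp: push_def\<close>)
qed

text \<open>
  Both sides are subquotients of the chains \<open>c\<close> with coefficients in the free module whose differential
  has coefficients in its syzygies: such a \<open>c\<close> maps to a cycle of the quotient, and its differential is a
  cycle of the syzygies. This is the connecting homomorphism, read as a relation.
\<close>

lemma koszul_shift:
  "koszul_dim (sh q) (Im q) (Suc i) g
   = kch.dim (kchains gr (sh (Suc q)) (Im (Suc q)) i g \<inter> kbounds gr (sh (Suc q)) (Fr (Suc q)) i g)
     - kch.dim (kbounds gr (sh (Suc q)) (Im (Suc q)) i g)"
proof -
  let ?C = "kchains gr (sh (Suc q)) (Fr (Suc q)) (Suc i) g"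
  define X where "X = {c \<in> ?C. push (m q) (kd c) = 0}"
  have X: "kch.subspace X"
  proof (rule kch.subspaceI)
    show "0 \<in> X" using kch.subspace_0[OF subspace_chains_Fr] unfolding X_def by (simp add: push_def fun_eq_iff)
    show "x + y \<in> X" if "x \<in> X" "y \<in> X" for x y
      using that kch.subspace_add[OF subspace_chains_Fr, of x _ _ _ y] unfolding X_def by (simp add: kd_add push_add)
    show "kscale a x \<in> X" if "x \<in> X" for a x
      using that kch.subspace_scale[OF subspace_chains_Fr, of x _ _ _ a] linear_push[of "m q"] unfolding X_def
      by (simp add: kd_kscale Vector_Spaces.linear_iff)
  qed
  have "X \<subseteq> ?C" unfolding X_def by blast
  then have fdX: "kch.fin_dim X" by (rule kch.fin_dim_subset[OF fin_dim_chains_Fr])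
  have A: "push (m q) ` X = kcycles gr (sh q) (Im q) (Suc i) g"
  proof (intro equalityI subsetI)
    fix x assume "x \<in> push (m q) ` X"
    then show "x \<in> kcycles gr (sh q) (Im q) (Suc i) g"
      using push_chain by (auto simp: X_def kcycles_def kd_push)
  next
    fix x assume x: "x \<in> kcycles gr (sh q) (Im q) (Suc i) g"
    then obtain c where "c \<in> ?C" "push (m q) c = x"
      using push_lift[OF subsetD[OF cycles_subset_chains x]] by blast
    then show "x \<in> push (m q) ` X" using x by (auto simp: X_def kcycles_def simp flip: kd_push)
  qed
  have A': "kd ` X = kchains gr (sh (Suc q)) (Im (Suc q)) i g \<inter> kbounds gr (sh (Suc q)) (Fr (Suc q)) i g"
  proof (intro equalityI subsetI)
    fix x assume "x \<in> kd ` X"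
    then obtain c where "c \<in> ?C" "push (m q) (kd c) = 0" "x = kd c" by (auto simp: X_def)
    then show "x \<in> kchains gr (sh (Suc q)) (Im (Suc q)) i g \<inter> kbounds gr (sh (Suc q)) (Fr (Suc q)) i g"
      using push_eq_0[OF kd_chains[OF subspace_free_module]] by (auto simp: kbounds_def)
  next
    fix x assume x: "x \<in> kchains gr (sh (Suc q)) (Im (Suc q)) i g \<inter> kbounds gr (sh (Suc q)) (Fr (Suc q)) i g"
    then obtain c where "c \<in> ?C" "x = kd c" by (auto simp: kbounds_def)
    then show "x \<in> kd ` X"
      using x push_eq_0[OF kd_chains[OF subspace_free_module]] by (auto simp: X_def)
  qed
  have B: "kbounds gr (sh q) (Im q) (Suc i) g \<subseteq> push (m q) ` X"
    unfolding A by (rule bounds_subset_cycles[OF subspace_Im])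
  have B': "kbounds gr (sh (Suc q)) (Im (Suc q)) i g \<subseteq> kd ` X"
    unfolding A' by (rule bounds_Im_subset)
  have eq: "push (m q) c \<in> kbounds gr (sh q) (Im q) (Suc i) g
      \<longleftrightarrow> kd c \<in> kbounds gr (sh (Suc q)) (Im (Suc q)) i g" if "c \<in> X" for c
  proof
    have c: "c \<in> ?C" using that by (simp add: X_def)
    show "kd c \<in> kbounds gr (sh (Suc q)) (Im (Suc q)) i g"
      if h: "push (m q) c \<in> kbounds gr (sh q) (Im q) (Suc i) g"
    proof -
      obtain e where e: "e \<in> kchains gr (sh q) (Im q) (Suc (Suc i)) g" "push (m q) c = kd e"
        using h unfolding kbounds_def by blast
      obtain e' where e': "e' \<in> kchains gr (sh (Suc q)) (Fr (Suc q)) (Suc (Suc i)) g" "push (m q) e' = e"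
        by (rule push_lift[OF e(1)])
      \<comment> \<open>Correcting \<open>c\<close> by a boundary moves it into the syzygies and
        does not change \<open>kd c\<close>.\<close>
      have "push (m q) (c - kd e') = 0" using e e' by (simp add: push_diff flip: kd_push)
      then have "c - kd e' \<in> kchains gr (sh (Suc q)) (Im (Suc q)) (Suc i) g"
        using push_eq_0[OF kch.subspace_diff[OF subspace_chains_Fr c kd_chains[OF subspace_free_module e'(1)]]] by blast
      moreover have "kd c = kd (c - kd e')" by (simp add: kd_diff)
      ultimately show ?thesis unfolding kbounds_def by blast
    qed
    show "push (m q) c \<in> kbounds gr (sh q) (Im q) (Suc i) g"
      if h: "kd c \<in> kbounds gr (sh (Suc q)) (Im (Suc q)) i g"
    proof -
      obtain e where e: "e \<in> kchains gr (sh (Suc q)) (Im (Suc q)) (Suc i) g" "kd c = kd e"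
        using h unfolding kbounds_def by blast
      have eC: "e \<in> ?C" using e(1) chains_Im_subset by blast
      \<comment> \<open>A cycle over a free module in positive exterior degree is a boundary, and
        \<open>push (m q)\<close> kills the correction \<open>e\<close>.\<close>
      have "c - e \<in> kcycles gr (sh (Suc q)) (Fr (Suc q)) (Suc i) g"
        using kch.subspace_diff[OF subspace_chains_Fr c eC] e(2) by (simp add: kcycles_def kd_diff)
      then have "c - e \<in> kbounds gr (sh (Suc q)) (Fr (Suc q)) (Suc i) g" by (simp add: free_acyclic)
      then obtain e' where e': "e' \<in> kchains gr (sh (Suc q)) (Fr (Suc q)) (Suc (Suc i)) g" "c - e = kd e'"
        by (auto simp: kbounds_def)
      have "push (m q) e = 0" using push_eq_0[OF eC] e(1) by blast
      then have "push (m q) c = push (m q) (c - e)" by (simp add: push_diff)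
      also have "\<dots> = kd (push (m q) e')" using e' by (simp add: kd_push)
      finally show ?thesis using push_chain[OF e'(1)] unfolding kbounds_def by blast
    qed
  qed
  have "kch.dim (push (m q) ` X) - kch.dim (kbounds gr (sh q) (Im q) (Suc i) g)
      = kch.dim (kd ` X) - kch.dim (kbounds gr (sh (Suc q)) (Im (Suc q)) i g)"
    by (rule subquotient_dim_eq[OF kch_pair kch_pair linear_push linear_kd X fdX
          subspace_kbounds[OF subspace_Im] B subspace_kbounds[OF subspace_Im] B' eq])
  then show ?thesis unfolding A A' koszul_dim_def .
qed

text \<open>In positive exterior degree every cycle over the free module is a boundary, so the
  intersection in \<open>koszul_shift\<close> is the space of all cycles. In exterior degree 0 this
  fails; \<open>koszul_end\<close> treats that case.\<close>

lemma koszul_shift_Suc: "koszul_dim (sh q) (Im q) (Suc (Suc i)) g = koszul_dim (sh (Suc q)) (Im (Suc q)) (Suc i) g"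
proof -
  have "kchains gr (sh (Suc q)) (Im (Suc q)) (Suc i) g \<inter> kbounds gr (sh (Suc q)) (Fr (Suc q)) (Suc i) g
    = kcycles gr (sh (Suc q)) (Im (Suc q)) (Suc i) g"
    using free_acyclic[of "Suc i" gr "sh (Suc q)" "r (Suc q)" g, where 'k = 'k]
      chains_Im_subset[of "Suc q" "Suc i" g]
    by (auto simp: kcycles_def)
  then show ?thesis unfolding koszul_shift[of q "Suc i" g] by (simp add: koszul_dim_def)
qed

text \<open>It stops at exterior degree 1, because the next shift is the exceptional one.\<close>

lemma koszul_shift_iterate: "koszul_dim (sh q) (Im q) (Suc i) g = koszul_dim (sh (q + i)) (Im (q + i)) 1 g"
  by (induction i arbitrary: q) (simp_all add: koszul_shift_Suc)

section \<open>Exterior degree zero and the homology of the fibers\<close>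

lemma const_chain_in:
  assumes "v \<in> fib q g"
  shows "const_chain v \<in> kchains gr (sh q) (Fr q) 0 g"
proof (rule chainsI)
  show "const_chain v S \<in> Fr q" for S
    using assms
    by (auto simp: const_chain_def free_module_def fib_def in_keys_iff Poly_Mapping.map.rep_eq when_def subset_iff split: if_splits)
  show "const_chain v S = 0" if "card S \<noteq> 0" for S
    using that by (auto simp: const_chain_def)
  show "gr (t + ind S) + sh q b = g" if "cf (const_chain v S) b t \<noteq> 0" for S b t
    using that assms by (auto simp: cf_const_chain fib_def in_keys_iff gr_0 split: if_splits)
qed

lemma const_part_in:
  assumes c: "c \<in> kchains gr (sh q) (Fr q) 0 g"
  shows "const_part c \<in> fib q g"
  unfolding fib_def mem_Collect_eq
proof (rule subsetI)
  fix b assume "b \<in> Poly_Mapping.keys (const_part c)"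
  then have nz: "cf (c {}) b 0 \<noteq> 0" by (simp add: in_keys_iff const_part_def)
  then have "b < r q" using chainsD(1)[OF c, of "{}"] by (metis cf_def free_module_iff lookup_zero not_less)
  then show "b \<in> {b. b < r q \<and> sh q b = g}" using chainsD(3)[OF c nz] by (simp add: gr_0)
qed

lemma bounds_0_iff:
  "c \<in> kchains gr (sh q) (Fr q) 0 g \<Longrightarrow> c \<in> kbounds gr (sh q) (Fr q) 0 g \<longleftrightarrow> const_part c = 0"
  unfolding const_part_eq_0 by (rule free_bounds_0)

text \<open>Both sides are subquotients of the space \<open>X\<close> of chains over the free module
  at position q + 1, one through \<open>push\<close>, the other through \<open>const_part\<close>.
  In both, the elements of \<open>X\<close> that become boundaries are those whose coefficient lies
  in \<open>Im (Suc q)\<close> plus the maximal ideal times the free module. For q = 0 the extra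
  conditions disappear, because position 0 precedes the resolution and everything in homological
  degree 0 of the fiber complex is a cycle.\<close>

lemma koszul_end:
  fixes q :: nat and g :: 'g
  defines "Y \<equiv> {c \<in> kchains gr (sh q) (Im q) 0 g. q = 0 \<or> c \<in> kbounds gr (sh q) (Fr q) 0 g}"
  shows "kch.dim Y - kch.dim (kbounds gr (sh q) (Im q) 0 g)
    = fin_vec.dim {v \<in> fib (Suc q) g. q = 0 \<or> fbd (m q) v = 0} - fin_vec.dim (fbd (m (Suc q)) ` fib (Suc (Suc q)) g)"
proof -
  let ?C = "kchains gr (sh (Suc q)) (Fr (Suc q)) 0 g"
  define X where "X = {c \<in> ?C. q = 0 \<or> push (m q) c \<in> kbounds gr (sh q) (Fr q) 0 g}"
  interpret pl: Vector_Spaces.linear kscale kscale "push (m q)" by (rule linear_push)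
  have X: "kch.subspace X"
    using kch.subspace_add[OF subspace_chains_Fr] kch.subspace_scale[OF subspace_chains_Fr] kch.subspace_0[OF subspace_chains_Fr]
      kch.subspace_add[OF subspace_bounds_Fr] kch.subspace_scale[OF subspace_bounds_Fr] kch.subspace_0[OF subspace_bounds_Fr]
    by (intro kch.subspaceI) (auto simp: X_def pl.add pl.scale pl.zero)
  have "X \<subseteq> ?C" unfolding X_def by blast
  then have fdX: "kch.fin_dim X" by (rule kch.fin_dim_subset[OF fin_dim_chains_Fr])
  have A: "push (m q) ` X = Y"
  proof (intro equalityI subsetI)
    fix x assume "x \<in> push (m q) ` X"
    then obtain c where "c \<in> X" "x = push (m q) c" by blast
    then show "x \<in> Y" using push_chain[of c q 0 g] by (simp add: X_def Y_def)
  next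
    fix x assume x: "x \<in> Y"
    then obtain c where "c \<in> ?C" "push (m q) c = x"
      using push_lift[of x q 0 g] unfolding Y_def by blast
    moreover then have "c \<in> X" using x by (simp add: X_def Y_def)
    ultimately show "x \<in> push (m q) ` X" by blast
  qed
  have A': "const_part ` X = {v \<in> fib (Suc q) g. q = 0 \<or> fbd (m q) v = 0}"
  proof (intro equalityI subsetI)
    fix v assume "v \<in> const_part ` X"
    then obtain c where c: "c \<in> ?C" "q = 0 \<or> push (m q) c \<in> kbounds gr (sh q) (Fr q) 0 g" "v = const_part c"
      by (auto simp: X_def)
    have "push (m q) c \<in> kchains gr (sh q) (Fr q) 0 g" using push_chain[OF c(1)] chains_Im_subset by blast
    then have "q = 0 \<or> fbd (m q) v = 0"
      using c(2,3) bounds_0_iff[of "push (m q) c" q g] by (simp add: const_part_push)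
    then show "v \<in> {v \<in> fib (Suc q) g. q = 0 \<or> fbd (m q) v = 0}" using const_part_in[OF c(1)] c(3) by blast
  next
    fix v assume v: "v \<in> {v \<in> fib (Suc q) g. q = 0 \<or> fbd (m q) v = 0}"
    let ?c = "const_chain v :: ('n, 'k) kchain"
    have c: "?c \<in> ?C" using v const_chain_in by blast
    have "push (m q) ?c \<in> kchains gr (sh q) (Fr q) 0 g" using push_chain[OF c] chains_Im_subset by blast
    then have "q = 0 \<or> push (m q) ?c \<in> kbounds gr (sh q) (Fr q) 0 g"
      using v bounds_0_iff[of "push (m q) ?c" q g] by (simp add: const_part_push)
    then have "?c \<in> X" using c by (simp add: X_def)
    then show "v \<in> const_part ` X" by (metis const_part_const_chain imageI)
  qed
  have B: "kbounds gr (sh q) (Im q) 0 g \<subseteq> push (m q) ` X"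
    unfolding A Y_def using bounds_Im_subset by blast
  have z: "const_part (kd e) = 0" if "e \<in> kchains gr (sh (Suc q)) (Fr (Suc q)) (Suc 0) g" for e
    using that bounds_0_iff[OF kd_chains[OF subspace_free_module that]] unfolding kbounds_def by blast
  have eq: "push (m q) c \<in> kbounds gr (sh q) (Im q) 0 g \<longleftrightarrow> const_part c \<in> fbd (m (Suc q)) ` fib (Suc (Suc q)) g"
    if "c \<in> X" for c
  proof
    have c: "c \<in> ?C" using that by (simp add: X_def)
    show "const_part c \<in> fbd (m (Suc q)) ` fib (Suc (Suc q)) g" if h: "push (m q) c \<in> kbounds gr (sh q) (Im q) 0 g"
    proof -
      obtain e where e: "e \<in> kchains gr (sh q) (Im q) (Suc 0) g" "push (m q) c = kd e"
        using h unfolding kbounds_def by blast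
      obtain e' where e': "e' \<in> kchains gr (sh (Suc q)) (Fr (Suc q)) (Suc 0) g" "push (m q) e' = e"
        by (rule push_lift[OF e(1)])
      have "push (m q) (c - kd e') = 0" using e e' by (simp add: push_diff flip: kd_push)
      then have "c - kd e' \<in> kchains gr (sh (Suc q)) (Im (Suc q)) 0 g"
        using push_eq_0[OF kch.subspace_diff[OF subspace_chains_Fr c kd_chains[OF subspace_free_module e'(1)]]] by blast
      \<comment> \<open>Syzygies are images from the next free module; the constant part of
        \<open>y\<close> then exhibits \<open>const_part c\<close> as a boundary of the fiber
        complex.\<close>
      then obtain y where y: "y \<in> kchains gr (sh (Suc (Suc q))) (Fr (Suc (Suc q))) 0 g" "push (m (Suc q)) y = c - kd e'"
        by (rule push_lift)
      have "const_part c = const_part ((c - kd e') + kd e')" by simp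
      also have "\<dots> = fbd (m (Suc q)) (const_part y)"
        unfolding const_part_add z[OF e'(1)] by (simp add: const_part_push flip: y(2))
      finally show ?thesis using const_part_in[OF y(1)] by blast
    qed
    show "push (m q) c \<in> kbounds gr (sh q) (Im q) 0 g" if h: "const_part c \<in> fbd (m (Suc q)) ` fib (Suc (Suc q)) g"
    proof -
      obtain v where v: "v \<in> fib (Suc (Suc q)) g" "const_part c = fbd (m (Suc q)) v" using h by blast
      define y :: "('n, 'k) kchain" where "y = const_chain v"
      have y: "y \<in> kchains gr (sh (Suc (Suc q))) (Fr (Suc (Suc q))) 0 g"
        unfolding y_def by (rule const_chain_in[OF v(1)])
      have py: "push (m (Suc q)) y \<in> kchains gr (sh (Suc q)) (Im (Suc q)) 0 g" by (rule push_chain[OF y])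
      then have pyC: "push (m (Suc q)) y \<in> ?C" using chains_Im_subset by blast
      have ppy: "push (m q) (push (m (Suc q)) y) = 0" using push_eq_0[OF pyC] py by blast
      let ?z = "c - push (m (Suc q)) y"
      have zC: "?z \<in> ?C" by (rule kch.subspace_diff[OF subspace_chains_Fr c pyC])
      have "const_part ?z + const_part (push (m (Suc q)) y) = const_part c"
        by (simp flip: const_part_add)
      then have "const_part ?z = 0" using v(2) by (simp add: const_part_push y_def)
      then have "?z \<in> kbounds gr (sh (Suc q)) (Fr (Suc q)) 0 g"
        using bounds_0_iff[OF zC] by blast
      then obtain e where e: "e \<in> kchains gr (sh (Suc q)) (Fr (Suc q)) (Suc 0) g" "?z = kd e"
        by (auto simp: kbounds_def)
      have "push (m q) c = push (m q) ?z" using ppy by (simp add: push_diff)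
      also have "\<dots> = kd (push (m q) e)" using e by (simp add: kd_push)
      finally show ?thesis using push_chain[OF e(1)] unfolding kbounds_def by blast
    qed
  qed
  have pair: "vector_space_pair kscale (scale :: 'k \<Rightarrow> (nat \<Rightarrow>\<^sub>0 'k) \<Rightarrow> (nat \<Rightarrow>\<^sub>0 'k))" by unfold_locales
  have B': "fbd (m (Suc q)) ` fib (Suc (Suc q)) g \<subseteq> const_part ` X"
  proof
    fix w assume "w \<in> fbd (m (Suc q)) ` fib (Suc (Suc q)) g"
    then obtain v where v: "v \<in> fib (Suc (Suc q)) g" "w = fbd (m (Suc q)) v" by blast
    define y :: "('n, 'k) kchain" where "y = const_chain v"
    have y: "y \<in> kchains gr (sh (Suc (Suc q))) (Fr (Suc (Suc q))) 0 g"
      unfolding y_def by (rule const_chain_in[OF v(1)])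
    have py: "push (m (Suc q)) y \<in> kchains gr (sh (Suc q)) (Im (Suc q)) 0 g" by (rule push_chain[OF y])
    then have pyC: "push (m (Suc q)) y \<in> ?C" using chains_Im_subset by blast
    have "push (m q) (push (m (Suc q)) y) = 0" using push_eq_0[OF pyC] py by blast
    then have "push (m (Suc q)) y \<in> X" using pyC kch.subspace_0[OF subspace_bounds_Fr] by (simp add: X_def)
    moreover have "w = const_part (push (m (Suc q)) y)" by (simp add: const_part_push y_def v(2))
    ultimately show "w \<in> const_part ` X" by blast
  qed
  have sB': "free_mod.subspace (fbd (m (Suc q)) ` fib (Suc (Suc q)) g)"
  proof -
    let ?X' = "kchains gr (sh (Suc (Suc q))) (Fr (Suc (Suc q))) 0 g"
    \<comment> \<open>\<open>const_chain\<close> makes \<open>const_part\<close> surjective onto the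
      fiber, so these boundaries are a linear image of a strand.\<close>
    have fib_eq: "fib (Suc (Suc q)) g = const_part ` ?X'"
      using const_part_in const_chain_in by (force intro: image_eqI[of _ _ "const_chain _"])
    have "fbd (m (Suc q)) ` fib (Suc (Suc q)) g = const_part ` (push (m (Suc q)) ` ?X')"
      unfolding fib_eq image_image by (simp add: const_part_push)
    moreover have "kch.subspace (push (m (Suc q)) ` ?X')"
      using module_hom.subspace_image[of kscale kscale] linear_push subspace_chains_Fr by (metis module_hom_iff_linear)
    then have "free_mod.subspace (const_part ` (push (m (Suc q)) ` ?X'))"
      using module_hom.subspace_image[of kscale scale] linear_const_part by (metis module_hom_iff_linear)
    ultimately show ?thesis by simp
  qed
  have "kch.dim (push (m q) ` X) - kch.dim (kbounds gr (sh q) (Im q) 0 g)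
      = fin_vec.dim (const_part ` X) - fin_vec.dim (fbd (m (Suc q)) ` fib (Suc (Suc q)) g)"
    by (rule subquotient_dim_eq[OF kch_pair pair linear_push linear_const_part X fdX
          subspace_kbounds[OF subspace_Im] B sB' B' eq])
  then show ?thesis unfolding A A' .
qed

text \<open>Homological degree i of the resolution sits at position i + 1, since position 0 holds
  the free module that contains \<open>Im 0\<close>.\<close>

lemma koszul_dim_eq_fiber_dim:
  "koszul_dim (sh 0) (Im 0) i g
    = fin_vec.dim {v \<in> fib (Suc i) g. i = 0 \<or> fbd (m i) v = 0} - fin_vec.dim (fbd (m (Suc i)) ` fib (Suc (Suc i)) g)"
proof (cases i)
  case 0
  then show ?thesis using koszul_end[of 0 g] cycles_0[OF subspace_Im, of gr "sh 0" 0 g] by (simp add: koszul_dim_def)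
next
  case (Suc i')
  have "koszul_dim (sh 0) (Im 0) (Suc i') g = koszul_dim (sh i') (Im i') (Suc 0) g"
    using koszul_shift_iterate[of 0 i' g] by simp
  also have "\<dots> = kch.dim {c \<in> kchains gr (sh i) (Im i) 0 g. i = 0 \<or> c \<in> kbounds gr (sh i) (Fr i) 0 g}
     - kch.dim (kbounds gr (sh i) (Im i) 0 g)"
    unfolding koszul_shift Suc by (simp add: Int_def)
  finally show ?thesis unfolding koszul_end[symmetric] Suc .
qed

end

section \<open>Monomial ideals\<close>

lemma poly_mapping_sum_keys: "f = (\<Sum>t\<in>Poly_Mapping.keys f. Poly_Mapping.single t (Poly_Mapping.lookup f t))"
  for f :: "'a \<Rightarrow>\<^sub>0 'b::comm_monoid_add"
proof (rule poly_mapping_eqI)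
  fix t
  have "(\<Sum>s\<in>Poly_Mapping.keys f. Poly_Mapping.lookup (Poly_Mapping.single s (Poly_Mapping.lookup f s)) t)
      = (\<Sum>s\<in>Poly_Mapping.keys f. if s = t then Poly_Mapping.lookup f s else 0)"
    by (rule sum.cong) (auto simp: lookup_single when_def)
  then show "Poly_Mapping.lookup f t
      = Poly_Mapping.lookup (\<Sum>t\<in>Poly_Mapping.keys f. Poly_Mapping.single t (Poly_Mapping.lookup f t)) t"
    by (simp add: lookup_sum in_keys_iff)
qed

lemma monom_times: "monom s * monom t = monom (s + t)"
  by (simp add: monom_def mult_single)

lemma single_eq_times_monom: "Poly_Mapping.single (s + t) c = Poly_Mapping.single s c * monom t"
  by (simp add: monom_def mult_single)

lemma keys_monom [simp]: "Poly_Mapping.keys (monom t :: ('n, 'k::field) mpoly) = {t}"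
  by (simp add: monom_def)

lemma monom_inject [simp]: "(monom s :: ('n, 'k::field) mpoly) = monom t \<longleftrightarrow> s = t"
  by (metis keys_monom singleton_inject)

lemma ideal_span_add: "f \<in> ideal_span S \<Longrightarrow> g \<in> ideal_span S \<Longrightarrow> f + g \<in> ideal_span S"
  unfolding ideal_span_def by (rule module.span_add[OF module_times])

lemma ideal_span_mult: "f \<in> ideal_span S \<Longrightarrow> h * f \<in> ideal_span S"
  unfolding ideal_span_def by (rule module.span_scale[OF module_times])

lemma ideal_span_base: "f \<in> S \<Longrightarrow> f \<in> ideal_span S"
  unfolding ideal_span_def by (rule module.span_base[OF module_times])

lemma ideal_span_sum: "(\<And>x. x \<in> A \<Longrightarrow> f x \<in> ideal_span S) \<Longrightarrow> (\<Sum>x\<in>A. f x) \<in> ideal_span S"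
  unfolding ideal_span_def by (rule module.span_sum[OF module_times])

lemma keys_mult_exponent:
  assumes "t \<in> Poly_Mapping.keys (f * g)"
  obtains s u where "s \<in> Poly_Mapping.keys f" "u \<in> Poly_Mapping.keys g" "t = s + u"
  using subsetD[OF keys_mult assms] that by auto

text \<open>The right-hand side describes an ideal that contains the generators. Conversely, a
  polynomial is the sum of its terms, here multiples of generators.\<close>

lemma in_ideal_span_monom_iff:
  "f \<in> ideal_span (monom ` A) \<longleftrightarrow> (\<forall>t\<in>Poly_Mapping.keys f. \<exists>a\<in>A. \<exists>u. t = a + u)"
  for f :: "('n, 'k::field) mpoly"
proof
  let ?U = "{f :: ('n, 'k) mpoly. \<forall>t\<in>Poly_Mapping.keys f. \<exists>a\<in>A. \<exists>u. t = a + u}"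
  have "module.subspace (*) ?U"
  proof (rule module.subspaceI[OF module_times])
    show "x + y \<in> ?U" if "x \<in> ?U" "y \<in> ?U" for x y
      using that Poly_Mapping.keys_add[of x y] by blast
    show "c * x \<in> ?U" if x: "x \<in> ?U" for c x
    proof (intro CollectI ballI)
      fix t assume "t \<in> Poly_Mapping.keys (c * x)"
      then obtain s u where "s \<in> Poly_Mapping.keys c" "u \<in> Poly_Mapping.keys x" "t = s + u"
        by (rule keys_mult_exponent)
      moreover then obtain a w where "a \<in> A" "u = a + w" using x by blast
      ultimately have "t = a + (s + w)" by (simp add: add.left_commute)
      then show "\<exists>a\<in>A. \<exists>u. t = a + u" using \<open>a \<in> A\<close> by blast
    qed
  qed simp
  moreover have "monom ` A \<subseteq> ?U"
  proof (rule image_subsetI)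
    fix a assume "a \<in> A"
    then show "monom a \<in> ?U" using add.right_neutral[of a] by (simp, metis)
  qed
  ultimately have "ideal_span (monom ` A) \<subseteq> ?U"
    unfolding ideal_span_def by (intro module.span_minimal[OF module_times])
  moreover assume "f \<in> ideal_span (monom ` A)"
  ultimately show "\<forall>t\<in>Poly_Mapping.keys f. \<exists>a\<in>A. \<exists>u. t = a + u" by blast
next
  assume f: "\<forall>t\<in>Poly_Mapping.keys f. \<exists>a\<in>A. \<exists>u. t = a + u"
  have "Poly_Mapping.single t (Poly_Mapping.lookup f t) \<in> ideal_span (monom ` A)" if t: "t \<in> Poly_Mapping.keys f" for t
  proof -
    obtain a u where a: "a \<in> A" "t = u + a" using f t by (metis add.commute)
    show ?thesis unfolding a(2) single_eq_times_monom
      by (rule ideal_span_mult[OF ideal_span_base]) (use a in blast)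
  qed
  then show "f \<in> ideal_span (monom ` A)"
    by (subst poly_mapping_sum_keys) (rule ideal_span_sum)
qed

lemma monom_in_ideal_span_iff:
  "(monom t :: ('n, 'k::field) mpoly) \<in> ideal_span (monom ` A) \<longleftrightarrow> (\<exists>a\<in>A. \<exists>u. t = a + u)"
  by (simp add: in_ideal_span_monom_iff)

lemma in_ideal_span_monomE:
  fixes f :: "('n, 'k::field) mpoly"
  assumes "f \<in> ideal_span (monom ` A)" "t \<in> Poly_Mapping.keys f"
  obtains a u where "a \<in> A" "t = a + u"
proof -
  have "\<exists>a\<in>A. \<exists>u. t = a + u" using assms(1)[unfolded in_ideal_span_monom_iff] assms(2) by (rule bspec)
  then show ?thesis using that by (elim bexE exE)
qed

lemma monom_in_ideal_spanE:
  assumes "(monom t :: ('n, 'k::field) mpoly) \<in> ideal_span (monom ` A)"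
  obtains a u where "a \<in> A" "t = a + u"
proof -
  have "t \<in> Poly_Mapping.keys (monom t :: ('n, 'k) mpoly)" by simp
  then obtain a u where "a \<in> A" "t = a + u" by (rule in_ideal_span_monomE[OF assms])
  then show ?thesis by (rule that)
qed

lemma monomial_idealE:
  assumes "monomial_ideal (L :: ('n, 'k::field) mpoly set)"
  obtains A where "L = ideal_span (monom ` A)"
proof -
  obtain G where "G \<subseteq> range monom" "L = ideal_span G" using assms unfolding monomial_ideal_def by blast
  moreover then obtain A where "G = monom ` A" by (elim subset_imageE)
  ultimately show ?thesis using that by simp
qed

lemma monomial_ideal_span: "monomial_ideal (ideal_span (monom ` A) :: ('n, 'k::field) mpoly set)"
  unfolding monomial_ideal_def by (intro exI[of _ "monom ` A"]) auto

lemma monomial_ideal_keys: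
  assumes "monomial_ideal (L :: ('n, 'k::field) mpoly set)"
  shows "f \<in> L \<longleftrightarrow> (\<forall>t\<in>Poly_Mapping.keys f. monom t \<in> L)"
proof -
  obtain A where "L = ideal_span (monom ` A)" using assms by (rule monomial_idealE)
  then show ?thesis by (simp add: in_ideal_span_monom_iff)
qed

lemma monomial_ideal_module:
  assumes "monomial_ideal (L :: ('n, 'k::field) mpoly set)"
  shows "0 \<in> L" "f \<in> L \<Longrightarrow> g \<in> L \<Longrightarrow> f + g \<in> L" "f \<in> L \<Longrightarrow> h * f \<in> L"
proof -
  obtain A where L: "L = ideal_span (monom ` A)" using assms by (rule monomial_idealE)
  show "0 \<in> L" by (simp add: L in_ideal_span_monom_iff)
  show "f \<in> L \<Longrightarrow> g \<in> L \<Longrightarrow> f + g \<in> L" "f \<in> L \<Longrightarrow> h * f \<in> L"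
    unfolding L by (rule ideal_span_add ideal_span_mult; assumption)+
qed

lemma monomial_ideal_add:
  assumes "monomial_ideal (L :: ('n, 'k::field) mpoly set)" "monom t \<in> L"
  shows "monom (s + t) \<in> L"
  using monomial_ideal_module(3)[OF assms, of "monom s"] by (simp add: monom_times)

lemma monomial_ideal_Int:
  assumes "monomial_ideal (L :: ('n, 'k::field) mpoly set)" "monomial_ideal L'"
  shows "monomial_ideal (L \<inter> L')"
proof -
  let ?A = "{t. (monom t :: ('n, 'k) mpoly) \<in> L \<inter> L'}"
  have "L \<inter> L' = ideal_span (monom ` ?A)"
  proof (intro set_eqI iffI)
    fix f assume "f \<in> L \<inter> L'"
    then have "\<forall>t\<in>Poly_Mapping.keys f. monom t \<in> L \<and> monom t \<in> L'"
      using monomial_ideal_keys[OF assms(1), of f] monomial_ideal_keys[OF assms(2), of f] by blast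
    then show "f \<in> ideal_span (monom ` ?A)"
      unfolding in_ideal_span_monom_iff by (metis (mono_tags, lifting) IntI add.right_neutral mem_Collect_eq)
  next
    fix f :: "('n, 'k) mpoly" assume f: "f \<in> ideal_span (monom ` ?A)"
    have "monom t \<in> L \<and> monom t \<in> L'" if t: "t \<in> Poly_Mapping.keys f" for t
    proof -
      obtain a u where au: "a \<in> ?A" "t = a + u"
        by (rule in_ideal_span_monomE[OF f t])
      show ?thesis
        using au(1) monomial_ideal_add[OF assms(1), of a u] monomial_ideal_add[OF assms(2), of a u]
        by (simp add: au(2) add.commute)
    qed
    then show "f \<in> L \<inter> L'"
      by (subst Int_iff, subst monomial_ideal_keys[OF assms(1)], subst monomial_ideal_keys[OF assms(2)]) simp
  qed
  then show ?thesis using monomial_ideal_span by metis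
qed

section \<open>Minimal monomial generators\<close>

lemma total_degree_add: "total_degree (s + t) = total_degree s + total_degree t"
  by (simp add: total_degree_def lookup_add sum.distrib)

lemma total_degree_eq_0: "total_degree t = 0 \<longleftrightarrow> t = 0"
  by (auto simp: total_degree_def intro: poly_mapping_eqI)

definition min_exps :: "('n, 'k::field) mpoly set \<Rightarrow> ('n \<Rightarrow>\<^sub>0 nat) set" where
  "min_exps L = {t. monom t \<in> L \<and> (\<forall>a u. t = a + u \<longrightarrow> monom a \<in> L \<longrightarrow> u = 0)}"

lemma min_expsD:
  assumes "t \<in> min_exps L"
  shows "monom t \<in> L" "t = a + u \<Longrightarrow> monom a \<in> L \<Longrightarrow> u = 0"
  using assms unfolding min_exps_def by simp_all

text \<open>Passing to a proper divisor lowers the total degree, so descent within L stops at a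
  minimal exponent.\<close>

lemma min_exps_below:
  fixes L :: "('n::finite, 'k::field) mpoly set"
  assumes "monom t \<in> L"
  shows "\<exists>a\<in>min_exps L. \<exists>u. t = a + u"
  using assms
proof (induction "total_degree t" arbitrary: t rule: less_induct)
  case less
  show ?case
  proof (cases "t \<in> min_exps L")
    case True then show ?thesis by (metis add.right_neutral)
  next
    case False
    then obtain a u where au: "t = a + u" "monom a \<in> L" "u \<noteq> 0" using less.prems unfolding min_exps_def by blast
    then have "total_degree a < total_degree t" using total_degree_eq_0[of u] by (simp add: total_degree_add)
    then obtain a' u' where "a' \<in> min_exps L" "a = a' + u'" using less.hyps au(2) by blast
    then show ?thesis using au(1) by (metis add.assoc)
  qed
qed

lemma ideal_span_min_exps:
  fixes L :: "('n::finite, 'k::field) mpoly set"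
  assumes "monomial_ideal L"
  shows "ideal_span (monom ` min_exps L) = L"
proof (intro set_eqI iffI)
  fix f :: "('n, 'k) mpoly" assume f: "f \<in> ideal_span (monom ` min_exps L)"
  have "monom t \<in> L" if t: "t \<in> Poly_Mapping.keys f" for t
  proof -
    obtain a u where "a \<in> min_exps L" "t = a + u" by (rule in_ideal_span_monomE[OF f t])
    then show ?thesis using monomial_ideal_add[OF assms, of a u] by (simp add: min_exps_def add.commute)
  qed
  then show "f \<in> L" by (subst monomial_ideal_keys[OF assms]) simp
next
  fix f assume "f \<in> L"
  then have "monom t \<in> L" if "t \<in> Poly_Mapping.keys f" for t using monomial_ideal_keys[OF assms, of f] that by blast
  then show "f \<in> ideal_span (monom ` min_exps L)"
    unfolding in_ideal_span_monom_iff by (intro ballI min_exps_below)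
qed

text \<open>A minimal monomial is a multiple of a generator only by being that generator, so every
  monomial generating set contains all of them, and they already generate. Existence and uniqueness
  together justify the definite description in \<open>mingens\<close>.\<close>

lemma minimal_monomial_generators_iff:
  fixes L :: "('n::finite, 'k::field) mpoly set"
  assumes L: "monomial_ideal L"
  shows "minimal_monomial_generators G L \<longleftrightarrow> G = monom ` min_exps L"
proof
  assume G: "minimal_monomial_generators G L"
  then obtain A where A: "G = monom ` A" unfolding minimal_monomial_generators_def subset_image_iff by blast
  have "min_exps L \<subseteq> A"
  proof
    fix t assume t: "t \<in> min_exps L"
    have "(monom t :: ('n, 'k) mpoly) \<in> ideal_span (monom ` A)"
      using G A min_expsD(1)[OF t] unfolding minimal_monomial_generators_def by simp
    then obtain a u where a: "a \<in> A" "t = a + u" by (rule monom_in_ideal_spanE)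
    moreover have "monom a \<in> L"
      using G a(1) ideal_span_base[of "monom a" G] unfolding minimal_monomial_generators_def A by auto
    ultimately show "t \<in> A" using min_expsD(2)[OF t, of a u] by simp
  qed
  then have "monom ` min_exps L \<subseteq> G" using A by blast
  then show "G = monom ` min_exps L"
    using G ideal_span_min_exps[OF L] unfolding minimal_monomial_generators_def by blast
next
  assume G: "G = monom ` min_exps L"
  have "ideal_span H \<noteq> L" if H: "H \<subset> G" for H
  proof
    assume HL: "ideal_span H = L"
    obtain B where B: "H = monom ` B" "B \<subseteq> min_exps L" using H G by (meson psubset_imp_subset subset_imageE)
    obtain t where t: "t \<in> min_exps L" "t \<notin> B" using H G B by blast
    then have "(monom t :: ('n, 'k) mpoly) \<in> ideal_span (monom ` B)" using HL B by (auto simp: min_exps_def)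
    then obtain a u where "a \<in> B" "t = a + u" by (rule monom_in_ideal_spanE)
    moreover then have "u = 0" using min_expsD(2)[OF t(1), of a u] min_expsD(1)[of a L] B(2) by blast
    ultimately show False using t by simp
  qed
  then show "minimal_monomial_generators G L"
    unfolding minimal_monomial_generators_def using ideal_span_min_exps[OF L] G by blast
qed

lemma mingens_eq: "monomial_ideal L \<Longrightarrow> mingens L = monom ` min_exps L"
  for L :: "('n::finite, 'k::field) mpoly set"
  unfolding mingens_def by (simp add: minimal_monomial_generators_iff)

text \<open>No minimal exponent properly divides another, so any set of them is its own set of
  minimal generators. The two halves of an x_p-partition have this form.\<close>

lemma min_exps_subset:
  fixes L :: "('n::finite, 'k::field) mpoly set"
  assumes A: "A \<subseteq> min_exps L"
  shows "min_exps (ideal_span (monom ` A) :: ('n, 'k) mpoly set) = A"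
proof (intro set_eqI iffI)
  fix t assume t: "t \<in> min_exps (ideal_span (monom ` A) :: ('n, 'k) mpoly set)"
  then have "(monom t :: ('n, 'k) mpoly) \<in> ideal_span (monom ` A)" unfolding min_exps_def by blast
  then obtain a u where a: "a \<in> A" "t = a + u" by (rule monom_in_ideal_spanE)
  moreover have "(monom a :: ('n, 'k) mpoly) \<in> ideal_span (monom ` A)" using a by (simp add: ideal_span_base)
  moreover have "u = 0" by (rule min_expsD(2)[OF t]) (use a in \<open>auto intro: ideal_span_base\<close>)
  ultimately show "t \<in> A" by simp
next
  fix t assume t: "t \<in> A"
  have "u = 0" if au: "t = a + u" "(monom a :: ('n, 'k) mpoly) \<in> ideal_span (monom ` A)" for a u
  proof -
    obtain b w where b: "b \<in> A" "a = b + w" by (rule monom_in_ideal_spanE[OF au(2)])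
    have tL: "t \<in> min_exps L" and "monom b \<in> L" using t b(1) A min_expsD(1)[of b L] by blast+
    then have "w + u = 0" using min_expsD(2)[OF tL, of b "w + u"] au(1) b(2) by (simp add: add.assoc)
    then have "total_degree w + total_degree u = 0" by (simp add: total_degree_eq_0 flip: total_degree_add)
    then show ?thesis by (simp add: total_degree_eq_0)
  qed
  then show "t \<in> min_exps (ideal_span (monom ` A) :: ('n, 'k) mpoly set)"
    using t unfolding min_exps_def by (simp add: ideal_span_base)
qed

lemma var_dvd_monom_iff: "var p dvd (monom t :: ('n, 'k::field) mpoly) \<longleftrightarrow> Poly_Mapping.lookup t p > 0"
proof
  assume "var p dvd (monom t :: ('n, 'k) mpoly)"
  then obtain h :: "('n, 'k) mpoly" where h: "monom t = var p * h" by (elim dvdE)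
  have "t \<in> Poly_Mapping.keys (var p * h)" by (simp flip: h)
  then obtain s u where "s \<in> Poly_Mapping.keys (var p :: ('n, 'k) mpoly)" "t = s + u" by (rule keys_mult_exponent)
  then show "Poly_Mapping.lookup t p > 0" by (simp add: var_def lookup_add)
next
  assume p: "Poly_Mapping.lookup t p > 0"
  have "t = Poly_Mapping.single p 1 + (t - Poly_Mapping.single p 1)"
    by (rule poly_mapping_eqI) (use p in \<open>auto simp: lookup_add lookup_minus lookup_single when_def\<close>)
  then have "(monom t :: ('n, 'k) mpoly) = var p * monom (t - Poly_Mapping.single p 1)"
    unfolding var_def by (simp only: monom_times)
  then show "var p dvd (monom t :: ('n, 'k) mpoly)" by (rule dvdI)
qed

text \<open>\<open>B0\<close> bounds all of \<open>A\<close> from below in the coordinates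
  \<open>I\<close>. As \<open>N\<close> is an upper bound for coordinate i on \<open>B0\<close>, it
  does so in coordinate i as well for elements whose value there is at least \<open>N\<close>. The
  others lie in finitely many slices of constant i-th coordinate, each covered by the induction
  hypothesis.\<close>

lemma dickson_functions:
  fixes f :: "'x \<Rightarrow> 'i \<Rightarrow> nat"
  assumes "finite I"
  shows "\<exists>B\<subseteq>A. finite B \<and> (\<forall>t\<in>A. \<exists>b\<in>B. \<forall>i\<in>I. f b i \<le> f t i)"
  using assms
proof (induction I arbitrary: A)
  case empty
  show ?case
  proof (cases "A = {}")
    case False
    then obtain a where "a \<in> A" by blast
    then show ?thesis by (intro exI[of _ "{a}"]) simp
  qed simp
next
  case (insert i I)
  obtain B0 where B0: "B0 \<subseteq> A" "finite B0" "\<forall>t\<in>A. \<exists>b\<in>B0. \<forall>i\<in>I. f b i \<le> f t i"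
    using insert.IH[of A] by (elim exE conjE)
  \<comment> \<open>\<open>insert 0\<close> keeps \<open>Max\<close> meaningful when
    \<open>B0\<close> is empty.\<close>
  define N where "N = Max (insert 0 ((\<lambda>b. f b i) ` B0))"
  have N: "f b i \<le> N" if "b \<in> B0" for b unfolding N_def using B0(2) that by (intro Max_ge) auto
  have "\<forall>n. \<exists>B\<subseteq>{t \<in> A. f t i = n}. finite B \<and> (\<forall>t\<in>{t \<in> A. f t i = n}. \<exists>b\<in>B. \<forall>i\<in>I. f b i \<le> f t i)"
    by (intro allI insert.IH)
  then obtain C where C': "\<forall>n. C n \<subseteq> {t \<in> A. f t i = n} \<and> finite (C n) \<and>
      (\<forall>t\<in>{t \<in> A. f t i = n}. \<exists>b\<in>C n. \<forall>i\<in>I. f b i \<le> f t i)"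
    by (elim choice[THEN exE])
  then have C: "\<And>n. C n \<subseteq> {t \<in> A. f t i = n}" "\<And>n. finite (C n)"
    "\<And>n. \<forall>t\<in>{t \<in> A. f t i = n}. \<exists>b\<in>C n. \<forall>i\<in>I. f b i \<le> f t i" by simp_all
  let ?B = "B0 \<union> (\<Union>n<N. C n)"
  have "\<exists>b\<in>?B. \<forall>j\<in>insert i I. f b j \<le> f t j" if t: "t \<in> A" for t
  proof (cases "f t i < N")
    case True
    obtain b where "b \<in> C (f t i)" "\<forall>i\<in>I. f b i \<le> f t i" using C(3)[of "f t i"] t by blast
    moreover then have "f b i = f t i" using C(1) by blast
    moreover have "b \<in> ?B" using True \<open>b \<in> C (f t i)\<close> by blast
    ultimately show ?thesis by (intro bexI[of _ b]) simp_all
  next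
    case False
    obtain b where "b \<in> B0" "\<forall>i\<in>I. f b i \<le> f t i" using B0(3) t by blast
    moreover then have "f b i \<le> f t i" using N[of b] False by linarith
    ultimately show ?thesis by blast
  qed
  moreover have "?B \<subseteq> A" using B0(1) C(1) by blast
  moreover have "finite ?B" using B0(2) C(2) by blast
  ultimately show ?case by blast
qed

lemma dickson:
  fixes A :: "('n::finite \<Rightarrow>\<^sub>0 nat) set"
  obtains B where "B \<subseteq> A" "finite B" "\<And>t. t \<in> A \<Longrightarrow> \<exists>b\<in>B. \<exists>u. t = b + u"
proof -
  obtain B where B: "B \<subseteq> A" "finite B"
    "\<forall>t\<in>A. \<exists>b\<in>B. \<forall>i\<in>UNIV. Poly_Mapping.lookup b i \<le> Poly_Mapping.lookup t i"
    using dickson_functions[OF finite_UNIV, of A Poly_Mapping.lookup] by (elim exE conjE)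
  have "\<exists>b\<in>B. \<exists>u. t = b + u" if t: "t \<in> A" for t
  proof -
    obtain b where "b \<in> B" and b: "\<And>i. Poly_Mapping.lookup b i \<le> Poly_Mapping.lookup t i" using B(3) t by blast
    have "t = b + (t - b)" by (rule poly_mapping_eqI) (simp add: lookup_add lookup_minus b)
    then show ?thesis using \<open>b \<in> B\<close> by blast
  qed
  then show ?thesis using that B by blast
qed

section \<open>Existence of multigraded resolutions\<close>

text \<open>
  To treat the augmentation like the other maps of a resolution, \<open>R\<close> is prepended to it as a free module
  of rank one and an ideal \<open>L\<close> is viewed as a submodule of \<open>R\<^sup>1\<close>.
\<close>

definition idl :: "('n, 'k::field) mpoly set \<Rightarrow> ('n, 'k) pvec set" where
  "idl L = {v \<in> free_module 1. Poly_Mapping.lookup v 0 \<in> L}"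

definition gc_rank :: "('g, 'n, 'k::field) free_seq \<Rightarrow> nat \<Rightarrow> nat" where
  "gc_rank F q = (case q of 0 \<Rightarrow> 1 | Suc i \<Rightarrow> frank F i)"

definition gc_shift :: "('g::zero, 'n, 'k::field) free_seq \<Rightarrow> nat \<Rightarrow> nat \<Rightarrow> 'g" where
  "gc_shift F q = (case q of 0 \<Rightarrow> \<lambda>_. 0 | Suc i \<Rightarrow> shift F i)"

definition gc_mat :: "('g, 'n, 'k::field) free_seq \<Rightarrow> nat \<Rightarrow> nat \<Rightarrow> ('n, 'k) pvec" where
  "gc_mat F q = (case q of 0 \<Rightarrow> \<lambda>b. Poly_Mapping.single 0 (aug F b) | Suc i \<Rightarrow> mat F i)"

lemma gc_rank_simps [simp]: "gc_rank F 0 = 1" "gc_rank F (Suc i) = frank F i"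
  by (simp_all add: gc_rank_def)

lemma gc_shift_simps [simp]: "gc_shift F 0 = (\<lambda>_. 0)" "gc_shift F (Suc i) = shift F i"
  by (simp_all add: gc_shift_def)

lemma gc_mat_simps [simp]:
  "gc_mat F 0 = (\<lambda>b. Poly_Mapping.single 0 (aug F b))" "gc_mat F (Suc i) = mat F i"
  by (simp_all add: gc_mat_def)

lemma lin_single_0: "lin (\<lambda>b. Poly_Mapping.single 0 (f b)) v
    = Poly_Mapping.single 0 (\<Sum>b\<in>Poly_Mapping.keys v. Poly_Mapping.lookup v b * f b)"
proof (rule poly_mapping_eqI)
  fix c
  show "Poly_Mapping.lookup (lin (\<lambda>b. Poly_Mapping.single 0 (f b)) v) c
    = Poly_Mapping.lookup (Poly_Mapping.single 0 (\<Sum>b\<in>Poly_Mapping.keys v. Poly_Mapping.lookup v b * f b)) c"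
    by (cases "c = 0") (simp_all add: lin_def lookup_sum lookup_single)
qed

lemma lin_aug: "lin (gc_mat F 0) v = Poly_Mapping.single 0 (augment F v)"
  by (simp add: augment_def lin_single_0)

lemma lin_mat: "lin (mat F i) = bdry F i"
  by (rule ext) (simp add: lin_def bdry_def)

lemma fbd_mat: "fbd (mat F i) = fiber_bdry F i"
  by (rule ext) (simp add: fbd_def fiber_bdry_def const0_def)

lemma single_in_free_module: "Poly_Mapping.single b a \<in> free_module r \<longleftrightarrow> b < r \<or> a = 0"
  by (auto simp: free_module_iff lookup_single when_def not_le)

lemma idl_eq: "v \<in> idl L \<longleftrightarrow> (\<exists>f\<in>L. v = Poly_Mapping.single 0 f)"
proof
  assume v: "v \<in> idl L"
  have "v = Poly_Mapping.single 0 (Poly_Mapping.lookup v 0)"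
  proof (rule poly_mapping_eqI)
    fix b show "Poly_Mapping.lookup v b = Poly_Mapping.lookup (Poly_Mapping.single 0 (Poly_Mapping.lookup v 0)) b"
      using v by (cases "b = 0") (auto simp: idl_def free_module_iff lookup_single)
  qed
  then show "\<exists>f\<in>L. v = Poly_Mapping.single 0 f" using v unfolding idl_def by blast
qed (auto simp: idl_def single_in_free_module)

lemma (in grading) resolution_graded_complex:
  assumes F: "graded_free_resolution gr F L"
  shows "graded_complex gr (gc_rank F) (gc_shift F) (gc_mat F)"
proof unfold_locales
  fix q
  show "graded_map (gc_rank F (Suc q)) (gc_shift F (Suc q)) (gc_rank F q) (gc_shift F q) (gc_mat F q)"
  proof (cases q)
    case 0
    have "gr t = shift F 0 b" if "b < frank F 0" "cf (Poly_Mapping.single 0 (aug F b)) c t \<noteq> 0" for b c t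
      using F that unfolding graded_free_resolution_def homogeneous_def
      by (cases "c = 0") (auto simp: cf_def lookup_single in_keys_iff)
    then show ?thesis using 0 by (simp add: graded_map_def single_in_free_module)
  next
    case (Suc i)
    have "\<forall>b<frank F (Suc i). mat F i b \<in> free_module (frank F i) \<and>
        (\<forall>c. \<forall>t\<in>Poly_Mapping.keys (Poly_Mapping.lookup (mat F i b) c). gr t + shift F i c = shift F (Suc i) b)"
      using F unfolding graded_free_resolution_def by simp
    then show ?thesis using Suc by (simp add: graded_map_def cf_def in_keys_iff)
  qed
  show "{v \<in> free_module (gc_rank F (Suc q)). lin (gc_mat F q) v = 0}
      = lin (gc_mat F (Suc q)) ` free_module (gc_rank F (Suc (Suc q)))"
  proof (cases q)
    case 0
    have "lin (gc_mat F 0) v = 0 \<longleftrightarrow> augment F v = 0" for v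
      unfolding lin_aug by (metis lookup_single_eq lookup_zero single_zero)
    then show ?thesis using F 0 unfolding graded_free_resolution_def by (simp add: lin_mat)
  next
    case (Suc i)
    then show ?thesis using F unfolding graded_free_resolution_def by (simp add: lin_mat)
  qed
qed

text \<open>The left side does not mention \<open>F\<close>. This is the independence of Tor of the
  resolution, and it makes the arbitrary choice in \<open>betti\<close> harmless.\<close>

lemma (in grading) koszul_dim_eq_tor_dim:
  assumes F: "graded_free_resolution gr F L"
  shows "koszul_dim (\<lambda>_. 0) (idl L) i g = tor_dim F i g"
proof -
  interpret c: graded_complex gr "gc_rank F" "gc_shift F" "gc_mat F"
    by (rule resolution_graded_complex[OF F])
  have L: "augment F ` free_module (frank F 0) = L" using F unfolding graded_free_resolution_def by simp
  have im: "lin (gc_mat F 0) ` free_module (frank F 0) = idl L"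
    unfolding lin_aug by (auto simp: idl_eq simp flip: L)
  have "fiber F i' g = c.fib (Suc i') g" for i' by (simp add: fiber_def c.fib_def)
  moreover have "fiber_cycles F i g = {v \<in> c.fib (Suc i) g. i = 0 \<or> fbd (gc_mat F i) v = 0}"
    by (cases i) (auto simp: fiber_cycles_def fiber_def c.fib_def fbd_mat)
  ultimately show ?thesis
    using c.koszul_dim_eq_fiber_dim[of i g] im
    by (simp add: tor_dim_def fiber_boundaries_def fbd_mat)
qed

interpretation mg: grading "\<lambda>t :: 'n::finite \<Rightarrow>\<^sub>0 nat. t"
  by unfold_locales simp_all

lemma finite_total_degree: "finite {t :: 'n::finite \<Rightarrow>\<^sub>0 nat. total_degree t = g}"
proof (rule finite_imageD)
  have "Poly_Mapping.lookup ` {t :: 'n \<Rightarrow>\<^sub>0 nat. total_degree t = g}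
      \<subseteq> {f. \<forall>x. (x \<in> UNIV \<longrightarrow> f x \<in> {..g}) \<and> (x \<notin> UNIV \<longrightarrow> f x = 0)}"
    by (auto simp: total_degree_def intro: member_le_sum)
  then show "finite (Poly_Mapping.lookup ` {t :: 'n \<Rightarrow>\<^sub>0 nat. total_degree t = g})"
    by (rule finite_subset) (rule finite_set_of_finite_funs; simp)
  show "inj_on Poly_Mapping.lookup {t :: 'n \<Rightarrow>\<^sub>0 nat. total_degree t = g}"
    by (simp add: inj_on_def lookup_inject)
qed

interpretation tg: grading "total_degree :: ('n::finite \<Rightarrow>\<^sub>0 nat) \<Rightarrow> nat"
  by unfold_locales (simp_all add: total_degree_add total_degree_eq_0 finite_total_degree)

section \<open>Finite generation of multigraded submodules\<close>

definition multihom :: "(nat \<Rightarrow> 'n \<Rightarrow>\<^sub>0 nat) \<Rightarrow> ('n, 'k::field) pvec \<Rightarrow> ('n \<Rightarrow>\<^sub>0 nat) \<Rightarrow> bool" where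
  "multihom sh v j \<longleftrightarrow> (\<forall>b t. cf v b t \<noteq> 0 \<longrightarrow> t + sh b = j)"

definition multigraded_submodule :: "(nat \<Rightarrow> 'n \<Rightarrow>\<^sub>0 nat) \<Rightarrow> ('n, 'k::field) pvec set \<Rightarrow> bool" where
  "multigraded_submodule sh Z \<longleftrightarrow> free_mod.subspace Z \<and> (\<forall>v\<in>Z. \<forall>j. prj (\<lambda>b t. t + sh b = j) v \<in> Z)"

text \<open>An element is the finite sum of its homogeneous components, which lie in
  \<open>Z\<close> again.\<close>

lemma multigraded_subset_span:
  assumes Z: "multigraded_submodule sh Z"
    and S: "\<And>v j. v \<in> Z \<Longrightarrow> multihom sh v j \<Longrightarrow> v \<in> free_mod.span S"
  shows "Z \<subseteq> free_mod.span S"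
proof
  fix v assume v: "v \<in> Z"
  define J where "J = (\<lambda>(b, t). t + sh b) ` (SIGMA b:Poly_Mapping.keys v. Poly_Mapping.keys (Poly_Mapping.lookup v b))"
  have fin: "finite J" unfolding J_def by (intro finite_imageI finite_SigmaI) simp_all
  have "v = (\<Sum>j\<in>J. prj (\<lambda>b t. t + sh b = j) v)"
  proof (rule pvec_eqI)
    fix b t
    have "(\<Sum>j\<in>J. cf (prj (\<lambda>b t. t + sh b = j) v) b t) = (\<Sum>j\<in>J. if t + sh b = j then cf v b t else 0)"
      by (rule sum.cong) simp_all
    also have "\<dots> = (if t + sh b \<in> J then cf v b t else 0)" using fin by (rule sum.delta')
    also have "\<dots> = cf v b t"
    proof (cases "cf v b t = 0")
      case False
      then have "b \<in> Poly_Mapping.keys v" "t \<in> Poly_Mapping.keys (Poly_Mapping.lookup v b)"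
        by (auto simp: cf_def in_keys_iff)
      then have "t + sh b \<in> J" unfolding J_def by (intro image_eqI[of _ _ "(b, t)"]) simp_all
      then show ?thesis by simp
    qed simp
    finally show "cf v b t = cf (\<Sum>j\<in>J. prj (\<lambda>b t. t + sh b = j) v) b t" by (simp add: cf_sum)
  qed
  also have "\<dots> \<in> free_mod.span S"
  proof (rule free_mod.span_sum)
    fix j
    have "multihom sh (prj (\<lambda>b t. t + sh b = j) v) j" by (simp add: multihom_def split: if_splits)
    then show "prj (\<lambda>b t. t + sh b = j) v \<in> free_mod.span S"
      using Z v S unfolding multigraded_submodule_def by blast
  qed
  finally show "v \<in> free_mod.span S" .
qed

text \<open>Induction on the rank. In the multigrading the last coordinate of a homogeneous element
  is a scalar times one monomial, so Dickson's lemma replaces the Hilbert basis theorem: finitely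
  many elements have last coordinates dividing all others, and the elements with last coordinate 0
  lie in a free module of smaller rank.\<close>

lemma multigraded_finitely_generated:
  fixes Z :: "('n::finite, 'k::field) pvec set"
  assumes "multigraded_submodule sh Z" "Z \<subseteq> free_module r"
  shows "\<exists>S\<subseteq>Z. finite S \<and> (\<forall>v\<in>S. \<exists>j. multihom sh v j) \<and> Z \<subseteq> free_mod.span S"
  using assms
proof (induction r arbitrary: Z)
  case 0
  then have "Z \<subseteq> {0}" by (auto simp: free_module_def)
  then show ?case by (intro exI[of _ "{}"]) (auto simp: free_mod.span_zero)
next
  case (Suc r)
  have sub: "free_mod.subspace Z" using Suc.prems unfolding multigraded_submodule_def by blast
  define Z0 where "Z0 = Z \<inter> free_module r"
  have "multigraded_submodule sh Z0"
    using Suc.prems(1) free_mod.subspace_inter[OF sub subspace_free_module[of r]] prj_free_module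
    unfolding multigraded_submodule_def Z0_def by blast
  then obtain S0 where S0: "S0 \<subseteq> Z0" "finite S0" "\<forall>v\<in>S0. \<exists>j. multihom sh v j" "Z0 \<subseteq> free_mod.span S0"
    using Suc.IH[of Z0] unfolding Z0_def by blast
  define A where "A = {t. \<exists>v\<in>Z. (\<exists>j. multihom sh v j) \<and> Poly_Mapping.lookup v r = monom t}"
  obtain B where B: "B \<subseteq> A" "finite B" "\<And>t. t \<in> A \<Longrightarrow> \<exists>b\<in>B. \<exists>u. t = b + u"
    using dickson[of A] by metis
  have "\<forall>b\<in>B. \<exists>v. v \<in> Z \<and> (\<exists>j. multihom sh v j) \<and> Poly_Mapping.lookup v r = monom b"
    using B(1) unfolding A_def by blast
  then obtain w where w: "\<And>b. b \<in> B \<Longrightarrow> w b \<in> Z" "\<And>b. b \<in> B \<Longrightarrow> \<exists>j. multihom sh (w b) j"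
    "\<And>b. b \<in> B \<Longrightarrow> Poly_Mapping.lookup (w b) r = monom b" by metis
  let ?S = "S0 \<union> w ` B"
  have Z0S: "v \<in> free_mod.span ?S" if "v \<in> Z" "Poly_Mapping.lookup v r = 0" for v
  proof -
    have "Poly_Mapping.lookup v b = 0" if b: "r \<le> b" for b
    proof (cases "b = r")
      case False
      then have "Suc r \<le> b" using b by simp
      moreover have "v \<in> free_module (Suc r)" using \<open>v \<in> Z\<close> Suc.prems(2) by blast
      ultimately show ?thesis by (simp add: free_module_iff)
    qed (use \<open>Poly_Mapping.lookup v r = 0\<close> in simp)
    then have "v \<in> free_module r" by (simp add: free_module_iff)
    then have "v \<in> free_mod.span S0" using that S0(4) unfolding Z0_def by blast
    then show ?thesis using free_mod.span_mono[of S0 ?S] by blast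
  qed
  have hom: "v \<in> free_mod.span ?S" if v: "v \<in> Z" "multihom sh v j" for v j
  proof (cases "Poly_Mapping.lookup v r = 0")
    case True then show ?thesis using Z0S v by blast
  next
    case False
    then obtain t where t: "t \<in> Poly_Mapping.keys (Poly_Mapping.lookup v r)" by (metis keys_eq_empty ex_in_conv)
    define a where "a = Poly_Mapping.lookup (Poly_Mapping.lookup v r) t"
    have a: "a \<noteq> 0" using t by (simp add: a_def in_keys_iff)
    have tj: "t + sh r = j" using v(2) a unfolding multihom_def a_def cf_def by blast
    \<comment> \<open>The equation t + sh r = j determines the exponent, so there is only one
      term.\<close>
    have vr: "Poly_Mapping.lookup v r = Poly_Mapping.single t a"
    proof (rule poly_mapping_eqI)
      fix t'
      show "Poly_Mapping.lookup (Poly_Mapping.lookup v r) t' = Poly_Mapping.lookup (Poly_Mapping.single t a) t'"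
      proof (cases "t' = t")
        case False
        then have "t' + sh r \<noteq> j" using tj by auto
        then have "cf v r t' = 0" using v(2) unfolding multihom_def by blast
        then show ?thesis using False by (simp add: cf_def lookup_single)
      qed (simp add: a_def)
    qed
    have "scale (Poly_Mapping.single 0 (1 / a)) v \<in> Z" using v(1) sub by (rule free_mod.subspace_scale[rotated])
    moreover have "multihom sh (scale (Poly_Mapping.single 0 (1 / a)) v) j" using v(2) by (simp add: multihom_def)
    moreover have "Poly_Mapping.lookup (scale (Poly_Mapping.single 0 (1 / a)) v) r = monom t"
      using a by (simp add: vr mult_single monom_def)
    ultimately have "t \<in> A" unfolding A_def by blast
    then obtain b u where b: "b \<in> B" "t = u + b" using B(3) by (metis add.commute)
    \<comment> \<open>Multiplication by a x^u turns the last coordinate of \<open>w b\<close> into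
      that of \<open>v\<close>, and the difference cancels it.\<close>
    define v' where "v' = v - scale (Poly_Mapping.single u a) (w b)"
    have "v' \<in> Z" unfolding v'_def using sub v(1) w(1)[OF b(1)]
      by (intro free_mod.subspace_diff free_mod.subspace_scale)
    moreover have "Poly_Mapping.lookup v' r = 0"
      by (simp add: v'_def lookup_minus vr w(3)[OF b(1)] monom_def mult_single b(2))
    ultimately have "v' \<in> free_mod.span ?S" by (rule Z0S)
    moreover have "w b \<in> free_mod.span ?S" using b(1) by (intro free_mod.span_base) blast
    ultimately have "v' + scale (Poly_Mapping.single u a) (w b) \<in> free_mod.span ?S"
      by (intro free_mod.span_add free_mod.span_scale)
    then show ?thesis by (simp add: v'_def)
  qed
  have "Z \<subseteq> free_mod.span ?S" by (rule multigraded_subset_span[OF Suc.prems(1) hom])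
  moreover have "?S \<subseteq> Z" using S0(1) w(1) unfolding Z0_def by blast
  moreover have "finite ?S" using S0(2) B(2) by simp
  moreover have "\<forall>v\<in>?S. \<exists>j. multihom sh v j" using S0(3) w(2) by blast
  ultimately show ?case by blast
qed

lemma multigraded_presentation:
  fixes Z :: "('n::finite, 'k::field) pvec set"
  assumes Z: "multigraded_submodule sh Z" "Z \<subseteq> free_module r"
  obtains r' sh' m where "mg.graded_map r' sh' r sh m" "lin m ` free_module r' = Z"
proof -
  obtain S where S: "S \<subseteq> Z" "finite S" "\<forall>v\<in>S. \<exists>j. multihom sh v j" "Z \<subseteq> free_mod.span S"
    using multigraded_finitely_generated[OF Z] by blast
  obtain f where f: "bij_betw f {..<card S} S"
    using ex_bij_betw_nat_finite[OF S(2)] by (auto simp: atLeast0LessThan)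
  \<comment> \<open>A zero vector is homogeneous of every degree, so the degree is a choice.\<close>
  define sh' where "sh' b = (SOME j. multihom sh (f b) j)" for b
  have fS: "f b \<in> S" if "b < card S" for b using f that by (auto simp: bij_betw_def)
  have hom: "multihom sh (f b) (sh' b)" if "b < card S" for b
    unfolding sh'_def by (rule someI_ex) (use fS[OF that] S(3) in blast)
  have sub: "free_mod.subspace Z" using Z(1) unfolding multigraded_submodule_def by blast
  have "mg.graded_map (card S) sh' r sh f"
    unfolding mg.graded_map_def
  proof (intro allI impI conjI)
    fix b assume b: "b < card S"
    show "f b \<in> free_module r" using fS[OF b] S(1) Z(2) by blast
    show "t + sh c = sh' b" if "cf (f b) c t \<noteq> 0" for c t
      using hom[OF b] that unfolding multihom_def by blast
  qed
  moreover have "lin f ` free_module (card S) = Z"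
  proof
    show "lin f ` free_module (card S) \<subseteq> Z"
    proof (rule image_subsetI)
      fix v :: "('n, 'k) pvec" assume "v \<in> free_module (card S)"
      then have "b < card S" if "b \<in> Poly_Mapping.keys v" for b using that by (auto simp: free_module_def)
      then show "lin f v \<in> Z" unfolding lin_def
        using fS S(1) by (intro free_mod.subspace_sum[OF sub] free_mod.subspace_scale[OF sub]) blast
    qed
    have "S \<subseteq> lin f ` free_module (card S)"
    proof
      fix v assume "v \<in> S"
      then obtain b where b: "b < card S" "v = f b" using f by (auto simp: bij_betw_def)
      have "lin f (Poly_Mapping.single b 1) = v"
        unfolding lin_def b(2) by simp
      moreover have "Poly_Mapping.single b 1 \<in> free_module (card S)" using b(1) by (simp add: single_in_free_module)
      ultimately show "v \<in> lin f ` free_module (card S)" by blast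
    qed
    then have "free_mod.span S \<subseteq> lin f ` free_module (card S)"
      by (intro free_mod.span_minimal module_hom.subspace_image[OF module_hom_lin subspace_free_module])
    then show "Z \<subseteq> lin f ` free_module (card S)" using S(4) by blast
  qed
  ultimately show ?thesis by (rule that)
qed

lemma multigraded_kernel:
  fixes m :: "nat \<Rightarrow> ('n::finite, 'k::field) pvec"
  assumes m: "mg.graded_map r' sh' r sh m"
  shows "multigraded_submodule sh' {v \<in> free_module r'. lin m v = 0}"
  unfolding multigraded_submodule_def
proof (intro conjI ballI allI)
  show "free_mod.subspace {v \<in> free_module r'. lin m v = 0}"
    using subspace_free_module[of r', where 'n = 'n and 'k = 'k]
    by (auto simp: free_mod.subspace_def lin_add lin_scale)
  fix v and j assume v: "v \<in> {v \<in> free_module r'. lin m v = 0}"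
  have "lin m (prj (\<lambda>b t. t + sh' b = j) v) = prj (\<lambda>c t. t + sh c = j) (lin m v)"
    by (rule mg.lin_prj[OF m, where Q = "\<lambda>h. h = j"]) (use v in simp)
  also have "\<dots> = 0" using v by (intro pvec_eqI) simp
  finally show "prj (\<lambda>b t. t + sh' b = j) v \<in> {v \<in> free_module r'. lin m v = 0}"
    using v prj_free_module by blast
qed

lemma idl_subset: "idl L \<subseteq> free_module 1"
  by (auto simp: idl_def)

lemma subspace_idl:
  assumes L: "monomial_ideal (L :: ('n, 'k::field) mpoly set)"
  shows "free_mod.subspace (idl L)"
proof (rule free_mod.subspaceI)
  show "0 \<in> idl L" by (simp add: idl_def free_module_iff monomial_ideal_module(1)[OF L])
  show "x + y \<in> idl L" if "x \<in> idl L" "y \<in> idl L" for x y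
    using that by (simp add: idl_def free_module_iff lookup_add monomial_ideal_module(2)[OF L])
  show "scale c x \<in> idl L" if "x \<in> idl L" for c x
    using that by (simp add: idl_def free_module_iff monomial_ideal_module(3)[OF L])
qed

lemma idl_iff:
  assumes L: "monomial_ideal (L :: ('n, 'k::field) mpoly set)"
  shows "v \<in> idl L \<longleftrightarrow> v \<in> free_module 1 \<and> (\<forall>t. cf v 0 t \<noteq> 0 \<longrightarrow> monom t \<in> L)"
  using monomial_ideal_keys[OF L, of "Poly_Mapping.lookup v 0"] by (simp add: idl_def cf_def in_keys_iff Ball_def)

lemma prj_idl:
  assumes L: "monomial_ideal (L :: ('n, 'k::field) mpoly set)" and v: "v \<in> idl L"
  shows "prj P v \<in> idl L"
  using v prj_free_module[of v 1 P] unfolding idl_iff[OF L] by simp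

lemma multigraded_idl:
  assumes L: "monomial_ideal (L :: ('n::finite, 'k::field) mpoly set)"
  shows "multigraded_submodule (\<lambda>_. 0) (idl L)"
  unfolding multigraded_submodule_def using subspace_idl[OF L] prj_idl[OF L] by blast

text \<open>Each stage, a triple of rank, degrees and matrix, presents the kernel of the preceding
  one; dependent choice joins the stages.\<close>

lemma multigraded_resolution_exists:
  assumes L: "monomial_ideal (L :: ('n::finite, 'k::field) mpoly set)"
  shows "\<exists>F. graded_free_resolution (\<lambda>t. t) F L"
proof -
  obtain r0 sh0 and m0 :: "nat \<Rightarrow> ('n, 'k) pvec" where
    0: "mg.graded_map r0 sh0 1 (\<lambda>_. 0) m0" "lin m0 ` free_module r0 = idl L"
    by (rule multigraded_presentation[OF multigraded_idl[OF L] idl_subset])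
  define rk :: "nat \<times> (nat \<Rightarrow> 'n \<Rightarrow>\<^sub>0 nat) \<times> (nat \<Rightarrow> ('n, 'k) pvec) \<Rightarrow> nat" where "rk = fst"
  define st :: "nat \<times> (nat \<Rightarrow> 'n \<Rightarrow>\<^sub>0 nat) \<times> (nat \<Rightarrow> ('n, 'k) pvec) \<Rightarrow> nat \<Rightarrow> 'n \<Rightarrow>\<^sub>0 nat" where "st = fst \<circ> snd"
  define mt :: "nat \<times> (nat \<Rightarrow> 'n \<Rightarrow>\<^sub>0 nat) \<times> (nat \<Rightarrow> ('n, 'k) pvec) \<Rightarrow> nat \<Rightarrow> ('n, 'k) pvec" where "mt = snd \<circ> snd"
  \<comment> \<open>The target is existential because it is R^1 at stage 0 and the preceding stage
    afterwards. The second conjunct pins the start.\<close>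
  define P where "P n x \<longleftrightarrow> (\<exists>r sh. mg.graded_map (rk x) (st x) r sh (mt x)) \<and> (n = 0 \<longrightarrow> x = (r0, sh0, m0))" for n :: nat and x
  define Q where "Q x y \<longleftrightarrow> mg.graded_map (rk y) (st y) (rk x) (st x) (mt y) \<and>
      lin (mt y) ` free_module (rk y) = {v \<in> free_module (rk x). lin (mt x) v = 0}" for x y
  have "P 0 (r0, sh0, m0)" unfolding P_def
    by (rule conjI, rule exI[of _ 1], rule exI[of _ "\<lambda>_. 0"]) (simp_all add: rk_def st_def mt_def 0(1)[unfolded One_nat_def])
  moreover have "\<exists>y. P (Suc n) y \<and> Q x y" if x: "P n x" for n x
  proof -
    obtain r sh where g: "mg.graded_map (rk x) (st x) r sh (mt x)" using x unfolding P_def by blast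
    have subk: "{v \<in> free_module (rk x). lin (mt x) v = 0} \<subseteq> free_module (rk x)" by blast
    obtain r' sh' m where h: "mg.graded_map r' sh' (rk x) (st x) m"
      "lin m ` free_module r' = {v \<in> free_module (rk x). lin (mt x) v = 0}"
      by (rule multigraded_presentation[OF multigraded_kernel[OF g] subk])
    have "P (Suc n) (r', sh', m)" unfolding P_def
      by (rule conjI, rule exI[of _ "rk x"], rule exI[of _ "st x"]) (use h(1) in \<open>simp_all add: rk_def st_def mt_def\<close>)
    moreover have "Q x (r', sh', m)" unfolding Q_def using h by (simp add: rk_def st_def mt_def)
    ultimately show ?thesis by blast
  qed
  ultimately obtain f where f: "\<And>n. P n (f n)" "\<And>n. Q (f n) (f (Suc n))"
    using dependent_nat_choice[of P "\<lambda>_. Q"] by metis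
  have f0: "f 0 = (r0, sh0, m0)" using f(1)[of 0] unfolding P_def by blast
  \<comment> \<open>Stage i + 1 carries the map into F_i, hence the index of \<open>mat\<close>. The
    map of stage 0 goes to R^1; read in its only component, it is the augmentation.\<close>
  define F :: "('n \<Rightarrow>\<^sub>0 nat, 'n, 'k) free_seq" where
    "F = \<lparr>frank = \<lambda>i. rk (f i), shift = \<lambda>i. st (f i), mat = \<lambda>i. mt (f (Suc i)),
      aug = \<lambda>b. Poly_Mapping.lookup (m0 b) 0\<rparr>"
  have sel: "frank F = (\<lambda>i. rk (f i))" "shift F = (\<lambda>i. st (f i))" "mat F = (\<lambda>i. mt (f (Suc i)))"
    "aug F = (\<lambda>b. Poly_Mapping.lookup (m0 b) 0)" by (simp_all add: F_def)
  have r0: "rk (f 0) = r0" "st (f 0) = sh0" "mt (f 0) = m0" by (simp_all add: f0 rk_def st_def mt_def)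
  have m0: "m0 b = Poly_Mapping.single 0 (aug F b)" if "b < r0" for b
  proof (rule poly_mapping_eqI)
    fix c
    have "m0 b \<in> free_module 1" using 0(1) that unfolding mg.graded_map_def by blast
    then show "Poly_Mapping.lookup (m0 b) c = Poly_Mapping.lookup (Poly_Mapping.single 0 (aug F b)) c"
      by (cases "c = 0") (simp_all add: sel free_module_iff lookup_single)
  qed
  have aug: "lin m0 v = Poly_Mapping.single 0 (augment F v)" if v: "v \<in> free_module r0" for v
  proof -
    have "lin m0 v = lin (gc_mat F 0) v"
      unfolding lin_def using v m0 by (intro sum.cong) (auto simp: free_module_def)
    then show ?thesis by (simp only: lin_aug)
  qed
  have bd: "bdry F i = lin (mt (f (Suc i)))" for i
    by (simp add: sel flip: lin_mat)
  have gm: "mg.graded_map (rk (f (Suc i))) (st (f (Suc i))) (rk (f i)) (st (f i)) (mt (f (Suc i)))"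
    and ex: "lin (mt (f (Suc i))) ` free_module (rk (f (Suc i))) = {v \<in> free_module (rk (f i)). lin (mt (f i)) v = 0}" for i
    using f(2)[of i] unfolding Q_def by blast+
  have "graded_free_resolution (\<lambda>t. t) F L"
    unfolding graded_free_resolution_def
  proof (intro conjI allI impI)
    fix b assume b: "b < frank F 0"
    show "homogeneous (\<lambda>t. t) (shift F 0 b) (aug F b)"
      unfolding homogeneous_def
    proof
      fix t assume "t \<in> Poly_Mapping.keys (aug F b)"
      then have "cf (m0 b) 0 t \<noteq> 0" using b m0 by (simp add: sel r0 cf_def in_keys_iff)
      then have "t + 0 = sh0 b" using 0(1) b unfolding mg.graded_map_def by (simp add: sel r0)
      then show "t = shift F 0 b" by (simp add: sel r0)
    qed
  next
    fix i b assume b: "b < frank F (Suc i)"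
    show "mat F i b \<in> free_module (frank F i)"
      using gm[of i] b unfolding mg.graded_map_def by (simp add: sel)
    fix c
    show "\<forall>t\<in>Poly_Mapping.keys (Poly_Mapping.lookup (mat F i b) c). t + shift F i c = shift F (Suc i) b"
      using gm[of i] b unfolding mg.graded_map_def by (simp add: sel cf_def in_keys_iff)
  next
    have "Poly_Mapping.single 0 ` augment F ` free_module r0 = idl L"
      using 0(2) aug unfolding image_image by (metis (no_types, lifting) image_cong)
    also have "idl L = Poly_Mapping.single 0 ` L" by (auto simp: idl_eq)
    finally show "augment F ` free_module (frank F 0) = L"
      by (simp add: sel r0 inj_image_eq_iff)
    have "{v \<in> free_module r0. augment F v = 0} = {v \<in> free_module r0. lin m0 v = 0}"
    proof (intro Collect_cong conj_cong refl)
      fix v :: "('n, 'k) pvec" assume "v \<in> free_module r0"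
      then show "augment F v = 0 \<longleftrightarrow> lin m0 v = 0" using aug[of v] by (metis lookup_single_eq lookup_zero single_zero)
    qed
    then show "{v \<in> free_module (frank F 0). augment F v = 0} = bdry F 0 ` free_module (frank F 1)"
      using ex[of 0] by (simp add: sel bd r0)
    show "{v \<in> free_module (frank F (Suc i)). bdry F i v = 0} = bdry F (Suc i) ` free_module (frank F (Suc (Suc i)))" for i
      using ex[of "Suc i"] by (simp add: sel bd)
  qed
  then show ?thesis by blast
qed

lemma betti_eq_koszul_dim:
  assumes "monomial_ideal (L :: ('n::finite, 'k::field) mpoly set)"
  shows "betti L i j = mg.koszul_dim (\<lambda>_. 0) (idl L) i j"
  unfolding betti_def
  by (rule mg.koszul_dim_eq_tor_dim[symmetric, OF someI_ex[OF multigraded_resolution_exists[OF assms]]])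

section \<open>Koszul homology of monomial ideals\<close>

abbreviation mchains :: "('n::finite, 'k::field) mpoly set \<Rightarrow> nat \<Rightarrow> ('n \<Rightarrow>\<^sub>0 nat) \<Rightarrow> ('n, 'k) kchain set" where
  "mchains L \<equiv> kchains (\<lambda>t. t) (\<lambda>_. 0) (idl L)"

abbreviation mcycles :: "('n::finite, 'k::field) mpoly set \<Rightarrow> nat \<Rightarrow> ('n \<Rightarrow>\<^sub>0 nat) \<Rightarrow> ('n, 'k) kchain set" where
  "mcycles L \<equiv> kcycles (\<lambda>t. t) (\<lambda>_. 0) (idl L)"

abbreviation mbounds :: "('n::finite, 'k::field) mpoly set \<Rightarrow> nat \<Rightarrow> ('n \<Rightarrow>\<^sub>0 nat) \<Rightarrow> ('n, 'k) kchain set" where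
  "mbounds L \<equiv> kbounds (\<lambda>t. t) (\<lambda>_. 0) (idl L)"

lemma fin_dim_mchains: "kch.fin_dim (mchains L i j)"
  by (rule mg.fin_dim_kchains[OF idl_subset])

lemma fin_dim_mcycles: "kch.fin_dim (mcycles L i j)"
  by (rule kch.fin_dim_subset[OF fin_dim_mchains cycles_subset_chains])

lemma (in grading) kcycles_eq_kbounds:
  fixes M :: "('n, 'k::field) pvec set"
  assumes "free_mod.subspace M" "M \<subseteq> free_module r" "koszul_dim sh M i g = 0"
  shows "kcycles gr sh M i g = kbounds gr sh M i g"
  by (rule kch.subspace_eq_fin_dim[symmetric, OF subspace_kbounds[OF assms(1)] subspace_kcycles[OF assms(1)]
        bounds_subset_cycles[OF assms(1)] kch.fin_dim_subset[OF fin_dim_kchains[OF assms(2)] cycles_subset_chains]])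
    (use assms(3) in \<open>simp add: koszul_dim_def\<close>)

lemma dim_mcycles:
  assumes L: "monomial_ideal (L :: ('n::finite, 'k::field) mpoly set)"
  shows "kch.dim (mcycles L i j) = betti L i j + kch.dim (mbounds L i j)"
proof -
  have "kch.dim (mbounds L i j) \<le> kch.dim (mcycles L i j)"
    by (rule kch.dim_mono_fin_dim[OF subspace_kbounds[OF subspace_idl[OF L]] subspace_kcycles[OF subspace_idl[OF L]]
        bounds_subset_cycles[OF subspace_idl[OF L]] fin_dim_mcycles])
  then show ?thesis unfolding betti_eq_koszul_dim[OF L] mg.koszul_dim_def by simp
qed

lemma dim_mchains_Suc:
  assumes L: "monomial_ideal (L :: ('n::finite, 'k::field) mpoly set)"
  shows "kch.dim (mchains L (Suc i) j) = kch.dim (mcycles L (Suc i) j) + kch.dim (mbounds L i j)"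
  unfolding kcycles_def kbounds_def
  by (rule vector_space_pair.rank_nullity[OF kch_pair linear_kd subspace_kchains[OF subspace_idl[OF L]] fin_dim_mchains])

lemma betti_eq_0_imp:
  assumes L: "monomial_ideal (L :: ('n::finite, 'k::field) mpoly set)" and "betti L i j = 0"
  shows "mcycles L i j = mbounds L i j"
  using mg.kcycles_eq_kbounds[OF subspace_idl[OF L] idl_subset] assms(2) unfolding betti_eq_koszul_dim[OF L] by blast

lemma mchains_Int: "mchains (J \<inter> K) i j = mchains J i j \<inter> mchains K i j"
  unfolding kchains_def idl_def by blast

lemma mcycles_Int: "mcycles (J \<inter> K) i j = mcycles J i j \<inter> mcycles K i j"
  unfolding kcycles_def mchains_Int by blast

text \<open>In a fixed multidegree the coefficient at S is a multiple of one monomial, so it lies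
  entirely in J or entirely in K, and a chain can be split coefficient by coefficient.\<close>

lemma mchains_add:
  fixes I J K :: "('n::finite, 'k::field) mpoly set"
  assumes I: "monomial_ideal I" and J: "monomial_ideal J" and K: "monomial_ideal K"
    and IJK: "I = {f + g |f g. f \<in> J \<and> g \<in> K}"
  shows "mchains I i j = {x + y |x y. x \<in> mchains J i j \<and> y \<in> mchains K i j}"
proof (intro equalityI subsetI)
  fix c assume c: "c \<in> mchains I i j"
  have either: "c S \<in> idl J \<or> c S \<in> idl K" for S
  proof (cases "c S = 0")
    case True then show ?thesis using free_mod.subspace_0[OF subspace_idl[OF J]] by simp
  next
    case False
    have cS: "c S \<in> idl I" by (rule chainsD(1)[OF c])
    then have fr: "c S \<in> free_module 1" using idl_subset by blast
    obtain b t where bt: "cf (c S) b t \<noteq> 0" using False pvec_eqI[of "c S" 0] by auto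
    have b0: "b = 0" using bt fr by (cases "b = 0") (auto simp: cf_def free_module_iff)
    have uniq: "t' = t" if "cf (c S) 0 t' \<noteq> 0" for t'
    proof -
      have "t' + ind S = t + ind S" using chainsD(3)[OF c that] chainsD(3)[OF c bt] by simp
      then show ?thesis by simp
    qed
    have "monom t \<in> I" using cS bt b0 unfolding idl_iff[OF I] by blast
    then obtain f g where fg: "monom t = f + g" "f \<in> J" "g \<in> K" using IJK by blast
    have "t \<in> Poly_Mapping.keys (f + g)" by (simp flip: fg(1))
    then have "t \<in> Poly_Mapping.keys f \<or> t \<in> Poly_Mapping.keys g"
      using subsetD[OF Poly_Mapping.keys_add[of f g]] by blast
    then have "monom t \<in> J \<or> monom t \<in> K"
      using fg(2,3) monomial_ideal_keys[OF J, of f] monomial_ideal_keys[OF K, of g] by blast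
    then show ?thesis using fr uniq unfolding idl_iff[OF J] idl_iff[OF K] by metis
  qed
  define x where "x S = (if c S \<in> idl J then c S else 0)" for S
  define y where "y S = (if c S \<in> idl J then 0 else c S)" for S
  have "x \<in> mchains J i j"
    by (rule chainsI)
      (use chainsD(2,3)[OF c] free_mod.subspace_0[OF subspace_idl[OF J]] in \<open>auto simp: x_def split: if_splits\<close>)
  moreover have "y \<in> mchains K i j"
  proof (rule chainsI)
    show "y S \<in> idl K" for S using either[of S] free_mod.subspace_0[OF subspace_idl[OF K]] by (auto simp: y_def)
  qed (use chainsD(2,3)[OF c] in \<open>auto simp: y_def split: if_splits\<close>)
  moreover have "c = x + y" by (rule ext) (simp add: x_def y_def)
  ultimately show "c \<in> {x + y |x y. x \<in> mchains J i j \<and> y \<in> mchains K i j}" by blast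
next
  fix c assume "c \<in> {x + y |x y. x \<in> mchains J i j \<and> y \<in> mchains K i j}"
  then obtain x y where xy: "c = x + y" "x \<in> mchains J i j" "y \<in> mchains K i j" by blast
  have "f \<in> I" if "f \<in> J" for f
    unfolding IJK using that monomial_ideal_module(1)[OF K] by (intro CollectI exI[of _ f] exI[of _ 0]) simp
  then have "idl J \<subseteq> idl I" unfolding idl_def by blast
  then have "x \<in> mchains I i j" using chains_mono xy(2) by blast
  have "f \<in> I" if "f \<in> K" for f
    unfolding IJK using that monomial_ideal_module(1)[OF J] by (intro CollectI exI[of _ 0] exI[of _ f]) simp
  then have "idl K \<subseteq> idl I" unfolding idl_def by blast
  then have "y \<in> mchains I i j" using chains_mono xy(3) by blast
  then show "c \<in> mchains I i j"
    unfolding xy(1) using \<open>x \<in> mchains I i j\<close> kch.subspace_add[OF subspace_kchains[OF subspace_idl[OF I]]] by blast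
qed

lemma mbounds_add:
  fixes I J K :: "('n::finite, 'k::field) mpoly set"
  assumes "monomial_ideal I" "monomial_ideal J" "monomial_ideal K" "I = {f + g |f g. f \<in> J \<and> g \<in> K}"
  shows "mbounds I i j = {x + y |x y. x \<in> mbounds J i j \<and> y \<in> mbounds K i j}"
  unfolding kbounds_def mchains_add[OF assms] by (force simp: kd_add)

text \<open>Boundaries of I are always sums of boundaries of J and of K. By \<open>ZJ\<close> and
  \<open>ZK\<close> these two spaces of boundaries intersect in all cycles of J \<inter> K. So the
  dimension formula for boundaries contains the cycles of J \<inter> K, and their excess over its
  boundaries, the homology of J \<inter> K, reappears in I one degree higher.\<close>

lemma betti_mayer_vietoris:
  fixes I J K :: "('n::finite, 'k::field) mpoly set"
  assumes I: "monomial_ideal I" and J: "monomial_ideal J" and K: "monomial_ideal K"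
    and IJK: "I = {f + g |f g. f \<in> J \<and> g \<in> K}"
    and ZJ: "\<And>i. mcycles (J \<inter> K) i j \<subseteq> mbounds J i j"
    and ZK: "\<And>i. mcycles (J \<inter> K) i j \<subseteq> mbounds K i j"
  shows "betti I i j = betti J i j + betti K i j + (case i of 0 \<Rightarrow> 0 | Suc i' \<Rightarrow> betti (J \<inter> K) i' j)"
proof -
  have JK: "monomial_ideal (J \<inter> K)" by (rule monomial_ideal_Int[OF J K])
  have c: "kch.dim (mchains I i j) + kch.dim (mchains (J \<inter> K) i j) = kch.dim (mchains J i j) + kch.dim (mchains K i j)" for i
    unfolding mchains_add[OF I J K IJK] mchains_Int
    by (rule kch.dim_sums_fin_dim[OF subspace_kchains[OF subspace_idl[OF J]] fin_dim_mchains
        subspace_kchains[OF subspace_idl[OF K]] fin_dim_mchains])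
  have int: "mbounds J i j \<inter> mbounds K i j = mcycles (J \<inter> K) i j" for i
    using ZJ[of i] ZK[of i] bounds_subset_cycles[OF subspace_idl[OF J], of "\<lambda>t. t" "\<lambda>_. 0" i j]
      bounds_subset_cycles[OF subspace_idl[OF K], of "\<lambda>t. t" "\<lambda>_. 0" i j]
    unfolding mcycles_Int by blast
  have fdB: "kch.fin_dim (mbounds L i j)" if "monomial_ideal L" for L :: "('n, 'k) mpoly set" and i
    by (rule kch.fin_dim_subset[OF fin_dim_mcycles bounds_subset_cycles[OF subspace_idl[OF that]]])
  have b: "kch.dim (mbounds I i j) + kch.dim (mcycles (J \<inter> K) i j) = kch.dim (mbounds J i j) + kch.dim (mbounds K i j)" for i
    unfolding mbounds_add[OF I J K IJK] int[symmetric]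
    by (rule kch.dim_sums_fin_dim[OF subspace_kbounds[OF subspace_idl[OF J]] fdB[OF J]
        subspace_kbounds[OF subspace_idl[OF K]] fdB[OF K]])
  note z = dim_mcycles[OF I, of _ j] dim_mcycles[OF J, of _ j] dim_mcycles[OF K, of _ j] dim_mcycles[OF JK, of _ j]
  show ?thesis
  proof (cases i)
    case 0
    have "kch.dim (mcycles L 0 j) = kch.dim (mchains L 0 j)" if "monomial_ideal L" for L :: "('n, 'k) mpoly set"
      by (simp add: cycles_0[OF subspace_idl[OF that]])
    from this[OF I] this[OF J] this[OF K] this[OF JK] show ?thesis
      using z[of 0] b[of 0] c[of 0] 0 by simp
  next
    case (Suc i')
    show ?thesis
      using z[of i] z[of i'] b[of i] b[of i'] c[of i] dim_mchains_Suc[OF I, of i' j] dim_mchains_Suc[OF J, of i' j]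
        dim_mchains_Suc[OF K, of i' j] dim_mchains_Suc[OF JK, of i' j] Suc by simp
  qed
qed

text \<open>Since \<open>x\<^sub>p\<close> does not occur in the generators of \<open>K\<close>, the homotopy in direction \<open>p\<close> preserves the
  Koszul complex of \<open>K\<close>, and it contracts the strands of degree \<open>j\<close> with \<open>j\<^sub>p > 0\<close>.\<close>

lemma mcycles_eq_mbounds_cone:
  fixes K :: "('n::finite, 'k::field) mpoly set"
  assumes K: "K = ideal_span (monom ` A)" and A: "\<And>a. a \<in> A \<Longrightarrow> Poly_Mapping.lookup a p = 0"
    and j: "Poly_Mapping.lookup j p > 0"
  shows "mcycles K i j = mbounds K i j"
proof
  have mK: "monomial_ideal K" unfolding K by (rule monomial_ideal_span)
  have div: "divx p v \<in> idl K" if v: "v \<in> idl K" for v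
    unfolding idl_iff[OF mK]
  proof (intro conjI allI impI)
    show "divx p v \<in> free_module 1" by (rule divx_free_module[OF subsetD[OF idl_subset v]])
    fix t assume "cf (divx p v) 0 t \<noteq> 0"
    then have "monom (ei p + t) \<in> K" using v unfolding idl_iff[OF mK] by simp
    then obtain a u where au: "a \<in> A" "ei p + t = a + u" unfolding K by (rule monom_in_ideal_spanE)
    have "Poly_Mapping.lookup (ei p + t) p = Poly_Mapping.lookup (a + u) p" by (simp add: au(2))
    \<comment> \<open>The generator x^a does not involve x_p, so x_p divides the cofactor and can be
      cancelled there.\<close>
    then have "Poly_Mapping.lookup u p > 0" using A[OF au(1)] by (simp add: lookup_add lookup_ei)
    then have "\<exists>u'. u = ei p + u'" by (intro exI[of _ "u - ei p"] exponent_decompose)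
    then obtain u' where "u = ei p + u'" by (elim exE)
    then have "ei p + t = ei p + (a + u')" using au(2) by (simp add: add.left_commute)
    then have "t = a + u'" by simp
    then show "monom t \<in> K" unfolding K monom_in_ideal_span_iff using au(1) by blast
  qed
  show "mcycles K i j \<subseteq> mbounds K i j"
  proof
    fix c assume c: "c \<in> mcycles K i j"
    then have cc: "c \<in> mchains K i j" and dc: "kd c = 0" by (simp_all add: kcycles_def)
    have "kd (kh p c) = c"
    proof (rule ext)
      fix S
      have "scale (var p) (divx p (c S)) = c S" if "p \<notin> S"
      proof (rule pvec_eqI)
        fix b t
        \<comment> \<open>As p is not in S, all of j_p comes from t, so division by x_p loses
          nothing.\<close>
        have "Poly_Mapping.lookup t p > 0" if nz: "cf (c S) b t \<noteq> 0"
        proof -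
          have "j = t + ind S" using chainsD(3)[OF cc nz] by simp
          then show ?thesis using j \<open>p \<notin> S\<close> by (simp add: lookup_add lookup_ind)
        qed
        then show "cf (scale (var p) (divx p (c S))) b t = cf (c S) b t"
          by (cases "cf (c S) b t = 0") (simp_all add: cf_var_divx)
      qed
      then show "kd (kh p c) S = c S" using kh_homotopy[of p c S] dc by simp
    qed
    moreover have "kh p c \<in> mchains K (Suc i) j" by (rule kh_chains[OF subspace_idl[OF mK] div cc])
    ultimately show "c \<in> mbounds K i j" unfolding kbounds_def by (metis imageI)
  qed
  show "mbounds K i j \<subseteq> mcycles K i j" by (rule bounds_subset_cycles[OF subspace_idl[OF mK]])
qed

section \<open>Degree bounds and linear resolutions\<close>

lemma total_degree_ind: "total_degree (ind S) = card S"
proof -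
  have "total_degree (ind S) = (\<Sum>v\<in>UNIV. if v \<in> S then 1 else 0)" by (simp add: total_degree_def lookup_ind)
  also have "\<dots> = card S" by (simp add: sum.If_cases)
  finally show ?thesis .
qed

text \<open>In exterior degree i the element e_S contributes exactly i and its coefficient at least
  \<open>e\<close>, so there are no nonzero chains below i + e.\<close>

lemma betti_pos_degree:
  assumes L: "monomial_ideal (L :: ('n::finite, 'k::field) mpoly set)"
    and d: "\<And>t. monom t \<in> L \<Longrightarrow> e \<le> total_degree t"
    and pos: "betti L i j > 0"
  shows "i + e \<le> total_degree j"
proof (rule ccontr)
  assume small: "\<not> i + e \<le> total_degree j"
  have "c = 0" if c: "c \<in> mcycles L i j" for c
  proof (rule ext, rule pvec_eqI)
    fix S b t
    have cc: "c \<in> mchains L i j" using c by (simp add: kcycles_def)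
    show "cf (c S) b t = cf (0 S) b t"
    proof (rule ccontr)
      assume "cf (c S) b t \<noteq> cf (0 S) b t"
      then have nz: "cf (c S) b t \<noteq> 0" by simp
      have cS: "c S \<in> idl L" by (rule chainsD(1)[OF cc])
      then have "c S \<in> free_module 1" using idl_subset by blast
      then have "b = 0" using nz by (cases "b = 0") (auto simp: cf_def free_module_iff)
      then have "e \<le> total_degree t" using cS nz d unfolding idl_iff[OF L] by blast
      moreover have "card S = i"
      proof (rule ccontr)
        assume "card S \<noteq> i"
        then have "c S = 0" by (rule chainsD(2)[OF cc])
        then show False using nz by simp
      qed
      moreover have "j = t + ind S" using chainsD(3)[OF cc nz] by simp
      ultimately show False using small by (simp add: total_degree_add total_degree_ind)
    qed
  qed
  then have "mcycles L i j \<subseteq> kch.span {}" by (auto simp: kch.span_empty)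
  then have "kch.dim (mcycles L i j) \<le> card ({} :: ('n, 'k) kchain set)" by (rule kch.dim_le_card) simp
  then show False using pos dim_mcycles[OF L, of i j] by simp
qed

lemma prj_kd:
  "kd (\<lambda>S. prj (\<lambda>b t. t + ind S = j) (w S)) T = prj (\<lambda>b t. t + ind T = j) (kd w T)"
proof (rule pvec_eqI)
  fix b t
  have "cf (ksgn s T (scale (var s) (prj (\<lambda>b t. t + ind (insert s T) = j) (w (insert s T))))) b t
    = (if t + ind T = j then cf (ksgn s T (scale (var s) (w (insert s T)))) b t else 0)" if "s \<in> -T" for s
  proof (cases "Poly_Mapping.lookup t s > 0")
    case True
    have "t - ei s + ind (insert s T) = ei s + (t - ei s) + ind T"
      using that by (simp add: ind_insert algebra_simps)
    then have "t - ei s + ind (insert s T) = t + ind T" using exponent_decompose[OF True] by simp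
    then show ?thesis using True by (simp add: ksgn_def cf_scale_var)
  qed (simp add: ksgn_def cf_scale_var)
  then show "cf (kd (\<lambda>S. prj (\<lambda>b t. t + ind S = j) (w S)) T) b t = cf (prj (\<lambda>b t. t + ind T = j) (kd w T)) b t"
    by (simp add: kd_def cf_sum)
qed

text \<open>The strand of multidegree j is a direct summand of the strand of the same total degree:
  if w bounds a cycle of multidegree j, so does its component of multidegree j. Thus vanishing seen
  by a resolution graded by total degree carries over to multigraded Betti numbers.\<close>

lemma betti_eq_0_if_total_koszul_dim_eq_0:
  assumes L: "monomial_ideal (L :: ('n::finite, 'k::field) mpoly set)"
    and 0: "tg.koszul_dim (\<lambda>_. 0) (idl L) i (total_degree j) = 0"
  shows "betti L i j = 0"
proof -
  have "mcycles L i j \<subseteq> mbounds L i j"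
  proof
    fix z assume z: "z \<in> mcycles L i j"
    then have zc: "z \<in> mchains L i j" and dz: "kd z = 0" by (simp_all add: kcycles_def)
    have "z \<in> kchains total_degree (\<lambda>_. 0) (idl L) i (total_degree j)"
      by (rule chainsI) (use chainsD[OF zc] in auto)
    then have "z \<in> kbounds total_degree (\<lambda>_. 0) (idl L) i (total_degree j)"
      using tg.kcycles_eq_kbounds[OF subspace_idl[OF L] idl_subset 0] dz by (auto simp: kcycles_def)
    then obtain w where w: "w \<in> kchains total_degree (\<lambda>_. 0) (idl L) (Suc i) (total_degree j)" "z = kd w"
      unfolding kbounds_def by blast
    define w' where "w' S = prj (\<lambda>b t. t + ind S = j) (w S)" for S
    have "w' \<in> mchains L (Suc i) j"
    proof (rule chainsI)
      show "w' S \<in> idl L" for S unfolding w'_def by (rule prj_idl[OF L chainsD(1)[OF w(1)]])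
      show "w' S = 0" if "card S \<noteq> Suc i" for S
        using chainsD(2)[OF w(1) that] by (intro pvec_eqI) (simp add: w'_def)
      show "t + ind S + 0 = j" if "cf (w' S) b t \<noteq> 0" for S b t
        using that by (simp add: w'_def split: if_splits)
    qed
    moreover have "kd w' = z"
    proof (rule ext, rule pvec_eqI)
      fix T b t
      have "kd w' T = prj (\<lambda>b t. t + ind T = j) (z T)"
        using prj_kd[of j w T] unfolding w'_def w(2) .
      then show "cf (kd w' T) b t = cf (z T) b t" using chainsD(3)[OF zc, of T b t] by auto
    qed
    ultimately show "z \<in> mbounds L i j" unfolding kbounds_def by blast
  qed
  then have "mcycles L i j = mbounds L i j" using bounds_subset_cycles[OF subspace_idl[OF L]] by blast
  then show ?thesis unfolding betti_eq_koszul_dim[OF L] mg.koszul_dim_def by simp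
qed

text \<open>The i-th free module has basis elements in degree i + d only, so its fiber in any other
  degree is zero, and Tor with it.\<close>

lemma linear_resolution_betti:
  fixes J :: "('n::finite, 'k::field) mpoly set"
  assumes J: "monomial_ideal J"
    and F: "graded_free_resolution total_degree F J" "\<And>i b. b < frank F i \<Longrightarrow> shift F i b = i + d"
    and deg: "total_degree j \<noteq> i + d"
  shows "betti J i j = 0"
proof (rule betti_eq_0_if_total_koszul_dim_eq_0[OF J])
  have "fiber F i (total_degree j) \<subseteq> free_mod.span {}"
  proof
    fix v assume v: "v \<in> fiber F i (total_degree j)"
    have "Poly_Mapping.keys v = {}"
    proof (rule equals0I)
      fix b assume "b \<in> Poly_Mapping.keys v"
      then have "b < frank F i" "shift F i b = total_degree j" using v unfolding fiber_def by blast+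
      then show False using F(2)[of b i] deg by simp
    qed
    then show "v \<in> free_mod.span {}" by (simp add: free_mod.span_empty)
  qed
  then have "fiber_cycles F i (total_degree j) \<subseteq> free_mod.span {}"
    unfolding fiber_cycles_def by blast
  then have "fin_vec.dim (fiber_cycles F i (total_degree j)) \<le> card ({} :: (nat \<Rightarrow>\<^sub>0 'k) set)"
    by (rule fin_vec.dim_le_card) simp
  then show "tg.koszul_dim (\<lambda>_. 0) (idl J) i (total_degree j) = 0"
    unfolding tg.koszul_dim_eq_tor_dim[OF F(1)] tor_dim_def by simp
qed

text \<open>Polynomials without terms of degree below d form an ideal, and it contains the
  generators.\<close>

lemma generated_in_degree_le:
  fixes L :: "('n::finite, 'k::field) mpoly set"
  assumes "generated_in_degree d L" "f \<in> L" "t \<in> Poly_Mapping.keys f"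
  shows "d \<le> total_degree t"
proof -
  let ?U = "{f :: ('n, 'k) mpoly. \<forall>t\<in>Poly_Mapping.keys f. d \<le> total_degree t}"
  have "module.subspace (*) ?U"
  proof (rule module.subspaceI[OF module_times])
    show "x + y \<in> ?U" if "x \<in> ?U" "y \<in> ?U" for x y
      using that Poly_Mapping.keys_add[of x y] by blast
    show "c * x \<in> ?U" if x: "x \<in> ?U" for c x
    proof (intro CollectI ballI)
      fix t assume "t \<in> Poly_Mapping.keys (c * x)"
      then obtain s u where "u \<in> Poly_Mapping.keys x" "t = s + u" by (rule keys_mult_exponent)
      then show "d \<le> total_degree t" using x by (auto simp: total_degree_add intro: trans_le_add2)
    qed
  qed simp
  moreover have "{f \<in> L. homogeneous total_degree d f} \<subseteq> ?U" by (auto simp: homogeneous_def)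
  ultimately have "ideal_span {f \<in> L. homogeneous total_degree d f} \<subseteq> ?U"
    unfolding ideal_span_def by (intro module.span_minimal[OF module_times])
  then have "L \<subseteq> ?U" using assms(1) unfolding generated_in_degree_def by simp
  then show ?thesis using assms(2,3) by blast
qed

section \<open>The splitting theorem\<close>

theorem corollary2p7:
  fixes I J K :: "('n::finite, 'k::field) mpoly set" and p :: 'n
  assumes "monomial_ideal I"
    and "x_partition p I J K"
    and "\<forall>f\<in>J. var p dvd f"
  shows "((\<forall>i j. betti (J \<inter> K) i j > 0 \<longrightarrow> betti J i j = 0) \<longrightarrow> betti_splitting I J K) \<and>
    (has_linear_resolution J \<longrightarrow> betti_splitting I J K)"
proof -
  note I = assms(1)
  define A where "A = min_exps I"
  define AJ where "AJ = {a \<in> A. Poly_Mapping.lookup a p > 0}"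
  define AK where "AK = {a \<in> A. Poly_Mapping.lookup a p = 0}"
  have gI: "mingens I = monom ` A" unfolding A_def by (rule mingens_eq[OF I])
  have "{m \<in> mingens I. var p dvd m} = monom ` AJ" "{m \<in> mingens I. \<not> var p dvd m} = monom ` AK"
    unfolding gI AJ_def AK_def by (auto simp: var_dvd_monom_iff)
  then have JA: "J = ideal_span (monom ` AJ)" and KA: "K = ideal_span (monom ` AK)"
    using assms(2) unfolding x_partition_def by simp_all
  have J: "monomial_ideal J" and K: "monomial_ideal K" unfolding JA KA by (rule monomial_ideal_span)+
  have JK: "monomial_ideal (J \<inter> K)" by (rule monomial_ideal_Int[OF J K])
  have AJK: "AJ \<union> AK = A" "AJ \<inter> AK = {}" "AJ \<subseteq> min_exps I" "AK \<subseteq> min_exps I"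
    unfolding AJ_def AK_def A_def by auto
  have gJ: "mingens J = monom ` AJ" and gK: "mingens K = monom ` AK"
    using mingens_eq[OF J] mingens_eq[OF K] min_exps_subset[OF AJK(3)] min_exps_subset[OF AJK(4)]
    unfolding JA KA by simp_all
  have "I = ideal_span (monom ` AJ \<union> monom ` AK)"
    using ideal_span_min_exps[OF I] unfolding image_Un[symmetric] AJK(1) A_def by simp
  also have "\<dots> = {f + g |f g. f \<in> J \<and> g \<in> K}"
    unfolding JA KA ideal_span_def by (rule module.span_Un[OF module_times])
  finally have IJK: "I = {f + g |f g. f \<in> J \<and> g \<in> K}" .
  have pJ: "Poly_Mapping.lookup t p > 0" if "monom t \<in> J" for t
  proof -
    obtain a u where "a \<in> AJ" "t = a + u" using \<open>monom t \<in> J\<close> unfolding JA by (rule monom_in_ideal_spanE)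
    then show ?thesis by (simp add: AJ_def lookup_add)
  qed
  have ZK: "mcycles (J \<inter> K) i j \<subseteq> mbounds K i j" for i j
  proof (cases "Poly_Mapping.lookup j p > 0")
    case True
    have "mcycles K i j = mbounds K i j"
      by (rule mcycles_eq_mbounds_cone[OF KA _ True]) (simp add: AK_def)
    then show ?thesis unfolding mcycles_Int by blast
  next
    case False
    \<comment> \<open>All monomials of J involve x_p, so J \<inter> K has no nonzero chains in
      multidegrees with j_p = 0.\<close>
    have "c = 0" if "c \<in> mcycles (J \<inter> K) i j" for c
    proof (rule ext, rule pvec_eqI, rule ccontr)
      fix S b t
      assume "cf (c S) b t \<noteq> cf (0 S) b t"
      then have nz: "cf (c S) b t \<noteq> 0" by simp
      have cc: "c \<in> mchains (J \<inter> K) i j" using \<open>c \<in> mcycles (J \<inter> K) i j\<close> by (simp add: kcycles_def)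
      have cS: "c S \<in> idl (J \<inter> K)" by (rule chainsD(1)[OF cc])
      then have "c S \<in> free_module 1" using idl_subset by blast
      then have "b = 0" using nz by (cases "b = 0") (auto simp: cf_def free_module_iff)
      then have "monom t \<in> J" using cS nz unfolding idl_iff[OF JK] by blast
      moreover have "j = t + ind S" using chainsD(3)[OF cc nz] by simp
      ultimately show False using pJ[of t] False by (simp add: lookup_add)
    qed
    then show ?thesis using kch.subspace_0[OF subspace_kbounds[OF subspace_idl[OF K]]] by blast
  qed
  have main: "betti_splitting I J K" if h: "\<forall>i j. betti (J \<inter> K) i j > 0 \<longrightarrow> betti J i j = 0"
  proof -
    \<comment> \<open>Either the cycles of J \<inter> K already bound there, or all cycles of J
      bound in J.\<close>
    have ZJ: "mcycles (J \<inter> K) i j \<subseteq> mbounds J i j" for i j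
    proof (cases "betti (J \<inter> K) i j = 0")
      case True
      have "idl (J \<inter> K) \<subseteq> idl J" by (auto simp: idl_def)
      then show ?thesis using betti_eq_0_imp[OF JK True] bounds_mono[of "idl (J \<inter> K)" "idl J"] by blast
    next
      case False
      then have "mcycles J i j = mbounds J i j" using h by (intro betti_eq_0_imp[OF J]) simp
      then show ?thesis unfolding mcycles_Int by blast
    qed
    have "betti I i j = betti J i j + betti K i j + (case i of 0 \<Rightarrow> 0 | Suc i' \<Rightarrow> betti (J \<inter> K) i' j)" for i j
      by (rule betti_mayer_vietoris[OF I J K IJK ZJ ZK])
    moreover have "mingens I = mingens J \<union> mingens K" unfolding gI gJ gK using AJK(1) by blast
    moreover have "mingens J \<inter> mingens K = {}" unfolding gJ gK using AJK(2) by auto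
    ultimately show ?thesis unfolding betti_splitting_def using I J K IJK by blast
  qed
  moreover have "betti J i j = 0" if lin: "has_linear_resolution J" and pos: "betti (J \<inter> K) i j > 0" for i j
  proof -
    obtain d and F :: "(nat, 'n, 'k) free_seq" where d: "generated_in_degree d J"
      and F: "minimal_resolution total_degree F J" "\<forall>i. \<forall>b < frank F i. shift F i b = i + d"
      using lin unfolding has_linear_resolution_def by blast
    \<comment> \<open>A monomial of J \<inter> K of degree at most d would be a minimal generator of
      I divisible by x_p and, being a multiple of a generator in \<open>AK\<close>, equal to that
      one.\<close>
    have "Suc d \<le> total_degree t" if t: "monom t \<in> J \<inter> K" for t
    proof (rule ccontr)
      assume small: "\<not> Suc d \<le> total_degree t"
      have "(monom t :: ('n, 'k) mpoly) \<in> ideal_span (monom ` AJ)" using t JA by blast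
      then obtain a u where a: "a \<in> AJ" "t = a + u" by (rule monom_in_ideal_spanE)
      have "(monom t :: ('n, 'k) mpoly) \<in> ideal_span (monom ` AK)" using t KA by blast
      then obtain b w where b: "b \<in> AK" "t = b + w" by (rule monom_in_ideal_spanE)
      have "monom a \<in> J" unfolding JA using a(1) by (intro ideal_span_base) blast
      then have "d \<le> total_degree a" by (rule generated_in_degree_le[OF d]) simp
      then have "total_degree u = 0" using small a(2) by (simp add: total_degree_add)
      then have "t = a" using a(2) by (simp add: total_degree_eq_0)
      then have "t \<in> min_exps I" using a(1) AJK(3) by blast
      moreover have "monom b \<in> I" using min_expsD(1) b(1) AJK(4) by blast
      ultimately have "w = 0" using b(2) by (intro min_expsD(2))
      then show False using a(1) b \<open>t = a\<close> AJK(2) by auto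
    qed
    \<comment> \<open>The extra 1 separates the degrees: at step i the Betti numbers of J live in
      total degree i + d.\<close>
    then have "i + Suc d \<le> total_degree j" by (rule betti_pos_degree[OF JK _ pos])
    then show ?thesis
      using F by (intro linear_resolution_betti[OF J, of F d]) (simp_all add: minimal_resolution_def)
  qed
  ultimately show ?thesis by blast
qed

end
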